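(* Let $G=SL_n(\mathbb{C})$ and let $\phi:T^*G/B=G\times^B\underline{b}_u\rightarrow \mathcal{G}/\mathcal{B}$ be the map $$\phi(g,Y)=g\,(Id+t^{-1}Y+t^{-2}Y^2+\cdots)\ (\mathrm{mod}\ \mathcal{B}),\qquad g\in G,\ Y\in\underline{b}_u .$$ Then $\phi$ identifies $\overline{T^*G/B}$ with a $G$-stable closed subvariety of the affine Schubert variety $X(\kappa_0)$; that is, identifying $T^*G/B$ with its image under the injective map $\phi$, the closure $\overline{T^*G/B}=\overline{\phi(T^*G/B)}$ taken in $\mathcal{G}/\mathcal{B}$ is a closed subvariety of $\mathcal{G}/\mathcal{B}$ that is stable under left multiplication by $G$ and is contained in $X(\kappa_0)$.
   Context: Let $n\ge 2$, $K=\mathbb{C}$, $A=K[[t]]$, $F=K((t))$, $G=SL_n(K)$, $T$ the diagonal torus of $G$, $B$ the Borel subgroup of upper triangular matrices, $\underline{b}_u$ the Lie algebra of its unipotent radical (strictly upper triangular matrices). Put $\mathcal{G}=SL_n(F)$, $G_0=SL_n(A)$, and let $\mathcal{B}\subset G_0$ be the preimage of $B$ under $G_0\to G$, $t\mapsto 0$. The affine flag variety $\mathcal{G}/\mathcal{B}$ carries its usual ind-variety structure. The cotangent bundle is $T^*G/B=G\times^B\underline{b}_u=(G\times\underline{b}_u)/\sim$, where $(g,Y)\sim(gb,b^{-1}Yb)$ for $b\in B$. The sum defining $\phi$ is finite since $Y$ is nilpotent, and $\phi$ is well defined and injective. The affine Weyl group is $\widehat{W}=N(K[t,t^{-1}])/T$,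 $N$ being the normalizer of $T$ in $G$. It is a Coxeter group with generators $s_0,\dots,s_{n-1}$, where for $1\le i\le n-1$, $s_i$ is represented by the matrix with $1$ at $(i,i+1)$, $-1$ at $(i+1,i)$, $1$ at $(j,j)$ for $j\neq i,i+1$, and $0$ elsewhere, and $s_0$ by the matrix with $t^{-1}$ at $(1,n)$, $-t$ at $(n,1)$, $1$ at $(j,j)$ for $j\ne 1,n$, and $0$ elsewhere. For $w\in\widehat{W}$ the affine Schubert variety is $X(w)=\bigcup_{\tau'\le w}\mathcal{B}\tau'\mathcal{B}\ (\mathrm{mod}\ \mathcal{B})\subset\mathcal{G}/\mathcal{B}$ (union over the Bruhat order). Put $\tau=s_{n-1}\cdots s_2s_1s_0$ and $\kappa_0=w'\tau^{n-1}$, where $w'$ is the longest element of the (finite) subgroup of $\widehat{W}$ generated by $s_1,\dots,s_{n-2}$. *)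

theory Defs
  imports
    "Jordan_Normal_Form.Determinant"
    "HOL-Computational_Algebra.Formal_Laurent_Series"
    "HOL-Algebra.Group_Action"
    "HOL-Algebra.Generated_Groups"
    "HOL-Algebra.Left_Coset"
    "HOL-Analysis.Abstract_Topology"
begin

text \<open>
  Matrix indices run from \<open>0\<close> to \<open>n - 1\<close>; \<open>F = K((t))\<close> is the type \<^typ>\<open>complex fls\<close>.
\<close>

no_notation fls_nth (infixl "$$" 75)
no_notation fps_nth (infixl "$" 75)

section \<open>Special linear groups and their subgroups\<close>

definition SL :: "nat \<Rightarrow> 'a::field mat monoid" where
  "SL n = \<lparr>carrier = {A \<in> carrier_mat n n. det A = 1}, monoid.mult = (*), one = 1\<^sub>m n\<rparr>"

abbreviation SLK :: "nat \<Rightarrow> complex mat monoid" where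
  "SLK \<equiv> SL"

abbreviation SLF :: "nat \<Rightarrow> complex fls mat monoid" where
  "SLF \<equiv> SL"

definition torus :: "nat \<Rightarrow> complex mat set" where
  "torus n = {g \<in> carrier (SLK n). diagonal_mat g}"

definition borel :: "nat \<Rightarrow> complex mat set" where
  "borel n = {g \<in> carrier (SLK n). upper_triangular g}"

definition borel_nilradical :: "nat \<Rightarrow> complex mat set" where
  "borel_nilradical n = {Y \<in> carrier_mat n n. \<forall>i<n. \<forall>j\<le>i. Y $$ (i, j) = 0}"

text \<open>The inclusion of constant matrices.\<close>

definition const_loop :: "complex mat \<Rightarrow> complex fls mat" where
  "const_loop = map_mat fls_const"

definition power_series_mats :: "nat \<Rightarrow> complex fls mat set" where
  "power_series_mats n = {g \<in> carrier_mat n n. \<forall>i<n. \<forall>j<n. \<forall>k<0. fls_nth (g $$ (i, j)) k = 0}"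

definition iwahori :: "nat \<Rightarrow> complex fls mat set" where
  "iwahori n = {g \<in> carrier (SLF n) \<inter> power_series_mats n. map_mat (\<lambda>f. fls_nth f 0) g \<in> borel n}"

section \<open>The affine flag variety\<close>

definition affine_flags :: "nat \<Rightarrow> complex fls mat set set" where
  "affine_flags n = lcosets\<^bsub>SLF n\<^esub> (iwahori n)"

definition flag_point :: "nat \<Rightarrow> complex fls mat \<Rightarrow> complex fls mat set" where
  "flag_point n g = g <#\<^bsub>SLF n\<^esub> iwahori n"

text \<open>
  \<open>SL\<^sub>n(F)\<close> is an ind-scheme: it is the union of the affine schemes \<open>loop_stage n N\<close> of matrices
  with poles of order at most \<open>N\<close>, whose regular functions are the polynomials in the (finitely
  many at a time) Laurent coefficients of the entries.  A subset is closed iff its intersection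
  with every stage is the zero set of a set of regular functions.  The affine flag variety, as the
  quotient ind-variety, carries the quotient topology.
\<close>

definition loop_stage :: "nat \<Rightarrow> nat \<Rightarrow> complex fls mat set" where
  "loop_stage n N =
     {g \<in> carrier (SLF n). \<forall>i<n. \<forall>j<n. \<forall>k < - int N. fls_nth (g $$ (i, j)) k = 0}"

inductive_set loop_regular :: "nat \<Rightarrow> (complex fls mat \<Rightarrow> complex) set" for n where
  const: "(\<lambda>_. c) \<in> loop_regular n"
| coeff: "i < n \<Longrightarrow> j < n \<Longrightarrow> (\<lambda>g. fls_nth (g $$ (i, j)) k) \<in> loop_regular n"
| add: "p \<in> loop_regular n \<Longrightarrow> q \<in> loop_regular n \<Longrightarrow> (\<lambda>g. p g + q g) \<in> loop_regular n"
| mult: "p \<in> loop_regular n \<Longrightarrow> q \<in> loop_regular n \<Longrightarrow> (\<lambda>g. p g * q g) \<in> loop_regular n"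

definition loop_zeros :: "nat \<Rightarrow> nat \<Rightarrow> (complex fls mat \<Rightarrow> complex) set \<Rightarrow> complex fls mat set" where
  "loop_zeros n N P = {g \<in> loop_stage n N. \<forall>p\<in>P. p g = 0}"

definition loop_open :: "nat \<Rightarrow> complex fls mat set \<Rightarrow> bool" where
  "loop_open n U \<longleftrightarrow> U \<subseteq> carrier (SLF n) \<and>
     (\<forall>N. \<exists>P \<subseteq> loop_regular n. loop_stage n N - U = loop_zeros n N P)"

definition loop_topology :: "nat \<Rightarrow> complex fls mat topology" where
  "loop_topology n = topology (loop_open n)"

definition affine_flag_topology :: "nat \<Rightarrow> complex fls mat set topology" where
  "affine_flag_topology n = topology (\<lambda>U. U \<subseteq> affine_flags n \<and>
     openin (loop_topology n) {g \<in> carrier (SLF n). flag_point n g \<in> U})"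

lemma mem_loop_zeros: "g \<in> loop_zeros n N P \<longleftrightarrow> g \<in> loop_stage n N \<and> (\<forall>p\<in>P. p g = 0)"
  unfolding loop_zeros_def by (rule mem_Collect_eq)

lemma loop_zeros_Un:
  "loop_zeros n N P \<union> loop_zeros n N Q = loop_zeros n N ((\<lambda>(p, q). (\<lambda>g. p g * q g)) ` (P \<times> Q))"
  (is "_ = loop_zeros n N ?R")
proof (rule Set.set_eqI)
  fix g
  have "(\<forall>r\<in>?R. r g = 0) \<longleftrightarrow> (\<forall>p\<in>P. \<forall>q\<in>Q. p g * q g = 0)"
    by (simp only: ball_simps split_paired_Ball_Sigma prod.case)
  also have "\<dots> \<longleftrightarrow> (\<forall>p\<in>P. p g = 0) \<or> (\<forall>q\<in>Q. q g = 0)"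
    unfolding mult_eq_0_iff by blast
  finally show "g \<in> loop_zeros n N P \<union> loop_zeros n N Q \<longleftrightarrow> g \<in> loop_zeros n N ?R"
    unfolding Un_iff mem_loop_zeros by blast
qed

lemma loop_zeros_UN:
  "g \<in> loop_zeros n N (\<Union>U\<in>\<K>. P U) \<longleftrightarrow> g \<in> loop_stage n N \<and> (\<forall>U\<in>\<K>. g \<in> loop_zeros n N (P U))"
  unfolding mem_loop_zeros ball_UN by blast

lemma istopology_loop_open: "istopology (loop_open n)"
  unfolding istopology_def
proof (intro conjI allI impI)
  fix S T assume S: "loop_open n S" and T: "loop_open n T"
  have "\<exists>R \<subseteq> loop_regular n. loop_stage n N - S \<inter> T = loop_zeros n N R" for N
  proof -
    obtain P where P: "P \<subseteq> loop_regular n" "loop_stage n N - S = loop_zeros n N P"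
      using S unfolding loop_open_def by blast
    obtain Q where Q: "Q \<subseteq> loop_regular n" "loop_stage n N - T = loop_zeros n N Q"
      using T unfolding loop_open_def by blast
    have "(\<lambda>(p, q). (\<lambda>g. p g * q g)) ` (P \<times> Q) \<subseteq> loop_regular n"
      using P(1) Q(1) by (auto intro: loop_regular.mult)
    then show ?thesis
      unfolding Diff_Int P(2) Q(2) loop_zeros_Un by blast
  qed
  moreover have "S \<inter> T \<subseteq> carrier (SLF n)"
    using S unfolding loop_open_def by blast
  ultimately show "loop_open n (S \<inter> T)"
    unfolding loop_open_def by simp
next
  fix \<K> assume K: "\<forall>U\<in>\<K>. loop_open n U"
  have "\<exists>R \<subseteq> loop_regular n. loop_stage n N - \<Union>\<K> = loop_zeros n N R" for N
  proof -
    have "\<forall>U\<in>\<K>. \<exists>P. P \<subseteq> loop_regular n \<and> loop_stage n N - U = loop_zeros n N P"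
      using K unfolding loop_open_def by blast
    then obtain P where
      P: "\<forall>U\<in>\<K>. P U \<subseteq> loop_regular n \<and> loop_stage n N - U = loop_zeros n N (P U)"
      by (rule bchoice[THEN exE])
    have "g \<in> loop_stage n N - \<Union>\<K> \<longleftrightarrow> g \<in> loop_zeros n N (\<Union>U\<in>\<K>. P U)" for g
    proof -
      have "g \<in> loop_stage n N - \<Union>\<K> \<longleftrightarrow> g \<in> loop_stage n N \<and> (\<forall>U\<in>\<K>. g \<in> loop_stage n N - U)"
        by blast
      also have "\<dots> \<longleftrightarrow> g \<in> loop_zeros n N (\<Union>U\<in>\<K>. P U)"
        unfolding loop_zeros_UN using P by simp
      finally show ?thesis .
    qed
    then have "loop_stage n N - \<Union>\<K> = loop_zeros n N (\<Union>U\<in>\<K>. P U)"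
      by (rule Set.set_eqI)
    moreover have "(\<Union>U\<in>\<K>. P U) \<subseteq> loop_regular n"
      using P by (simp add: UN_least)
    ultimately show ?thesis by blast
  qed
  moreover have "\<Union>\<K> \<subseteq> carrier (SLF n)"
    using K unfolding loop_open_def by blast
  ultimately show "loop_open n (\<Union>\<K>)"
    unfolding loop_open_def by simp
qed

lemma openin_loop_topology: "openin (loop_topology n) U \<longleftrightarrow> loop_open n U"
  unfolding loop_topology_def by (simp add: topology_inverse'[OF istopology_loop_open])

lemma topspace_loop_topology: "topspace (loop_topology n) = carrier (SLF n)"
proof -
  have "loop_stage n N - carrier (SLF n) = loop_zeros n N {\<lambda>_. 1}" for N
    by (rule Set.set_eqI) (simp add: mem_loop_zeros loop_stage_def)
  moreover have "{\<lambda>_. 1} \<subseteq> loop_regular n"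
    by (simp add: loop_regular.const)
  ultimately have "loop_open n (carrier (SLF n))"
    unfolding loop_open_def by (intro conjI subset_refl allI exI[of _ "{\<lambda>_. 1}"])
  moreover have "U \<subseteq> carrier (SLF n)" if "loop_open n U" for U
    using that unfolding loop_open_def by (rule conjunct1)
  ultimately show ?thesis
    unfolding topspace_def openin_loop_topology by blast
qed

lemma openin_affine_flag_topology:
  "openin (affine_flag_topology n) U \<longleftrightarrow> U \<subseteq> affine_flags n \<and>
     openin (loop_topology n) {g \<in> carrier (SLF n). flag_point n g \<in> U}"
proof -
  let ?pre = "\<lambda>U. {g \<in> carrier (SLF n). flag_point n g \<in> U}"
  have "istopology (\<lambda>U. U \<subseteq> affine_flags n \<and> openin (loop_topology n) (?pre U))"
    unfolding istopology_def
  proof (intro conjI allI impI)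
    fix S T
    assume "S \<subseteq> affine_flags n \<and> openin (loop_topology n) (?pre S)"
      and "T \<subseteq> affine_flags n \<and> openin (loop_topology n) (?pre T)"
    moreover have "?pre (S \<inter> T) = ?pre S \<inter> ?pre T" by blast
    ultimately show "S \<inter> T \<subseteq> affine_flags n" "openin (loop_topology n) (?pre (S \<inter> T))"
      by (simp_all add: le_infI1 openin_Int)
  next
    fix \<K>
    assume K: "\<forall>U\<in>\<K>. U \<subseteq> affine_flags n \<and> openin (loop_topology n) (?pre U)"
    have "?pre (\<Union>\<K>) = (\<Union>U\<in>\<K>. ?pre U)" by blast
    with K show "\<Union>\<K> \<subseteq> affine_flags n" "openin (loop_topology n) (?pre (\<Union>\<K>))"
      by (simp_all only: Sup_le_iff) (blast intro: openin_Union)+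
  qed
  then show ?thesis
    unfolding affine_flag_topology_def by simp
qed

lemma affine_flags_eq: "affine_flags n = flag_point n ` carrier (SLF n)"
  unfolding affine_flags_def flag_point_def LCOSETS_def by blast

lemma topspace_affine_flag_topology: "topspace (affine_flag_topology n) = affine_flags n"
proof -
  have "{g \<in> carrier (SLF n). flag_point n g \<in> affine_flags n} = topspace (loop_topology n)"
    by (auto simp: topspace_loop_topology affine_flags_eq)
  then have "openin (affine_flag_topology n) (affine_flags n)"
    by (simp add: openin_affine_flag_topology)
  then show ?thesis
    unfolding topspace_def by (auto simp: openin_affine_flag_topology)
qed

lemma quotient_map_flag_point:
  "quotient_map (loop_topology n) (affine_flag_topology n) (flag_point n)"
  unfolding quotient_map_def topspace_loop_topology topspace_affine_flag_topology
  by (simp add: affine_flags_eq[symmetric] openin_affine_flag_topology)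

definition irreducible_in :: "'a topology \<Rightarrow> 'a set \<Rightarrow> bool" where
  "irreducible_in X S \<longleftrightarrow> S \<subseteq> topspace X \<and> S \<noteq> {} \<and>
     (\<forall>C D. closedin X C \<longrightarrow> closedin X D \<longrightarrow> S \<subseteq> C \<union> D \<longrightarrow> S \<subseteq> C \<or> S \<subseteq> D)"

text \<open>
  A closed subvariety of the ind-variety is an irreducible closed subset of one of the
  finite-dimensional stages \<open>{gB | g has poles of order at most N}\<close>.
\<close>

definition closed_subvariety :: "nat \<Rightarrow> complex fls mat set set \<Rightarrow> bool" where
  "closed_subvariety n Z \<longleftrightarrow> closedin (affine_flag_topology n) Z \<and>
     irreducible_in (affine_flag_topology n) Z \<and> (\<exists>N. Z \<subseteq> flag_point n ` loop_stage n N)"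

definition G_stable :: "nat \<Rightarrow> complex fls mat set set \<Rightarrow> bool" where
  "G_stable n Z \<longleftrightarrow> (\<forall>g \<in> carrier (SLK n). \<forall>x \<in> Z. const_loop g <#\<^bsub>SLF n\<^esub> x \<in> Z)"

section \<open>Length and Bruhat order with respect to a generating set\<close>

definition word_prod :: "('a, 'b) monoid_scheme \<Rightarrow> 'a list \<Rightarrow> 'a" where
  "word_prod W xs = foldr (mult W) xs \<one>\<^bsub>W\<^esub>"

definition word_length :: "('a, 'b) monoid_scheme \<Rightarrow> 'a set \<Rightarrow> 'a \<Rightarrow> nat" where
  "word_length W S w = (LEAST k. \<exists>xs. set xs \<subseteq> S \<and> length xs = k \<and> word_prod W xs = w)"

definition reflections :: "('a, 'b) monoid_scheme \<Rightarrow> 'a set \<Rightarrow> 'a set" where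
  "reflections W S = {w \<otimes>\<^bsub>W\<^esub> s \<otimes>\<^bsub>W\<^esub> inv\<^bsub>W\<^esub> w | w s. w \<in> carrier W \<and> s \<in> S}"

definition bruhat_step :: "('a, 'b) monoid_scheme \<Rightarrow> 'a set \<Rightarrow> 'a \<Rightarrow> 'a \<Rightarrow> bool" where
  "bruhat_step W S u v \<longleftrightarrow> u \<in> carrier W \<and> (\<exists>r \<in> reflections W S. v = u \<otimes>\<^bsub>W\<^esub> r) \<and>
     word_length W S u < word_length W S v"

definition bruhat_le :: "('a, 'b) monoid_scheme \<Rightarrow> 'a set \<Rightarrow> 'a \<Rightarrow> 'a \<Rightarrow> bool" where
  "bruhat_le W S = (bruhat_step W S)\<^sup>*\<^sup>*"

section \<open>The affine Weyl group\<close>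

definition loop_torus :: "nat \<Rightarrow> complex fls mat set" where
  "loop_torus n = const_loop ` torus n"

text \<open>
  \<open>N(K[t, t\<^sup>-\<^sup>1])\<close>: the matrices over \<open>K[t, t\<^sup>-\<^sup>1]\<close> of determinant one that normalize the
  diagonal torus; equivalently, the monomial ones.
\<close>

definition loop_normalizer :: "nat \<Rightarrow> complex fls mat set" where
  "loop_normalizer n = {g \<in> normalizer (SLF n) (loop_torus n).
     \<forall>i<n. \<forall>j<n. finite {k. fls_nth (g $$ (i, j)) k \<noteq> 0}}"

text \<open>Elements of the affine Weyl group are sets of matrices, namely cosets of the torus.\<close>

definition affine_weyl :: "nat \<Rightarrow> complex fls mat set monoid" where
  "affine_weyl n = (SLF n)\<lparr>carrier := loop_normalizer n\<rparr> Mod loop_torus n"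

definition simple_rep :: "nat \<Rightarrow> nat \<Rightarrow> complex fls mat" where
  "simple_rep n i =
     (if i = 0 then
        mat n n (\<lambda>(a, b). if a = 0 \<and> b = n - 1 then fls_X_intpow (- 1)
                         else if a = n - 1 \<and> b = 0 then - fls_X
                         else if a = b \<and> a \<noteq> 0 \<and> a \<noteq> n - 1 then 1 else 0)
      else
        mat n n (\<lambda>(a, b). if a = i - 1 \<and> b = i then 1
                         else if a = i \<and> b = i - 1 then - 1
                         else if a = b \<and> a \<noteq> i - 1 \<and> a \<noteq> i then 1 else 0))"

definition simple_refl :: "nat \<Rightarrow> nat \<Rightarrow> complex fls mat set" where
  "simple_refl n i = loop_torus n #>\<^bsub>SLF n\<^esub> simple_rep n i"

definition simple_refls :: "nat \<Rightarrow> complex fls mat set set" where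
  "simple_refls n = simple_refl n ` {0..<n}"

abbreviation weyl_length :: "nat \<Rightarrow> complex fls mat set \<Rightarrow> nat" where
  "weyl_length n \<equiv> word_length (affine_weyl n) (simple_refls n)"

abbreviation weyl_le :: "nat \<Rightarrow> complex fls mat set \<Rightarrow> complex fls mat set \<Rightarrow> bool" where
  "weyl_le n \<equiv> bruhat_le (affine_weyl n) (simple_refls n)"

definition affine_schubert :: "nat \<Rightarrow> complex fls mat set \<Rightarrow> complex fls mat set set" where
  "affine_schubert n w =
     (\<Union>v \<in> {v \<in> carrier (affine_weyl n). weyl_le n v w}.
        flag_point n ` (iwahori n <#>\<^bsub>SLF n\<^esub> v <#>\<^bsub>SLF n\<^esub> iwahori n))"

definition tau :: "nat \<Rightarrow> complex fls mat set" where
  "tau n = word_prod (affine_weyl n) (map (simple_refl n) (rev [0..<n]))"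

definition longest_parabolic :: "nat \<Rightarrow> complex fls mat set" where
  "longest_parabolic n =
     (let H = generate (affine_weyl n) (simple_refl n ` {1..n - 2})
      in THE w. w \<in> H \<and> (\<forall>v \<in> H. v \<noteq> w \<longrightarrow> weyl_length n v < weyl_length n w))"

definition kappa0 :: "nat \<Rightarrow> complex fls mat set" where
  "kappa0 n = longest_parabolic n \<otimes>\<^bsub>affine_weyl n\<^esub> (tau n [^]\<^bsub>affine_weyl n\<^esub> (n - 1))"

section \<open>The cotangent bundle and the map to the affine flag variety\<close>

definition cotangent_rel :: "nat \<Rightarrow> ((complex mat \<times> complex mat) \<times> (complex mat \<times> complex mat)) set" where
  "cotangent_rel n =
     {((g, Y), (g * b, inv\<^bsub>SLK n\<^esub> b * Y * b)) | g Y b.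
        g \<in> carrier (SLK n) \<and> Y \<in> borel_nilradical n \<and> b \<in> borel n}"

definition cotangent_bundle :: "nat \<Rightarrow> (complex mat \<times> complex mat) set set" where
  "cotangent_bundle n = (carrier (SLK n) \<times> borel_nilradical n) // cotangent_rel n"

text \<open>\<open>Id + t\<^sup>-\<^sup>1 Y + t\<^sup>-\<^sup>2 Y\<^sup>2 + \<dots>\<close>, which stops before exponent \<open>n\<close> because \<open>Y\<^sup>n = 0\<close>.\<close>

definition geometric_sum :: "nat \<Rightarrow> complex mat \<Rightarrow> complex fls mat" where
  "geometric_sum n Y =
     mat n n (\<lambda>(i, j). \<Sum>k<n. fls_X_intpow (- int k) * fls_const ((Y ^\<^sub>m k) $$ (i, j)))"

definition phi :: "nat \<Rightarrow> (complex mat \<times> complex mat) set \<Rightarrow> complex fls mat set" where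
  "phi n E = the_elem ((\<lambda>(g, Y). flag_point n (const_loop g * geometric_sum n Y)) ` E)"

end

theory Submission
  imports Defs
begin

text \<open>
  Write \<open>L = A\<^sup>n\<close> and let \<open>\<Lambda> i\<close> be the lattice spanned by \<open>t L\<close> and the first \<open>i\<close> basis vectors,
  so that the Iwahori subgroup is the stabilizer of the chain \<open>t L = \<Lambda> 0, \<dots>, \<Lambda> n = L\<close> and the
  point of the affine flag variety represented by \<open>g\<close> is the chain of lattices \<open>M i = g (\<Lambda> i)\<close>.
  The inverse of \<open>1 + t\<^sup>-\<^sup>1 Y + t\<^sup>-\<^sup>2 Y\<^sup>2 + \<dots>\<close> is \<open>1 - t\<^sup>-\<^sup>1 Y\<close>, which maps \<open>t L\<close> into
  \<open>t L + Y L\<close>, and this lies in \<open>\<Lambda> (n - 1)\<close> because \<open>Y\<close> is strictly upper triangular. Hence every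
  point in the image of \<open>\<phi>\<close> satisfies \<open>t L \<subseteq> M (n - 1)\<close>: the inverse of a representing loop has
  poles of order at most one, and none in its last row. The proof is built around the set of all
  such flags, the image of \<open>bounded_loops\<close>.

  This set is closed, because the entries of an inverse matrix are polynomials in the entries of
  the matrix (\<open>bounded_flags_closed\<close>); for the same reason it lies in one finite-dimensional stage
  (\<open>bounded_loops_stage\<close>). So it contains the closure of the image, and it remains to see that it
  is contained in the Schubert variety of \<open>\<kappa>\<^sub>0\<close> (\<open>bounded_loops_schubert\<close>). The set is stable
  under the Iwahori subgroup on both sides, so by the Bruhat decomposition
  (\<open>iwahori_bruhat_decomposition\<close>, a Gaussian elimination with a suitable choice of pivots) one
  only has to show \<open>v \<le> \<kappa>\<^sub>0\<close> for the elements \<open>v\<close> of the affine Weyl group that satisfy the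
  lattice condition.

  That is combinatorics of affine permutations. Number the basis of \<open>F\<^sup>n\<close> by the integers, with
  \<open>j + n k\<close> standing for \<open>t\<^sup>-\<^sup>k e\<^sub>j\<close> (indices \<open>j\<close> from \<open>0\<close>). An element of the affine Weyl group
  becomes a bijection \<open>f\<close> of the integers that commutes with the shift by \<open>n\<close> and has total
  displacement zero, \<open>s\<^sub>i\<close> exchanges \<open>i - 1\<close> and \<open>i\<close> modulo \<open>n\<close>, and the lattice condition says
  that \<open>f\<close> is nonnegative from \<open>n - 1\<close> on (\<open>admissible_perms\<close>). If \<open>a < b\<close> and \<open>f a < f b\<close>, then
  exchanging the values of \<open>f\<close> on the classes of \<open>a\<close> and \<open>b\<close> is a step upwards in the Bruhat
  order: \<open>strong_exchange\<close> follows by reading a word for the larger element letter by letter. From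
  every admissible permutation such steps lead, through admissible permutations, to the one with
  window \<open>-2, -3, \<dots>, -n, n\<^sup>2 - 1\<close> (\<open>admissible_climb\<close>), and this window is that of \<open>\<kappa>\<^sub>0\<close>
  (\<open>kappa0_eq\<close>).

  The other claims are more direct. Two points of the cotangent bundle have the same image iff \<open>(1
  - t\<^sup>-\<^sup>1 Y) c (1 + t\<^sup>-\<^sup>1 Y' + \<dots>)\<close> is in the Iwahori subgroup for the constant matrix \<open>c\<close> relating
  the group elements. This product has no positive powers of \<open>t\<close>, so it is then a constant Borel
  element, and comparing coefficients identifies the two points (\<open>phi_loop_eq_imp\<close>). The closure
  is \<open>G\<close>-stable because left translations by constant matrices are continuous, and it is
  irreducible because any two points of the image lie on a rational curve inside the image
  (\<open>phi_image_irreducible\<close>).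
\<close>

section \<open>Laurent series matrices and the special linear group\<close>

lemma mat_mult_index:
  fixes A B :: "'a::comm_ring_1 mat"
  assumes "A \<in> carrier_mat n n" "B \<in> carrier_mat n n" "i < n" "j < n"
  shows "(A * B) $$ (i, j) = (\<Sum>l<n. A $$ (i, l) * B $$ (l, j))"
  using assms by (simp add: scalar_prod_def lessThan_atLeast0)

lemma fls_mult_nth_window:
  fixes f g :: "'a::comm_ring_1 fls"
  assumes "\<And>k. k < a \<Longrightarrow> fls_nth f k = 0" "\<And>k. k < b \<Longrightarrow> fls_nth g k = 0"
  shows "fls_nth (f * g) k = (\<Sum>i=a..k - b. fls_nth f i * fls_nth g (k - i))"
proof (cases "f = 0 \<or> g = 0")
  case True
  then show ?thesis by auto
next
  case False
  have "a \<le> fls_subdegree f" "b \<le> fls_subdegree g"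
    using assms nth_fls_subdegree_nonzero False by (meson leI)+
  then have "(\<Sum>i=a..k - b. fls_nth f i * fls_nth g (k - i)) =
      (\<Sum>i=fls_subdegree f..k - fls_subdegree g. fls_nth f i * fls_nth g (k - i))"
    by (intro sum.mono_neutral_right) auto
  then show ?thesis
    by (simp add: fls_times_nth(2))
qed

lemma fls_mult_nth_eq_0:
  fixes f g :: "'a::comm_ring_1 fls"
  assumes "\<And>a b. a + b = k \<Longrightarrow> fls_nth f a = 0 \<or> fls_nth g b = 0"
  shows "fls_nth (f * g) k = 0"
  unfolding fls_times_nth(2) using assms by (intro sum.neutral ballI) (metis add_diff_cancel_left' diff_add_cancel mult_not_zero add.commute)

lemma fls_mult_nth_lowest:
  fixes f g :: "'a::comm_ring_1 fls"
  assumes "\<And>a. a < 0 \<Longrightarrow> fls_nth f a = 0" "\<And>b. b < k \<Longrightarrow> fls_nth g b = 0"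
  shows "fls_nth (f * g) k = fls_nth f 0 * fls_nth g k"
  using fls_mult_nth_window[OF assms] by simp

text \<open>
  Coefficient bounds on products, here and below, are all reduced to this: a coefficient of a
  product vanishes if every way of splitting it does.
\<close>

lemma mat_mult_nth_eq_0:
  fixes A B :: "'a::comm_ring_1 fls mat"
  assumes "A \<in> carrier_mat n n" "B \<in> carrier_mat n n" "i < n" "j < n"
    and "\<And>l a b. l < n \<Longrightarrow> a + b = k \<Longrightarrow> fls_nth (A $$ (i, l)) a = 0 \<or> fls_nth (B $$ (l, j)) b = 0"
  shows "fls_nth ((A * B) $$ (i, j)) k = 0"
  unfolding mat_mult_index[OF assms(1-4)] fls_nth_sum
  by (intro sum.neutral ballI fls_mult_nth_eq_0) (use assms(5) in auto)

lemma carrier_SL: "A \<in> carrier (SL n) \<longleftrightarrow> A \<in> carrier_mat n n \<and> det A = 1"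
  by (simp add: SL_def)

lemma mult_SL [simp]: "A \<otimes>\<^bsub>SL n\<^esub> B = A * B"
  and one_SL [simp]: "\<one>\<^bsub>SL n\<^esub> = 1\<^sub>m n"
  by (simp_all add: SL_def)

lemma SL_D: "A \<in> carrier (SL n) \<Longrightarrow> A \<in> carrier_mat n n"
  by (simp add: carrier_SL)

lemma mult_in_SL: "A \<in> carrier (SL n) \<Longrightarrow> B \<in> carrier (SL n) \<Longrightarrow> A * B \<in> carrier (SL n)"
  by (auto simp: carrier_SL det_mult)

lemma adj_mat_SL:
  fixes A :: "'a::field mat"
  assumes "A \<in> carrier (SL n)"
  shows "adj_mat A \<in> carrier (SL n)" "A * adj_mat A = 1\<^sub>m n" "adj_mat A * A = 1\<^sub>m n"
proof -
  have A: "A \<in> carrier_mat n n" "det A = 1"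
    using assms by (auto simp: carrier_SL)
  note adj = adj_mat[OF A(1)]
  show eq: "A * adj_mat A = 1\<^sub>m n" "adj_mat A * A = 1\<^sub>m n"
    using adj A(2) by auto
  have "det A * det (adj_mat A) = 1"
    using det_mult[OF A(1) adj(1)] eq by simp
  then show "adj_mat A \<in> carrier (SL n)"
    using A adj by (simp add: carrier_SL)
qed

lemma group_SL: "group (SL n :: 'a::field mat monoid)"
proof (rule groupI)
  show "\<exists>y\<in>carrier (SL n). y \<otimes>\<^bsub>SL n\<^esub> x = \<one>\<^bsub>SL n\<^esub>" if "x \<in> carrier (SL n)" for x :: "'a mat"
    using adj_mat_SL[OF that] by auto
qed (auto simp: carrier_SL det_mult)

lemma inv_SL:
  fixes A :: "'a::field mat"
  assumes "A \<in> carrier (SL n)"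
  shows "inv\<^bsub>SL n\<^esub> A = adj_mat A"
  using assms adj_mat_SL[OF assms] by (intro group.inv_equality[OF group_SL]) auto

lemma inv_SL_eq:
  fixes A B :: "'a::field mat"
  assumes "A * B = 1\<^sub>m n" "A \<in> carrier (SL n)" "B \<in> carrier (SL n)"
  shows "inv\<^bsub>SL n\<^esub> A = B" "inv\<^bsub>SL n\<^esub> B = A"
proof -
  show *: "inv\<^bsub>SL n\<^esub> B = A"
    using assms by (intro group.inv_equality[OF group_SL]) auto
  show "inv\<^bsub>SL n\<^esub> A = B"
    unfolding *[symmetric] using assms by (intro group.inv_inv[OF group_SL])
qed

lemma inv_SL_closed:
  fixes A :: "'a::field mat"
  shows "A \<in> carrier (SL n) \<Longrightarrow> inv\<^bsub>SL n\<^esub> A \<in> carrier (SL n)"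
  by (rule group.inv_closed[OF group_SL])

lemma inv_SL_mult:
  fixes A :: "'a::field mat"
  assumes "A \<in> carrier (SL n)"
  shows "A * inv\<^bsub>SL n\<^esub> A = 1\<^sub>m n" "inv\<^bsub>SL n\<^esub> A * A = 1\<^sub>m n"
  using adj_mat_SL[OF assms] inv_SL[OF assms] by auto

lemma SL_assoc:
  assumes "A \<in> carrier (SL n)" "B \<in> carrier (SL n)" "C \<in> carrier (SL n)"
  shows "(A * B) * C = A * (B * C)"
  using assms assoc_mult_mat unfolding carrier_SL by blast

lemma SL_cancel:
  fixes A B :: "'a::field mat"
  assumes "A \<in> carrier (SL n)" "B \<in> carrier (SL n)"
  shows "inv\<^bsub>SL n\<^esub> A * (A * B) = B" "A * (inv\<^bsub>SL n\<^esub> A * B) = B"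
    "(B * A) * inv\<^bsub>SL n\<^esub> A = B" "(B * inv\<^bsub>SL n\<^esub> A) * A = B"
  using SL_assoc[OF inv_SL_closed[OF assms(1)] assms] SL_assoc[OF assms(1) inv_SL_closed[OF assms(1)] assms(2)]
    SL_assoc[OF assms(2,1) inv_SL_closed[OF assms(1)]] SL_assoc[OF assms(2) inv_SL_closed[OF assms(1)] assms(1)]
    inv_SL_mult[OF assms(1)] SL_D[OF assms(2)]
  by simp_all

lemma comm_ring_hom_fls_const: "comm_ring_hom (fls_const :: 'a::comm_ring_1 \<Rightarrow> 'a fls)"
  by unfold_locales (auto simp: fls_plus_const[symmetric])

lemma comm_ring_hom_fps_to_fls: "comm_ring_hom (fps_to_fls :: 'a::comm_ring_1 fps \<Rightarrow> 'a fls)"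
  by unfold_locales (auto simp: fls_times_fps_to_fls)

lemma comm_ring_hom_fps_nth_0: "comm_ring_hom (\<lambda>f :: 'a::comm_ring_1 fps. fps_nth f 0)"
  by unfold_locales (auto simp: fps_mult_nth_0)

lemma det_const_loop: "det (const_loop g) = fls_const (det g)"
  unfolding const_loop_def by (rule comm_ring_hom.hom_det[OF comm_ring_hom_fls_const])

lemma const_loop_mult:
  "A \<in> carrier_mat n n \<Longrightarrow> B \<in> carrier_mat n n \<Longrightarrow> const_loop (A * B) = const_loop A * const_loop B"
  unfolding const_loop_def
proof -
  interpret comm_ring_hom "fls_const :: complex \<Rightarrow> complex fls" by (rule comm_ring_hom_fls_const)
  show "A \<in> carrier_mat n n \<Longrightarrow> B \<in> carrier_mat n n \<Longrightarrow>
      map_mat fls_const (A * B) = map_mat fls_const A * map_mat fls_const B"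
    by (rule mat_hom_mult)
qed

lemma const_loop_carrier [simp]: "const_loop g \<in> carrier_mat n n \<longleftrightarrow> g \<in> carrier_mat n n"
  by (simp add: const_loop_def)

lemma const_loop_SL [simp]: "const_loop g \<in> carrier (SLF n) \<longleftrightarrow> g \<in> carrier (SLK n)"
  by (simp add: carrier_SL det_const_loop)

text \<open>
  Setting \<open>t = 0\<close> is a ring homomorphism on power series only, so the matrix is first viewed over
  the power series ring.
\<close>

lemma det_constant_term:
  fixes g :: "'a::comm_ring_1 fls mat"
  assumes g: "g \<in> carrier_mat n n"
    and pow: "\<And>i j k. i < n \<Longrightarrow> j < n \<Longrightarrow> k < 0 \<Longrightarrow> fls_nth (g $$ (i, j)) k = 0"
  shows "det (map_mat (\<lambda>f. fls_nth f 0) g) = fls_nth (det g) 0"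
    and "\<And>k. k < 0 \<Longrightarrow> fls_nth (det g) k = 0"
proof -
  define h where "h = map_mat fls_regpart g"
  have "map_mat fps_to_fls h = g"
  proof (rule eq_matI)
    fix i j assume "i < dim_row g" "j < dim_col g"
    then show "map_mat fps_to_fls h $$ (i, j) = g $$ (i, j)"
      using g pow[of i j] by (auto simp: h_def intro!: fls_eqI)
  qed (auto simp: h_def)
  then have det: "det g = fps_to_fls (det h)"
    by (metis comm_ring_hom.hom_det[OF comm_ring_hom_fps_to_fls])
  then show "fls_nth (det g) k = 0" if "k < 0" for k
    using that by simp
  have "map_mat (\<lambda>f. fls_nth f 0) g = map_mat (\<lambda>f. fps_nth f 0) h"
    by (rule eq_matI) (auto simp: h_def)
  then show "det (map_mat (\<lambda>f. fls_nth f 0) g) = fls_nth (det g) 0"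
    by (simp add: comm_ring_hom.hom_det[OF comm_ring_hom_fps_nth_0] det)
qed

section \<open>The Iwahori subgroup\<close>

text \<open>
  Give the monomial \<open>t\<^sup>k\<close> at position \<open>(i, j)\<close> the weight \<open>n k + j - i\<close>. Weights add up under
  matrix multiplication, and the Iwahori subgroup consists of the loops without terms of negative
  weight: as \<open>\<bar>j - i\<bar> < n\<close>, the sign of the weight is decided by \<open>k\<close>, and by \<open>j - i\<close> when \<open>k = 0\<close>.
\<close>

lemma iwahori_iff:
  "g \<in> iwahori n \<longleftrightarrow> g \<in> carrier (SLF n) \<and>
     (\<forall>i<n. \<forall>j<n. \<forall>k. int n * k + int j - int i < 0 \<longrightarrow> fls_nth (g $$ (i, j)) k = 0)"
  (is "_ \<longleftrightarrow> _ \<and> ?P")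
proof (intro iffI conjI)
  assume g: "g \<in> iwahori n"
  then show SL: "g \<in> carrier (SLF n)" by (simp add: iwahori_def)
  show ?P
  proof (intro allI impI)
    fix i j k assume ij: "i < n" "j < n" and k: "int n * k + int j - int i < 0"
    show "fls_nth (g $$ (i, j)) k = 0"
    proof (cases "k < 0")
      case True
      then show ?thesis using g ij by (simp add: iwahori_def power_series_mats_def)
    next
      case False
      have "k = 0"
      proof (rule ccontr)
        assume "k \<noteq> 0"
        then have "int n * 1 \<le> int n * k" using False by (intro mult_left_mono) auto
        then have "int n \<le> int n * k" by simp
        then show False using k ij by linarith
      qed
      then have "j < i" using k by simp
      then show ?thesis
        using upper_triangularD[of "map_mat (\<lambda>f. fls_nth f 0) g" j i] g ij SL \<open>k = 0\<close>
        by (auto simp: iwahori_def borel_def carrier_SL)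
    qed
  qed
next
  assume "g \<in> carrier (SLF n) \<and> ?P"
  then have g: "g \<in> carrier (SLF n)" and P: ?P by auto
  have neg: "fls_nth (g $$ (i, j)) k = 0" if "i < n" "j < n" "k < 0" for i j k
  proof -
    have "int n * k \<le> int n * (- 1)" using that by (intro mult_left_mono) auto
    then have "int n * k + int j - int i < 0" using that by auto
    then show ?thesis using P that by blast
  qed
  have "upper_triangular (map_mat (\<lambda>f. fls_nth f 0) g)"
    using P g by (auto simp: carrier_SL)
  moreover have "det (map_mat (\<lambda>f. fls_nth f 0) g) = 1"
    using det_constant_term(1)[of g n] neg g by (auto simp: carrier_SL)
  ultimately show "g \<in> iwahori n"
    using g neg by (auto simp: iwahori_def power_series_mats_def borel_def carrier_SL)
qed

lemma iwahori_SL: "g \<in> iwahori n \<Longrightarrow> g \<in> carrier (SLF n)"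
  by (simp add: iwahori_iff)

lemma iwahori_nth:
  "g \<in> iwahori n \<Longrightarrow> i < n \<Longrightarrow> j < n \<Longrightarrow> int n * k + int j - int i < 0 \<Longrightarrow> fls_nth (g $$ (i, j)) k = 0"
  by (simp add: iwahori_iff)

lemma iwahori_diag:
  assumes g: "g \<in> iwahori n" and "i < n"
  shows "fls_nth (g $$ (i, i)) 0 \<noteq> 0"
proof -
  define h where "h = map_mat (\<lambda>f. fls_nth f 0) g"
  have h: "h \<in> carrier_mat n n" "upper_triangular h" "det h = 1"
    using g by (auto simp: h_def iwahori_def borel_def carrier_SL)
  have "prod_list (diag_mat h) = 1"
    using det_upper_triangular[OF h(2,1)] h(3) by simp
  then have "0 \<notin> set (diag_mat h)" by (metis prod_list_zero_iff zero_neq_one)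
  then have "h $$ (i, i) \<noteq> 0"
    using h \<open>i < n\<close> by (auto simp: diag_mat_def)
  then show ?thesis
    using g \<open>i < n\<close> by (auto simp: h_def iwahori_def carrier_SL)
qed

lemma one_iwahori: "1\<^sub>m n \<in> iwahori n"
proof -
  have "int n * k + int j - int i < 0 \<Longrightarrow> i = j \<Longrightarrow> k \<noteq> 0" for k i j by auto
  then show ?thesis by (auto simp: iwahori_iff carrier_SL)
qed

lemma iwahori_mult:
  assumes "g \<in> iwahori n" "h \<in> iwahori n"
  shows "g * h \<in> iwahori n"
  unfolding iwahori_iff
proof (intro conjI allI impI)
  show "g * h \<in> carrier (SLF n)" using assms by (simp add: mult_in_SL iwahori_SL)
  fix i j k assume ij: "i < n" "j < n" and k: "int n * k + int j - int i < 0"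
  show "fls_nth ((g * h) $$ (i, j)) k = 0"
  proof (rule mat_mult_nth_eq_0)
    fix l a b assume l: "l < n" "a + b = k"
    have "int n * k = int n * a + int n * b" using l by (simp add: distrib_left[symmetric])
    then have "int n * a + int l - int i < 0 \<or> int n * b + int j - int l < 0"
      using k by linarith
    then show "fls_nth (g $$ (i, l)) a = 0 \<or> fls_nth (h $$ (l, j)) b = 0"
      using assms ij l by (auto simp: iwahori_iff)
  qed (use assms ij iwahori_SL SL_D in auto)
qed

text \<open>
  The part of weight zero of \<open>g\<close> is an invertible diagonal matrix. If the inverse had terms of
  negative weight, the lowest of them would only be multiplied by this diagonal part and survive
  in \<open>g g\<^sup>-\<^sup>1 = 1\<close>.
\<close>

lemma iwahori_inverse:
  assumes g: "g \<in> iwahori n"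
  shows "inv\<^bsub>SLF n\<^esub> g \<in> iwahori n"
proof -
  define h where "h = inv\<^bsub>SLF n\<^esub> g"
  have gS: "g \<in> carrier (SLF n)" using g by (rule iwahori_SL)
  have hS: "h \<in> carrier (SLF n)" unfolding h_def using gS by (rule inv_SL_closed)
  have gh: "g * h = 1\<^sub>m n" unfolding h_def using gS by (rule inv_SL_mult)
  have "\<exists>M. \<forall>i<n. \<forall>j<n. \<forall>k. int n * k + int j - int i < - int M \<longrightarrow> fls_nth (h $$ (i, j)) k = 0"
  proof -
    define S where "S = (\<lambda>(i, j). nat (int n * \<bar>fls_subdegree (h $$ (i, j))\<bar> + int n)) ` ({..<n} \<times> {..<n})"
    have fin: "finite S" unfolding S_def by simp
    show ?thesis
    proof (intro exI[of _ "Max S"] allI impI)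
      fix i j k assume ij: "i < n" "j < n" and k: "int n * k + int j - int i < - int (Max S)"
      have "nat (int n * \<bar>fls_subdegree (h $$ (i, j))\<bar> + int n) \<le> Max S"
        using ij fin by (intro Max_ge) (auto simp: S_def)
      then have le: "int n * \<bar>fls_subdegree (h $$ (i, j))\<bar> + int n \<le> int (Max S)" by linarith
      have "k < fls_subdegree (h $$ (i, j))"
      proof (rule ccontr)
        assume "\<not> ?thesis"
        then have "int n * (- \<bar>fls_subdegree (h $$ (i, j))\<bar>) \<le> int n * k"
          by (intro mult_left_mono) auto
        then show False using k le ij by auto
      qed
      then show "fls_nth (h $$ (i, j)) k = 0" by simp
    qed
  qed
  then obtain M where M: "\<And>i j k. i < n \<Longrightarrow> j < n \<Longrightarrow> int n * k + int j - int i < - int M \<Longrightarrow>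
      fls_nth (h $$ (i, j)) k = 0" by blast
  \<comment> \<open>All weights below \<open>-M\<close> are absent; raise this bound step by step up to zero.\<close>
  have main: "\<forall>i<n. \<forall>j<n. \<forall>k. int n * k + int j - int i < min 0 (int m - int M) \<longrightarrow> fls_nth (h $$ (i, j)) k = 0" for m
  proof (induction m)
    case 0
    then show ?case using M by auto
  next
    case (Suc m)
    show ?case
    proof (intro allI impI)
      fix i j k assume ij: "i < n" "j < n" and k: "int n * k + int j - int i < min 0 (int (Suc m) - int M)"
      have low: "fls_nth (h $$ (i, j)) b = 0" if "b < k" for b
      proof -
        have "int n * b \<le> int n * (k - 1)" using that by (intro mult_left_mono) auto
        then have "int n * b + int j - int i < min 0 (int m - int M)"
          using k ij by (auto simp: algebra_simps)
        then show ?thesis using Suc ij by blast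
      qed
      have "fls_nth (g $$ (i, l) * h $$ (l, j)) k = 0" if l: "l < n" "l \<noteq> i" for l
      proof (rule fls_mult_nth_eq_0)
        fix a b assume ab: "a + b = k"
        have nk: "int n * k = int n * a + int n * b" using ab by (simp add: distrib_left[symmetric])
        \<comment> \<open>Off the diagonal no term has weight zero.\<close>
        have "int n * a + int l - int i \<noteq> 0"
        proof
          assume "int n * a + int l - int i = 0"
          then have "int i - int l = int n * a" by linarith
          then have "int n dvd int i - int l" by (rule dvdI)
          moreover have "int i - int l \<noteq> 0" "\<bar>int i - int l\<bar> < int n" using ij l by auto
          ultimately show False using dvd_imp_le_int[of "int i - int l" "int n"] by simp
        qed
        then have "int n * a + int l - int i < 0 \<or> int n * b + int j - int l < min 0 (int m - int M)"
          using k nk by auto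
        then show "fls_nth (g $$ (i, l)) a = 0 \<or> fls_nth (h $$ (l, j)) b = 0"
          using Suc iwahori_nth[OF g] ij l by blast
      qed
      then have "fls_nth ((g * h) $$ (i, j)) k = fls_nth (g $$ (i, i) * h $$ (i, j)) k"
        unfolding mat_mult_index[OF SL_D[OF gS] SL_D[OF hS] ij] fls_nth_sum
        using ij by (subst sum.remove[of _ i]) (auto intro!: sum.neutral)
      also have "\<dots> = fls_nth (g $$ (i, i)) 0 * fls_nth (h $$ (i, j)) k"
      proof (rule fls_mult_nth_lowest)
        show "fls_nth (g $$ (i, i)) a = 0" if "a < 0" for a
          using iwahori_nth[OF g ij(1) ij(1)] that ij by (auto simp: mult_less_0_iff)
      qed (rule low)
      finally have "fls_nth (g $$ (i, i)) 0 * fls_nth (h $$ (i, j)) k = fls_nth (1\<^sub>m n $$ (i, j)) k"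
        unfolding gh by simp
      also have "\<dots> = 0"
        using k ij by (cases "i = j") auto
      finally show "fls_nth (h $$ (i, j)) k = 0"
        using iwahori_diag[OF g ij(1)] by simp
    qed
  qed
  have "h \<in> iwahori n"
    unfolding iwahori_iff
  proof (intro conjI allI impI)
    fix i j k assume "i < n" "j < n" "int n * k + int j - int i < 0"
    then show "fls_nth (h $$ (i, j)) k = 0" using main[of M] by simp
  qed (rule hS)
  then show ?thesis
    by (simp add: h_def)
qed

lemma subgroup_iwahori: "subgroup (iwahori n) (SLF n)"
  by (rule group.subgroupI[OF group_SL])
    (use one_iwahori[of n] iwahori_mult iwahori_inverse iwahori_SL in auto)

lemma flag_point_eq_iff:
  assumes "g \<in> carrier (SLF n)" "h \<in> carrier (SLF n)"
  shows "flag_point n g = flag_point n h \<longleftrightarrow> inv\<^bsub>SLF n\<^esub> g * h \<in> iwahori n"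
proof
  assume eq: "flag_point n g = flag_point n h"
  have "h * 1\<^sub>m n \<in> flag_point n h"
    using one_iwahori unfolding flag_point_def l_coset_def by auto
  then have "h \<in> flag_point n g"
    unfolding eq right_mult_one_mat[OF SL_D[OF assms(2)]] .
  then obtain b where b: "b \<in> iwahori n" "h = g * b"
    unfolding flag_point_def l_coset_def by auto
  then show "inv\<^bsub>SLF n\<^esub> g * h \<in> iwahori n"
    using assms by (simp add: SL_cancel iwahori_SL)
next
  assume b: "inv\<^bsub>SLF n\<^esub> g * h \<in> iwahori n" (is "?b \<in> _")
  have h: "h = g * ?b" using assms by (simp add: SL_cancel)
  have 1: "h * c = g * (?b * c)" if "c \<in> iwahori n" for c
    using SL_assoc[OF assms(1) iwahori_SL[OF b] iwahori_SL[OF that]] h by simp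
  have 2: "g * c = h * (inv\<^bsub>SLF n\<^esub> ?b * c)" if "c \<in> iwahori n" for c
  proof -
    have "g * (?b * (inv\<^bsub>SLF n\<^esub> ?b * c)) = g * c"
      using that b by (simp add: SL_cancel iwahori_SL)
    moreover have "g * (?b * (inv\<^bsub>SLF n\<^esub> ?b * c)) = (g * ?b) * (inv\<^bsub>SLF n\<^esub> ?b * c)"
      using that b assms by (intro SL_assoc[symmetric]) (auto intro: mult_in_SL inv_SL_closed iwahori_SL)
    ultimately show ?thesis using h by simp
  qed
  have eq: "flag_point n x = (*) x ` iwahori n" for x
    unfolding flag_point_def l_coset_def by auto
  show "flag_point n g = flag_point n h"
    unfolding eq
  proof (intro equalityI image_subsetI)
    show "g * c \<in> (*) h ` iwahori n" if "c \<in> iwahori n" for c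
      unfolding 2[OF that] by (intro imageI iwahori_mult iwahori_inverse b that)
    show "h * c \<in> (*) g ` iwahori n" if "c \<in> iwahori n" for c
      unfolding 1[OF that] by (intro imageI iwahori_mult b that)
  qed
qed

lemma flag_point_mult:
  assumes "g \<in> carrier (SLF n)" "b \<in> iwahori n"
  shows "flag_point n (g * b) = flag_point n g"
  using assms flag_point_eq_iff[of g n "g * b"]
  by (simp add: mult_in_SL iwahori_SL SL_cancel)

lemma l_coset_flag_point:
  assumes "g \<in> carrier (SLF n)" "h \<in> carrier (SLF n)"
  shows "g <#\<^bsub>SLF n\<^esub> flag_point n h = flag_point n (g * h)"
  unfolding flag_point_def using assms subgroup_iwahori group.lcos_m_assoc[OF group_SL, of "iwahori n" n g h]
  by (simp add: subgroup.subset)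

section \<open>Affine permutations\<close>

definition affine_perms :: "nat \<Rightarrow> (int \<Rightarrow> int) set" where
  "affine_perms n = {f. bij f \<and> (\<forall>x. f (x + int n) = f x + int n) \<and>
     (\<Sum>j<n. f (int j) - int j) = 0}"

text \<open>
  The affine reflection that exchanges \<open>a + n k\<close> and \<open>b + n k\<close> for all \<open>k\<close>; it is meant for \<open>a\<close>
  and \<open>b\<close> in different classes modulo \<open>n\<close>.
\<close>

definition class_swap :: "nat \<Rightarrow> int \<Rightarrow> int \<Rightarrow> int \<Rightarrow> int" where
  "class_swap n a b x =
     (if x mod int n = a mod int n then x + (b - a)
      else if x mod int n = b mod int n then x + (a - b) else x)"

lemma periodic_shift:
  assumes "\<And>x. d (x + int n) = (d x :: 'a)"
  shows "d (x + int n * k) = d x"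
proof (induction k arbitrary: x rule: int_induct[where k = 0])
  case base then show ?case by simp
next
  case (step1 i)
  have "d (x + int n * (i + 1)) = d ((x + int n * i) + int n)" by (simp add: algebra_simps)
  then show ?case using assms step1 by simp
next
  case (step2 i)
  have "d (x + int n * i) = d ((x + int n * (i - 1)) + int n)" by (simp add: algebra_simps)
  then show ?case using assms step2 by simp
qed

lemma periodic_cong:
  assumes "\<And>x. d (x + int n) = (d x :: 'a)" "x mod int n = y mod int n"
  shows "d x = d y"
proof -
  have "x = y + int n * ((x - y) div int n)"
    using assms(2) by (simp add: mod_eq_dvd_iff)
  then show ?thesis using periodic_shift[of d n y] assms(1) by metis
qed

lemma shift_mult:
  assumes "\<And>x. f (x + int n) = f x + int n"
  shows "f (x + int n * k) = f x + int n * k"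
proof -
  have "(\<lambda>x. f x - x) (x + int n * k) = (\<lambda>x. f x - x) x"
    by (rule periodic_shift) (simp add: assms)
  then show ?thesis by simp
qed

lemma affine_shift:
  assumes "f \<in> affine_perms n"
  shows "f (x + int n * k) = f x + int n * k" "f (x + int n) = f x + int n" "f (x - int n) = f x - int n"
  using shift_mult[of f n x k] shift_mult[of f n x 1] shift_mult[of f n x "-1"] assms
  by (auto simp: affine_perms_def)

lemma affine_inj: "f \<in> affine_perms n \<Longrightarrow> f x = f y \<longleftrightarrow> x = y"
  by (auto simp: affine_perms_def bij_def inj_def)

lemma affine_mod_eq:
  assumes "f \<in> affine_perms n"
  shows "f x mod int n = f y mod int n \<longleftrightarrow> x mod int n = y mod int n"
proof
  assume "x mod int n = y mod int n"
  then have "x = y + int n * ((x - y) div int n)" by (simp add: mod_eq_dvd_iff)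
  then have "f x = f y + int n * ((x - y) div int n)" by (metis affine_shift(1)[OF assms])
  then show "f x mod int n = f y mod int n" by simp
next
  assume "f x mod int n = f y mod int n"
  then have "f x = f y + int n * ((f x - f y) div int n)" by (simp add: mod_eq_dvd_iff)
  then have "f x = f (y + int n * ((f x - f y) div int n))" by (metis affine_shift(1)[OF assms])
  then have "x = y + int n * ((f x - f y) div int n)" by (simp add: affine_inj[OF assms])
  then show "x mod int n = y mod int n" by (metis mod_mult_self2)
qed

text \<open>
  The values of \<open>h\<close> form a complete residue system, so both sums run over all classes.
\<close>

lemma sum_residues:
  fixes d :: "int \<Rightarrow> int"
  assumes per: "\<And>x. d (x + int n) = d x" and inj: "inj_on (\<lambda>j. h j mod int n) {..<n}"
  shows "(\<Sum>j<n. d (h j)) = (\<Sum>j<n. d (int j))"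
proof -
  let ?r = "\<lambda>j. nat (h j mod int n)"
  have "inj_on ?r {..<n}"
  proof (rule inj_onI)
    fix i j assume ij: "i \<in> {..<n}" "j \<in> {..<n}" "?r i = ?r j"
    then have "0 < int n" by auto
    then have "h i mod int n = h j mod int n"
      using ij(3) pos_mod_sign[of "int n"] by (metis eq_nat_nat_iff)
    then show "i = j" using inj ij by (auto dest: inj_onD)
  qed
  moreover have "?r ` {..<n} \<subseteq> {..<n}"
    by (auto simp: nat_less_iff)
  ultimately have "bij_betw ?r {..<n} {..<n}"
    by (simp add: bij_betw_def endo_inj_surj)
  then have "(\<Sum>j<n. d (int j)) = (\<Sum>j<n. d (int (?r j)))"
    by (rule sum.reindex_bij_betw[symmetric])
  also have "\<dots> = (\<Sum>j<n. d (h j))"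
  proof (rule sum.cong)
    fix j assume "j \<in> {..<n}"
    then have "int (?r j) mod int n = h j mod int n" by simp
    with per show "d (int (?r j)) = d (h j)" by (rule periodic_cong)
  qed simp
  finally show ?thesis by simp
qed

lemma sum_window:
  fixes d :: "int \<Rightarrow> int"
  assumes "\<And>x. d (x + int n) = d x"
  shows "(\<Sum>j<n. d (c + int j)) = (\<Sum>j<n. d (int j))"
proof (rule sum_residues[where d = d])
  show "d (x + int n) = d x" for x by (rule assms)
next
  show "inj_on (\<lambda>j. (c + int j) mod int n) {..<n}"
  proof (rule inj_onI)
    fix i j assume ij: "i \<in> {..<n}" "j \<in> {..<n}" "(c + int i) mod int n = (c + int j) mod int n"
    then have "int n dvd int i - int j" by (simp add: mod_eq_dvd_iff)
    then have "int i mod int n = int j mod int n" by (simp only: mod_eq_dvd_iff)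
    then show "i = j" using ij by simp
  qed
qed

lemma sum_two_classes:
  fixes d :: "int \<Rightarrow> int"
  assumes per: "\<And>x. d (x + int n) = d x" and ab: "a mod int n \<noteq> b mod int n" and "0 < n"
    and zero: "\<And>x. x mod int n \<noteq> a mod int n \<Longrightarrow> x mod int n \<noteq> b mod int n \<Longrightarrow> d x = 0"
  shows "(\<Sum>j<n. d (int j)) = d a + d b"
proof -
  define i j where "i = nat (a mod int n)" and "j = nat (b mod int n)"
  have ij: "int i = a mod int n" "int j = b mod int n" using \<open>0 < n\<close> by (auto simp: i_def j_def)
  have lt: "i < n" "j < n" using ij \<open>0 < n\<close> by (metis of_nat_less_iff pos_mod_bound of_nat_0_less_iff)+
  have "(\<Sum>k<n. d (int k)) = (\<Sum>k\<in>{i, j}. d (int k))"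
  proof (intro sum.mono_neutral_right ballI)
    fix k assume "k \<in> {..<n} - {i, j}"
    then show "d (int k) = 0" using ij by (intro zero) auto
  qed (use lt in auto)
  also have "\<dots> = d (int i) + d (int j)" using ij ab by auto
  also have "d (int i) = d a" by (rule periodic_cong[of d n], rule per) (simp add: ij)
  also have "d (int j) = d b" by (rule periodic_cong[of d n], rule per) (simp add: ij)
  finally show ?thesis .
qed

lemma affine_compose:
  assumes f: "f \<in> affine_perms n" and g: "g \<in> affine_perms n"
  shows "f \<circ> g \<in> affine_perms n"
proof -
  have "(\<Sum>j<n. (\<lambda>x. f x - x) (g (int j))) = (\<Sum>j<n. (\<lambda>x. f x - x) (int j))"
  proof (rule sum_residues)
    show "inj_on (\<lambda>j. g (int j) mod int n) {..<n}"
      by (rule inj_onI) (simp add: affine_mod_eq[OF g])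
  qed (simp add: affine_shift[OF f])
  then have "(\<Sum>j<n. f (g (int j)) - g (int j)) + (\<Sum>j<n. g (int j) - int j) = 0"
    using f g by (simp add: affine_perms_def)
  then have "(\<Sum>j<n. f (g (int j)) - int j) = 0"
    by (simp add: sum.distrib[symmetric])
  then show ?thesis
    using f g by (auto simp: affine_perms_def intro: bij_comp)
qed

lemma affine_id: "id \<in> affine_perms n"
  by (simp add: affine_perms_def)

lemma affine_inverse:
  assumes f: "f \<in> affine_perms n"
  obtains g where "g \<in> affine_perms n" "f \<circ> g = id" "g \<circ> f = id"
proof -
  define g where "g = inv_into UNIV f"
  have bij: "bij f" using f by (simp add: affine_perms_def)
  have fg: "f (g x) = x" and gf: "g (f x) = x" for x
    using bij by (simp_all add: g_def bij_is_surj surj_f_inv_f bij_is_inj)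
  have sh: "g (x + int n) = g x + int n" for x
    by (metis fg gf affine_shift(2)[OF f])
  have "(\<Sum>j<n. (\<lambda>x. g x - x) (f (int j))) = (\<Sum>j<n. (\<lambda>x. g x - x) (int j))"
  proof (rule sum_residues)
    show "inj_on (\<lambda>j. f (int j) mod int n) {..<n}"
      by (rule inj_onI) (simp add: affine_mod_eq[OF f])
  qed (simp add: sh)
  then have "(\<Sum>j<n. g (int j) - int j) = - (\<Sum>j<n. f (int j) - int j)"
    by (simp add: gf sum_negf[symmetric])
  then have "g \<in> affine_perms n"
    using f sh bij by (simp add: affine_perms_def g_def bij_imp_bij_inv)
  then show ?thesis
    by (rule that) (auto simp: fg gf)
qed

lemma class_swap_mod: "class_swap n a b x mod int n =
    (if x mod int n = a mod int n then b mod int n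
     else if x mod int n = b mod int n then a mod int n else x mod int n)"
proof -
  have "(x + (b - a)) mod int n = b mod int n" if "x mod int n = a mod int n" for a b x
  proof -
    have "(x + (b - a)) mod int n = (x mod int n + (b - a)) mod int n" by (simp add: mod_add_left_eq)
    then show ?thesis by (simp add: that mod_add_left_eq)
  qed
  then show ?thesis by (simp add: class_swap_def)
qed

lemma class_swap_involution:
  "a mod int n \<noteq> b mod int n \<Longrightarrow> class_swap n a b (class_swap n a b x) = x"
  by (subst (1) class_swap_def) (auto simp: class_swap_mod, auto simp: class_swap_def)

lemma class_swap_shift: "class_swap n a b (x + int n) = class_swap n a b x + int n"
  by (simp add: class_swap_def)

lemma class_swap_simps [simp]:
  "class_swap n a b a = b" "a mod int n \<noteq> b mod int n \<Longrightarrow> class_swap n a b b = a"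
  by (auto simp: class_swap_def)

text \<open>
  The displacements \<open>b - a\<close> and \<open>a - b\<close> cancel.
\<close>

lemma class_swap_affine:
  assumes "a mod int n \<noteq> b mod int n" "0 < n"
  shows "class_swap n a b \<in> affine_perms n"
proof -
  have "(\<Sum>j<n. (\<lambda>x. class_swap n a b x - x) (int j)) =
      (\<lambda>x. class_swap n a b x - x) a + (\<lambda>x. class_swap n a b x - x) b"
    by (rule sum_two_classes) (use assms in \<open>auto simp: class_swap_shift\<close>, auto simp: class_swap_def)
  moreover have "bij (class_swap n a b)"
    by (rule o_bij[of "class_swap n a b"]) (auto simp: class_swap_involution assms)
  ultimately show ?thesis
    using assms by (simp add: affine_perms_def class_swap_shift)
qed

lemma class_swap_conj:
  assumes "f \<in> affine_perms n"
  shows "f (class_swap n a b x) = class_swap n (f a) (f b) (f x)"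
proof -
  have *: "f (x + (b - a)) = f x + (f b - f a)" if "x mod int n = a mod int n" for a b
  proof -
    have x: "x = a + int n * ((x - a) div int n)" using that by (simp add: mod_eq_dvd_iff)
    have "x + (b - a) = b + int n * ((x - a) div int n)" using x by simp
    then have "f (x + (b - a)) = f b + int n * ((x - a) div int n)"
      by (metis affine_shift(1)[OF assms])
    moreover have "f x = f a + int n * ((x - a) div int n)"
      using x by (metis affine_shift(1)[OF assms])
    ultimately show ?thesis by simp
  qed
  show ?thesis
    by (auto simp: class_swap_def affine_mod_eq[OF assms] *)
qed

section \<open>Words in adjacent swaps and the strong exchange property\<close>

abbreviation adjacent_swap :: "nat \<Rightarrow> nat \<Rightarrow> int \<Rightarrow> int" where
  "adjacent_swap n i \<equiv> class_swap n (int i - 1) (int i)"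

lemma consecutive_mod: "2 \<le> n \<Longrightarrow> (x - 1) mod int n \<noteq> x mod int n" "2 \<le> n \<Longrightarrow> x mod int n \<noteq> (x - 1) mod int n"
proof -
  show "(x - 1) mod int n \<noteq> x mod int n" if "2 \<le> n"
  proof
    assume "(x - 1) mod int n = x mod int n"
    then have "int n dvd (x - 1) - x" by (simp only: mod_eq_dvd_iff)
    then show False using that by simp
  qed
  then show "x mod int n \<noteq> (x - 1) mod int n" if "2 \<le> n"
    using that by metis
qed

lemma adjacent_swap_affine: "2 \<le> n \<Longrightarrow> adjacent_swap n i \<in> affine_perms n"
  by (rule class_swap_affine) (auto simp: consecutive_mod)

definition word_perm :: "nat \<Rightarrow> nat list \<Rightarrow> int \<Rightarrow> int" where
  "word_perm n xs = foldr (\<lambda>i f. adjacent_swap n i \<circ> f) xs id"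

lemma word_perm_simps [simp]:
  "word_perm n [] = id" "word_perm n (i # xs) = adjacent_swap n i \<circ> word_perm n xs"
  by (simp_all add: word_perm_def)

lemma word_perm_append: "word_perm n (xs @ ys) = word_perm n xs \<circ> word_perm n ys"
  by (induction xs) (auto simp: comp_assoc)

lemma word_perm_affine: "2 \<le> n \<Longrightarrow> word_perm n xs \<in> affine_perms n"
  by (induction xs) (auto intro: affine_compose adjacent_swap_affine affine_id)

text \<open>
  The sum over one window of the squared displacements, which by periodicity does not depend on
  the window. It serves as a termination measure: every Bruhat step up increases it, by
  \<open>energy_swap\<close>, and every step down decreases it.
\<close>

definition energy :: "nat \<Rightarrow> (int \<Rightarrow> int) \<Rightarrow> int" where
  "energy n f = (\<Sum>j<n. (f (int j) - int j)\<^sup>2)"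

lemma energy_swap:
  assumes f: "f \<in> affine_perms n" and ab: "a mod int n \<noteq> b mod int n" and "0 < n"
  shows "energy n (f \<circ> class_swap n a b) = energy n f + 2 * ((b - a) * (f b - f a))"
proof -
  let ?g = "f \<circ> class_swap n a b"
  let ?d = "\<lambda>x. (?g x - x)\<^sup>2 - (f x - x)\<^sup>2"
  have "(\<Sum>j<n. ?d (int j)) = ?d a + ?d b"
    by (rule sum_two_classes)
      (use ab \<open>0 < n\<close> in \<open>auto simp: class_swap_shift affine_shift[OF f]\<close>, auto simp: class_swap_def)
  also have "\<dots> = 2 * ((b - a) * (f b - f a))"
    using ab by (simp add: power2_eq_square algebra_simps)
  finally show ?thesis
    by (simp add: energy_def sum_subtractf)
qed

text \<open>
  The \<open>n\<close> increments of \<open>f\<close> over a window are positive and add up to \<open>n\<close>, so each is one, and the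
  displacement sum removes the remaining translation.
\<close>

lemma affine_no_descent_id:
  assumes f: "f \<in> affine_perms n" and "0 < n" and inc: "\<And>x. f (x - 1) < f x"
  shows "f = id"
proof -
  have ge: "f x + int m \<le> f (x + int m)" for x m
  proof (induction m)
    case (Suc m)
    then show ?case using inc[of "x + int (Suc m)"] by (simp add: algebra_simps)
  qed simp
  have step: "f (x + 1) = f x + 1" for x
  proof (rule antisym)
    have "f (x + 1) + int (n - 1) \<le> f (x + 1 + int (n - 1))" by (rule ge)
    also have "\<dots> = f (x + int n)" using \<open>0 < n\<close> by (simp add: of_nat_diff)
    also have "\<dots> = f x + int n" by (rule affine_shift[OF f])
    finally show "f (x + 1) \<le> f x + 1" using \<open>0 < n\<close> by (simp add: of_nat_diff)
  qed (use ge[of x 1] in simp)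
  have "f x = x + f 0" for x
  proof (induction x rule: int_induct[where k = 0])
    case (step1 i)
    then show ?case using step[of i] by simp
  next
    case (step2 i)
    then show ?case using step[of "i - 1"] by simp
  qed simp
  note fx = this
  have "(\<Sum>j<n. f (int j) - int j) = (\<Sum>j<n. f 0)"
    by (intro sum.cong refl) (simp add: fx[of "int _"])
  then have "f 0 = 0" using \<open>0 < n\<close> f by (simp add: affine_perms_def)
  then have "f x = x" for x using fx[of x] by linarith
  then show ?thesis by auto
qed

lemma adjacent_swap_mod: "adjacent_swap n (nat (x mod int n)) = class_swap n (x - 1) x" if "0 < n"
proof -
  have "(x mod int n - 1) mod int n = (x - 1) mod int n" by (simp add: mod_diff_left_eq)
  then show ?thesis using that by (auto simp: class_swap_def fun_eq_iff)
qed

text \<open>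
  Removing descents one by one terminates because each removal lowers the energy; without descents
  only the identity remains.
\<close>

lemma affine_perm_word:
  assumes "2 \<le> n" "f \<in> affine_perms n"
  shows "\<exists>xs. set xs \<subseteq> {0..<n} \<and> word_perm n xs = f"
  using assms(2)
proof (induction "nat (energy n f)" arbitrary: f rule: less_induct)
  case less
  show ?case
  proof (cases "\<exists>x. f x < f (x - 1)")
    case False
    have "f (x - 1) < f x" for x
    proof -
      have "f (x - 1) \<noteq> f x" by (simp add: affine_inj[OF less.prems])
      then show ?thesis using False by (meson linorder_cases)
    qed
    then have "f = id" using affine_no_descent_id less.prems assms(1) by auto
    then show ?thesis by (intro exI[of _ "[]"]) simp
  next
    case True
    then obtain x where x: "f x < f (x - 1)" by blast
    let ?s = "class_swap n (x - 1) x" and ?i = "nat (x mod int n)"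
    have s: "?s = adjacent_swap n ?i" using assms(1) adjacent_swap_mod[of n x] by simp
    have i: "?i < n" using assms(1) by (simp add: nat_less_iff)
    have fs: "f \<circ> ?s \<in> affine_perms n"
      using less.prems assms(1) by (intro affine_compose class_swap_affine) (auto simp: consecutive_mod)
    have "energy n (f \<circ> ?s) = energy n f + 2 * ((x - (x - 1)) * (f x - f (x - 1)))"
      by (rule energy_swap) (use less.prems assms(1) in \<open>auto simp: consecutive_mod\<close>)
    moreover have "0 \<le> energy n (f \<circ> ?s)" by (simp add: energy_def sum_nonneg)
    ultimately have "nat (energy n (f \<circ> ?s)) < nat (energy n f)" using x by simp
    from less.hyps[OF this fs] obtain xs where xs: "set xs \<subseteq> {0..<n}" "word_perm n xs = f \<circ> ?s" by blast
    have "word_perm n (xs @ [?i]) = f \<circ> (?s \<circ> ?s)"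
      using s by (simp add: word_perm_append xs comp_assoc)
    also have "?s \<circ> ?s = id"
      by (auto simp: fun_eq_iff class_swap_involution consecutive_mod assms(1))
    finally have "word_perm n (xs @ [?i]) = f" by simp
    then show ?thesis using xs i by (intro exI[of _ "xs @ [?i]"]) auto
  qed
qed

lemma adjacent_swap_reverses:
  assumes "2 \<le> n" "x < y" "adjacent_swap n i y < adjacent_swap n i x"
  shows "y = x + 1" "adjacent_swap n i = class_swap n x y"
proof -
  have *: "x mod int n = (int i - 1) mod int n" "y = x + 1"
    using assms unfolding class_swap_def by (auto split: if_splits)
  have "y mod int n = int i mod int n"
    using *(1) unfolding *(2) by (metis diff_add_cancel mod_add_left_eq)
  then show "y = x + 1" "adjacent_swap n i = class_swap n x y"
    using * by (auto simp: class_swap_def fun_eq_iff)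
qed

text \<open>
  Apply the letters of the word to \<open>a\<close> and \<open>b\<close> from right to left. Their images start in the order
  \<open>a < b\<close> and end in the opposite order, so some letter \<open>s\<^sub>i\<close> reverses them. An adjacent swap only
  reverses neighbours, so it exchanges exactly the two images; hence deleting this letter has the
  same effect as exchanging \<open>a\<close> and \<open>b\<close> first, and the exchange is the conjugate of \<open>s\<^sub>i\<close> by the
  letters already read.
\<close>

lemma strong_exchange:
  assumes "2 \<le> n" "a < b" "a mod int n \<noteq> b mod int n"
    and "word_perm n xs b < word_perm n xs a"
  shows "\<exists>ys i u. set ys \<subseteq> set xs \<and> length ys < length xs \<and>
    word_perm n ys = word_perm n xs \<circ> class_swap n a b \<and>
    i \<in> set xs \<and> u \<in> affine_perms n \<and> u \<circ> class_swap n a b = adjacent_swap n i \<circ> u"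
  using assms(4)
proof (induction xs)
  case Nil
  then show ?case using assms(2) by simp
next
  case (Cons i xs)
  define u where "u = word_perm n xs"
  have u: "u \<in> affine_perms n" unfolding u_def using assms(1) by (rule word_perm_affine)
  show ?case
  proof (cases "u b < u a")
    case True
    then obtain ys j v where "set ys \<subseteq> set xs" "length ys < length xs"
      "word_perm n ys = u \<circ> class_swap n a b" "j \<in> set xs" "v \<in> affine_perms n"
      "v \<circ> class_swap n a b = adjacent_swap n j \<circ> v"
      using Cons.IH unfolding u_def by blast
    then show ?thesis
      by (intro exI[of _ "i # ys"] exI[of _ j] exI[of _ v]) (auto simp: u_def comp_assoc)
  next
    case False
    then have "u a < u b" using affine_inj[OF u, of a b] assms(2) by simp
    then have sw: "adjacent_swap n i = class_swap n (u a) (u b)"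
    proof (rule adjacent_swap_reverses(2)[OF assms(1)])
      show "adjacent_swap n i (u b) < adjacent_swap n i (u a)" using Cons.prems by (simp add: u_def)
    qed
    have conj: "u \<circ> class_swap n a b = adjacent_swap n i \<circ> u"
      unfolding sw using class_swap_conj[OF u] by (simp add: fun_eq_iff)
    have "adjacent_swap n i (u (class_swap n a b x)) = u x" for x
      using fun_cong[OF conj, of x] by (simp add: class_swap_involution consecutive_mod assms(1))
    then have deleted: "word_perm n xs = word_perm n (i # xs) \<circ> class_swap n a b"
      by (simp add: u_def fun_eq_iff)
    show ?thesis
    proof (intro exI conjI)
      show "set xs \<subseteq> set (i # xs)" "length xs < length (i # xs)" "i \<in> set (i # xs)" by auto
    qed (rule deleted u conj)+
  qed
qed

section \<open>Length and climbing\<close>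

definition perm_length :: "nat \<Rightarrow> (int \<Rightarrow> int) \<Rightarrow> nat" where
  "perm_length n f = (LEAST k. \<exists>xs. set xs \<subseteq> {0..<n} \<and> length xs = k \<and> word_perm n xs = f)"

definition perm_step :: "nat \<Rightarrow> (int \<Rightarrow> int) \<Rightarrow> (int \<Rightarrow> int) \<Rightarrow> bool" where
  "perm_step n f g \<longleftrightarrow> (\<exists>a b. a < b \<and> a mod int n \<noteq> b mod int n \<and> f a < f b \<and> g = f \<circ> class_swap n a b)"

text \<open>
  Apply \<open>strong_exchange\<close> to a shortest word for \<open>g\<close>. This yields both a shorter word for \<open>f\<close> and
  the fact that \<open>f\<close> and \<open>g\<close> differ by a conjugate of a generator.
\<close>

lemma perm_step_length:
  assumes n: "2 \<le> n" and f: "f \<in> affine_perms n" and "perm_step n f g"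
  shows "perm_length n f < perm_length n g"
    and "\<exists>a b i u. g = f \<circ> class_swap n a b \<and> a mod int n \<noteq> b mod int n \<and> i < n \<and>
      u \<in> affine_perms n \<and> u \<circ> class_swap n a b = adjacent_swap n i \<circ> u"
proof -
  obtain a b where ab: "a < b" "a mod int n \<noteq> b mod int n" "f a < f b" and g: "g = f \<circ> class_swap n a b"
    using assms(3) by (auto simp: perm_step_def)
  have "g \<in> affine_perms n" unfolding g using f ab n by (intro affine_compose class_swap_affine) auto
  then have "\<exists>k xs. set xs \<subseteq> {0..<n} \<and> length xs = k \<and> word_perm n xs = g"
    using affine_perm_word[OF n] by blast
  then have "\<exists>xs. set xs \<subseteq> {0..<n} \<and> length xs = perm_length n g \<and> word_perm n xs = g"
    unfolding perm_length_def by (rule LeastI_ex)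
  then obtain xs where xs: "set xs \<subseteq> {0..<n}" "length xs = perm_length n g" "word_perm n xs = g" by blast
  have "word_perm n xs b < word_perm n xs a" using ab by (simp add: xs g)
  from strong_exchange[OF n ab(1,2) this] obtain ys i u where ys: "set ys \<subseteq> set xs" "length ys < length xs"
    "word_perm n ys = word_perm n xs \<circ> class_swap n a b"
    and i: "i \<in> set xs" "u \<in> affine_perms n" "u \<circ> class_swap n a b = adjacent_swap n i \<circ> u" by blast
  have "word_perm n ys = f" using ys(3) ab(2) by (auto simp: xs g class_swap_involution fun_eq_iff)
  then have "perm_length n f \<le> length ys"
    unfolding perm_length_def using ys(1) xs(1) by (intro Least_le) auto
  then show "perm_length n f < perm_length n g" using ys xs by simp
  show "\<exists>a b i u. g = f \<circ> class_swap n a b \<and> a mod int n \<noteq> b mod int n \<and> i < n \<and>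
      u \<in> affine_perms n \<and> u \<circ> class_swap n a b = adjacent_swap n i \<circ> u"
  proof (intro exI conjI)
    show "i < n" using i(1) xs(1) by auto
  qed (rule g ab(2) i(2,3))+
qed

text \<open>
  The energy increases along every step and is bounded on \<open>D\<close>.
\<close>

lemma climb_to_top:
  assumes n: "2 \<le> n"
    and D: "\<And>f. f \<in> D \<Longrightarrow> f \<in> affine_perms n" "\<And>f. f \<in> D \<Longrightarrow> energy n f \<le> B"
    and step: "\<And>f. f \<in> D \<Longrightarrow> f \<noteq> k \<Longrightarrow> \<exists>g\<in>D. R f g"
    and R: "\<And>f g. R f g \<Longrightarrow> perm_step n f g"
    and "f \<in> D"
  shows "(\<lambda>f g. f \<in> D \<and> g \<in> D \<and> R f g)\<^sup>*\<^sup>* f k"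
  using assms(6)
proof (induction "nat (B - energy n f)" arbitrary: f rule: less_induct)
  case less
  show ?case
  proof (cases "f = k")
    case False
    then obtain g where g: "g \<in> D" "R f g" using step less.prems by blast
    obtain a b where ab: "a < b" "a mod int n \<noteq> b mod int n" "f a < f b" and gf: "g = f \<circ> class_swap n a b"
      using R[OF g(2)] by (auto simp: perm_step_def)
    have "energy n g = energy n f + 2 * ((b - a) * (f b - f a))"
      unfolding gf using D(1)[OF less.prems] ab n by (intro energy_swap) auto
    moreover have "0 < (b - a) * (f b - f a)" using ab by simp
    ultimately have "nat (B - energy n g) < nat (B - energy n f)"
      using D(2)[OF g(1)] by linarith
    then show ?thesis
      using less.hyps[OF _ g(1)] g less.prems by (intro converse_rtranclp_into_rtranclp[of _ f g k]) auto
  qed simp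
qed

text \<open>
  The remaining value in the window is determined by the displacement sum.
\<close>

lemma affine_eqI:
  assumes n: "0 < n" and f: "f \<in> affine_perms n" and g: "g \<in> affine_perms n"
    and eq: "\<And>j. 0 < j \<Longrightarrow> j < n \<Longrightarrow> f (c + int j) = g (c + int j)"
  shows "f = g"
proof -
  let ?d = "\<lambda>x. f x - g x"
  have per: "?d (x + int n) = ?d x" for x by (simp add: affine_shift[OF f] affine_shift[OF g])
  have "(\<Sum>j<n. ?d (c + int j)) = (\<Sum>j<n. ?d (int j))"
    by (rule sum_window[where d = ?d]) (rule per)
  also have "\<dots> = (\<Sum>j<n. f (int j) - int j) - (\<Sum>j<n. g (int j) - int j)"
    by (simp add: sum_subtractf[symmetric])
  also have "\<dots> = 0" using f g by (simp add: affine_perms_def)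
  finally have sum0: "(\<Sum>j<n. ?d (c + int j)) = 0" .
  have "(\<Sum>j<n. ?d (c + int j)) = ?d (c + int 0) + (\<Sum>j\<in>{..<n} - {0}. ?d (c + int j))"
    using n by (intro sum.remove) auto
  also have "(\<Sum>j\<in>{..<n} - {0}. ?d (c + int j)) = 0"
    using eq by (intro sum.neutral) auto
  finally have "?d (c + int 0) = 0" using sum0 by simp
  then have all: "?d (c + int j) = 0" if "j < n" for j
    using eq[of j] that by (cases "j = 0") auto
  have "?d x = 0" for x
  proof -
    define j where "j = nat ((x - c) mod int n)"
    have j: "int j = (x - c) mod int n" "j < n" using n by (auto simp: j_def nat_less_iff)
    have "(c + (x - c) mod int n) mod int n = x mod int n" by (simp add: mod_add_right_eq)
    then have "x mod int n = (c + int j) mod int n" unfolding j by simp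
    then have "?d x = ?d (c + int j)"
      by (rule periodic_cong[where d = ?d, OF per])
    then show ?thesis using all[OF j(2)] by simp
  qed
  then show ?thesis by auto
qed

lemma energy_window:
  assumes f: "f \<in> affine_perms n"
  shows "energy n f = (\<Sum>j<n. (f (c + int j) - (c + int j))\<^sup>2)"
  unfolding energy_def
  by (rule sum_window[where d = "\<lambda>x. (f x - x)\<^sup>2", symmetric]) (simp add: affine_shift[OF f])

section \<open>Admissible permutations\<close>

definition admissible_perms :: "nat \<Rightarrow> (int \<Rightarrow> int) set" where
  "admissible_perms n = {f \<in> affine_perms n. \<forall>x \<ge> int n - 1. 0 \<le> f x}"

lemma admissible_window:
  assumes n: "0 < n" and f: "f \<in> affine_perms n"
    and pos: "\<And>x. int n - 1 \<le> x \<Longrightarrow> x < 2 * int n - 1 \<Longrightarrow> 0 \<le> f x"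
  shows "f \<in> admissible_perms n"
proof -
  have "0 \<le> f x" if x: "int n - 1 \<le> x" for x
  proof -
    define q y where "q = (x - (int n - 1)) div int n" and "y = int n - 1 + (x - (int n - 1)) mod int n"
    have eq: "x = y + int n * q"
      using mult_div_mod_eq[of "int n" "x - (int n - 1)"] unfolding q_def y_def by linarith
    have "0 \<le> f y" unfolding y_def using n by (intro pos) auto
    moreover have "0 \<le> int n * q" using x n by (simp add: q_def pos_imp_zdiv_nonneg_iff)
    ultimately show ?thesis
      unfolding eq affine_shift(1)[OF f] by linarith
  qed
  then show ?thesis using f by (simp add: admissible_perms_def)
qed

text \<open>
  On the window that starts at \<open>n - 1\<close> the values are nonnegative and have a fixed sum.
\<close>

lemma admissible_energy_bound:
  assumes "0 < n"
  shows "\<exists>B. \<forall>f \<in> admissible_perms n. energy n f \<le> B"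
proof -
  let ?c = "int n - 1"
  define S where "S = (\<Sum>j<n. ?c + int j)"
  have "energy n f \<le> (\<Sum>j<n. (S + 2 * int n)\<^sup>2)" if f: "f \<in> admissible_perms n" for f
  proof -
    have fa: "f \<in> affine_perms n" using f by (simp add: admissible_perms_def)
    have pos: "0 \<le> f (?c + int j)" for j using f by (simp add: admissible_perms_def)
    have "(\<Sum>j<n. f (?c + int j) - (?c + int j)) = (\<Sum>j<n. f (int j) - int j)"
      by (rule sum_window[where d = "\<lambda>x. f x - x"]) (simp add: affine_shift[OF fa])
    then have S: "(\<Sum>j<n. f (?c + int j)) = S"
      using fa by (simp add: affine_perms_def S_def sum_subtractf)
    have "(f (?c + int j) - (?c + int j))\<^sup>2 \<le> (S + 2 * int n)\<^sup>2" if j: "j < n" for j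
    proof (rule abs_le_square_iff[THEN iffD1])
      have "f (?c + int j) \<le> S"
        unfolding S[symmetric] using pos j by (intro member_le_sum) auto
      moreover have "0 \<le> S" unfolding S[symmetric] using pos by (intro sum_nonneg) auto
      ultimately show "\<bar>f (?c + int j) - (?c + int j)\<bar> \<le> \<bar>S + 2 * int n\<bar>"
        using pos[of j] j by linarith
    qed
    then show ?thesis unfolding energy_window[OF fa, of ?c] by (intro sum_mono) auto
  qed
  then show ?thesis by blast
qed

text \<open>
  The reflection exchanges \<open>p - k n\<close> and \<open>q\<close>. Among the positions of the window from \<open>n - 1\<close> to
  \<open>2 n - 2\<close> it only affects \<open>p\<close> and \<open>q\<close>, whose values become \<open>f q + k n\<close> and \<open>f p - k n\<close>.
\<close>

lemma admissible_swap:
  assumes n: "0 < n" and f: "f \<in> admissible_perms n"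
    and p: "int n - 1 \<le> p" "p < 2 * int n - 1" and q: "int n - 1 \<le> q" "q < 2 * int n - 1"
    and "p \<noteq> q" "0 \<le> k" "p - k * int n < q" "0 \<le> f p - k * int n" "f p - k * int n < f q"
  shows "\<exists>g \<in> admissible_perms n. perm_step n f g"
proof -
  define a where "a = p - k * int n"
  have fa: "f \<in> affine_perms n" using f by (simp add: admissible_perms_def)
  have a: "p = a + int n * k" "a mod int n = p mod int n" by (simp_all add: a_def mod_eq_dvd_iff mult.commute)
  have uniq: "x = y" if "x mod int n = y mod int n" "int n - 1 \<le> x" "x < 2 * int n - 1"
    "int n - 1 \<le> y" "y < 2 * int n - 1" for x y
  proof -
    have "int n dvd x - y" using that by (simp add: mod_eq_dvd_iff)
    moreover have "\<bar>x - y\<bar> < int n" using that by linarith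
    ultimately show ?thesis using dvd_imp_le_int[of "x - y" "int n"] n by force
  qed
  have ab: "a mod int n \<noteq> q mod int n" using uniq[OF _ p q] \<open>p \<noteq> q\<close> a(2) by auto
  have fp: "f a = f p - k * int n"
    using affine_shift(1)[OF fa, of a k] a by (simp add: mult.commute)
  let ?g = "f \<circ> class_swap n a q"
  have ga: "?g \<in> affine_perms n"
    using fa n ab by (intro affine_compose class_swap_affine) auto
  have "?g \<in> admissible_perms n"
  proof (rule admissible_window[OF n ga])
    fix x assume x: "int n - 1 \<le> x" "x < 2 * int n - 1"
    have "x mod int n \<noteq> p mod int n" if "x \<noteq> p" using uniq[OF _ x p] that by blast
    moreover have "x mod int n \<noteq> q mod int n" if "x \<noteq> q" using uniq[OF _ x q] that by blast
    ultimately consider "x = p" | "x = q" | "x mod int n \<noteq> p mod int n" "x mod int n \<noteq> q mod int n"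
      by blast
    then show "0 \<le> ?g x"
    proof cases
      case 1
      have "class_swap n a q p = p + (q - a)" by (simp add: class_swap_def a(2))
      then have "class_swap n a q p = q + int n * k" using a(1) by simp
      then have "?g x = f q + int n * k" using affine_shift(1)[OF fa, of q k] 1 by simp
      moreover have "0 \<le> f q" using f q by (simp add: admissible_perms_def)
      ultimately show ?thesis using \<open>0 \<le> k\<close> by simp
    next
      case 2
      then have "?g x = f a" using ab by simp
      then show ?thesis using fp assms by simp
    next
      case 3
      then have "?g x = f x" by (simp add: class_swap_def a(2))
      then show ?thesis using f x by (simp add: admissible_perms_def)
    qed
  qed
  moreover have "perm_step n f ?g"
    unfolding perm_step_def using assms ab fp by (intro exI[of _ a] exI[of _ q]) (auto simp: a_def)
  ultimately show ?thesis by blast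
qed

text \<open>
  Unless \<open>f\<close> is decreasing on the window that starts at \<open>n - 1\<close>, two of its values can be
  exchanged. A value that is at least \<open>n\<close>, at a position other than the first, can be lowered by
  \<open>n\<close> in favour of the first. Finally \<open>n - 1\<close> cannot occur after the first position: otherwise the
  first value could be lowered by a multiple of \<open>n\<close> to its remainder, which would be smaller than
  \<open>n - 1\<close>. So the values after the first are \<open>n - 2, \<dots>, 0\<close>.
\<close>

lemma admissible_top:
  assumes n: "2 \<le> n" and f: "f \<in> admissible_perms n"
    and top: "\<And>g. g \<in> admissible_perms n \<Longrightarrow> \<not> perm_step n f g"
    and j: "0 < j" "j < n"
  shows "f (int n - 1 + int j) = int n - 1 - int j"
proof -
  have n0: "0 < n" using n by simp
  have fa: "f \<in> affine_perms n" using f by (simp add: admissible_perms_def)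
  have pos: "0 \<le> f x" if "int n - 1 \<le> x" for x using f that by (simp add: admissible_perms_def)
  have dec: "f q < f p" if "int n - 1 \<le> p" "p < q" "q < 2 * int n - 1" for p q
  proof (rule ccontr)
    assume "\<not> ?thesis"
    then have "f p < f q" using affine_inj[OF fa, of p q] that by linarith
    then have "\<exists>g \<in> admissible_perms n. perm_step n f g"
      using that pos[of p] by (intro admissible_swap[OF n0 f, of p q 0]) auto
    then show False using top by blast
  qed
  have small: "f p < int n" if p: "int n - 1 < p" "p < 2 * int n - 1" for p
  proof (rule ccontr)
    assume "\<not> ?thesis"
    moreover have "f p < f (int n - 1)" using p by (intro dec) auto
    ultimately have "\<exists>g \<in> admissible_perms n. perm_step n f g"
      using p n by (intro admissible_swap[OF n0 f, of p "int n - 1" 1]) auto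
    then show False using top by blast
  qed
  have ne: "f p \<noteq> int n - 1" if p: "int n - 1 < p" "p < 2 * int n - 1" for p
  proof
    assume fp: "f p = int n - 1"
    let ?k = "f (int n - 1) div int n" and ?r = "f (int n - 1) mod int n"
    have eq: "f (int n - 1) - ?k * int n = ?r" by (simp add: minus_div_mult_eq_mod)
    have k: "0 \<le> ?k" using pos[of "int n - 1"] n by (simp add: pos_imp_zdiv_nonneg_iff)
    have "?r \<noteq> f p mod int n"
    proof
      assume "?r = f p mod int n"
      then have "int n dvd p - (int n - 1)"
        using affine_mod_eq[OF fa] by (metis mod_eq_dvd_iff)
      moreover have "0 < p - (int n - 1)" "p - (int n - 1) < int n" using p by auto
      ultimately show False using zdvd_not_zless by blast
    qed
    moreover have "f p mod int n = int n - 1"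
      unfolding fp using n by (intro mod_pos_pos_trivial) auto
    ultimately have "?r \<noteq> int n - 1" by simp
    moreover have "0 \<le> ?r" "?r < int n" using n by simp_all
    ultimately have r: "0 \<le> ?r" "?r < f p" using fp by linarith+
    have "0 \<le> ?k * int n" using k by simp
    then have lt: "int n - 1 - ?k * int n < p" using p by linarith
    have "\<exists>g \<in> admissible_perms n. perm_step n f g"
      using p n k r eq lt by (intro admissible_swap[OF n0 f, of "int n - 1" p ?k]) auto
    then show False using top by blast
  qed
  have upper: "f (int n - 1 + int m) \<le> int n - 1 - int m" if "0 < m" "m < n" for m
    using that
  proof (induction m)
    case (Suc m)
    show ?case
    proof (cases "m = 0")
      case True
      then show ?thesis using small[of "int n"] ne[of "int n"] n by auto
    next
      case False
      have "f (int n - 1 + int (Suc m)) < f (int n - 1 + int m)"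
        using Suc.prems by (intro dec) auto
      then show ?thesis using Suc False by auto
    qed
  qed simp
  have lower: "int m \<le> f (2 * int n - 2 - int m)" if "m < n - 1" for m
    using that
  proof (induction m)
    case 0
    then show ?case using pos[of "2 * int n - 2"] n by simp
  next
    case (Suc m)
    have "f (2 * int n - 2 - int m) < f (2 * int n - 2 - int (Suc m))"
      using Suc.prems by (intro dec) auto
    then show ?case using Suc by auto
  qed
  show ?thesis
  proof (rule antisym)
    show "f (int n - 1 + int j) \<le> int n - 1 - int j" using j by (rule upper)
    have eq: "2 * int n - 2 - (int n - 1 - int j) = int n - 1 + int j" "int (n - 1 - j) = int n - 1 - int j"
      using j by (simp_all add: of_nat_diff)
    have "int (n - 1 - j) \<le> f (2 * int n - 2 - int (n - 1 - j))"
      using j by (intro lower) auto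
    then show "int n - 1 - int j \<le> f (int n - 1 + int j)"
      by (simp only: eq)
  qed
qed

text \<open>
  The top of the admissible permutations is unique, since its values on \<open>n, \<dots>, 2 n - 2\<close> are known;
  shifting them by \<open>-n\<close> gives the values \<open>-2, \<dots>, -n\<close> on \<open>0, \<dots>, n - 2\<close>.
\<close>

lemma admissible_climb:
  assumes n: "2 \<le> n" and k: "k \<in> affine_perms n" "\<And>x. 0 \<le> x \<Longrightarrow> x \<le> int n - 2 \<Longrightarrow> k x = - 2 - x"
    and f: "f \<in> admissible_perms n"
  shows "(\<lambda>f g. f \<in> affine_perms n \<and> g \<in> affine_perms n \<and> perm_step n f g)\<^sup>*\<^sup>* f k"
proof -
  obtain B where B: "\<And>f. f \<in> admissible_perms n \<Longrightarrow> energy n f \<le> B"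
    using admissible_energy_bound[of n] n by auto
  have aff: "f \<in> affine_perms n" if "f \<in> admissible_perms n" for f
    using that by (simp add: admissible_perms_def)
  have "(\<lambda>f g. f \<in> admissible_perms n \<and> g \<in> admissible_perms n \<and> perm_step n f g)\<^sup>*\<^sup>* f k"
  proof (rule climb_to_top[OF n aff B])
    fix f assume f: "f \<in> admissible_perms n" "f \<noteq> k"
    show "\<exists>g\<in>admissible_perms n. perm_step n f g"
    proof (rule ccontr)
      assume "\<not> ?thesis"
      then have top: "\<And>g. g \<in> admissible_perms n \<Longrightarrow> \<not> perm_step n f g" by blast
      have "f = k"
      proof (rule affine_eqI[OF _ aff[OF f(1)] k(1), of "int n - 1"])
        fix j assume j: "0 < j" "j < n"
        have "k (int n - 1 + int j) = k (int j - 1) + int n"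
          using affine_shift(2)[OF k(1), of "int j - 1"] by (simp add: algebra_simps)
        also have "\<dots> = int n - 1 - int j" using j by (subst k(2)) auto
        finally show "f (int n - 1 + int j) = k (int n - 1 + int j)"
          using admissible_top[OF n f(1) top j] by simp
      qed (use n in auto)
      then show False using f(2) by simp
    qed
  qed (use f in auto)
  then show ?thesis by (rule rtranclp_mono[THEN predicate2D, rotated]) (use aff in auto)
qed

section \<open>The finite parabolic subgroup\<close>

text \<open>
  The subgroup generated by \<open>s\<^sub>1, \<dots>, s\<^sub>n\<^sub>-\<^sub>2\<close>: the permutations of \<open>0, \<dots>, n - 2\<close>, with \<open>n - 1\<close>
  fixed and extended periodically.
\<close>

definition finite_perms :: "nat \<Rightarrow> (int \<Rightarrow> int) set" where
  "finite_perms n = {f \<in> affine_perms n. f (int n - 1) = int n - 1 \<and> (\<forall>x \<in> {0..int n - 2}. f x \<in> {0..int n - 2})}"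

lemma finite_perms_id: "id \<in> finite_perms n"
  by (simp add: finite_perms_def affine_id)

lemma finite_perms_compose: "f \<in> finite_perms n \<Longrightarrow> g \<in> finite_perms n \<Longrightarrow> f \<circ> g \<in> finite_perms n"
  by (simp add: finite_perms_def affine_compose)

lemma finite_perms_adjacent:
  assumes "2 \<le> n" "1 \<le> i" "i \<le> n - 2"
  shows "adjacent_swap n i \<in> finite_perms n"
proof -
  have "adjacent_swap n i x = (if x = int i - 1 then int i else if x = int i then int i - 1 else x)"
    if "0 \<le> x" "x < int n" for x
    using that assms by (auto simp: class_swap_def)
  then show ?thesis
    using assms adjacent_swap_affine[of n i] by (auto simp: finite_perms_def)
qed

lemma finite_perms_energy: "0 < n \<Longrightarrow> f \<in> finite_perms n \<Longrightarrow> energy n f \<le> (\<Sum>j<n. (int n)\<^sup>2)"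
  unfolding energy_def
proof (intro sum_mono abs_le_square_iff[THEN iffD1])
  fix j assume f: "f \<in> finite_perms n" and j: "j \<in> {..<n}"
  show "\<bar>f (int j) - int j\<bar> \<le> \<bar>int n\<bar>"
  proof (cases "j = n - 1")
    case True
    then show ?thesis using f j by (simp add: finite_perms_def of_nat_diff)
  next
    case False
    then have "int j \<in> {0..int n - 2}" using j by auto
    then have "f (int j) \<in> {0..int n - 2}" using f unfolding finite_perms_def by blast
    then show ?thesis using j by auto
  qed
qed

lemma finite_perms_top:
  assumes n: "2 \<le> n" and f: "f \<in> finite_perms n"
    and top: "\<And>i. 1 \<le> i \<Longrightarrow> i \<le> n - 2 \<Longrightarrow> \<not> f (int i - 1) < f (int i)"
    and x: "0 \<le> x" "x \<le> int n - 2"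
  shows "f x = int n - 2 - x"
proof -
  have fa: "f \<in> affine_perms n" using f by (simp add: finite_perms_def)
  have ran: "0 \<le> f x \<and> f x \<le> int n - 2" if "0 \<le> x" "x \<le> int n - 2" for x
    using f that by (auto simp: finite_perms_def)
  have dec: "f (int i) < f (int i - 1)" if "1 \<le> i" "i \<le> n - 2" for i
    using top[OF that] affine_inj[OF fa, of "int i" "int i - 1"] by linarith
  have upper: "f (int m) \<le> int n - 2 - int m" if "m \<le> n - 2" for m
    using that
  proof (induction m)
    case 0
    then show ?case using ran[of 0] n by simp
  next
    case (Suc m)
    then show ?case using dec[of "Suc m"] by auto
  qed
  have lower: "int m \<le> f (int (n - 2 - m))" if "m \<le> n - 2" for m
    using that
  proof (induction m)
    case 0
    then show ?case using ran[of "int (n - 2)"] n by (simp add: of_nat_diff)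
  next
    case (Suc m)
    have eq: "int (n - 2 - m) - 1 = int (n - 2 - Suc m)" using Suc.prems by (simp add: of_nat_diff)
    have "f (int (n - 2 - m)) < f (int (n - 2 - m) - 1)"
      using Suc.prems by (intro dec) auto
    then have "f (int (n - 2 - m)) < f (int (n - 2 - Suc m))" unfolding eq .
    moreover have "int m \<le> f (int (n - 2 - m))" using Suc by auto
    ultimately show ?case by linarith
  qed
  have "f (int (nat x)) \<le> int n - 2 - int (nat x)" using x by (intro upper) auto
  moreover have "int (n - 2 - nat x) \<le> f (int (n - 2 - (n - 2 - nat x)))" using x by (intro lower) auto
  moreover have "n - 2 - (n - 2 - nat x) = nat x" using x by auto
  ultimately show ?thesis using x by (simp add: of_nat_diff)
qed

definition adjacent_step :: "nat \<Rightarrow> (int \<Rightarrow> int) \<Rightarrow> (int \<Rightarrow> int) \<Rightarrow> bool" where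
  "adjacent_step n f g \<longleftrightarrow>
     (\<exists>i. 1 \<le> i \<and> i \<le> n - 2 \<and> f (int i - 1) < f (int i) \<and> g = f \<circ> adjacent_swap n i)"

lemma adjacent_step_perm_step: "2 \<le> n \<Longrightarrow> adjacent_step n f g \<Longrightarrow> perm_step n f g"
  unfolding adjacent_step_def perm_step_def
  by (elim exE conjE, intro exI conjI) (auto simp: consecutive_mod)

lemma finite_perms_climb:
  assumes n: "2 \<le> n" and w: "w \<in> affine_perms n" "\<And>x. 0 \<le> x \<Longrightarrow> x \<le> int n - 2 \<Longrightarrow> w x = int n - 2 - x"
    and f: "f \<in> finite_perms n"
  shows "(\<lambda>f g. f \<in> finite_perms n \<and> g \<in> finite_perms n \<and> adjacent_step n f g)\<^sup>*\<^sup>* f w"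
proof (rule climb_to_top[OF n])
  show aff: "f \<in> affine_perms n" if "f \<in> finite_perms n" for f
    using that by (simp add: finite_perms_def)
  show "energy n f \<le> (\<Sum>j<n. (int n)\<^sup>2)" if "f \<in> finite_perms n" for f
    using finite_perms_energy that n by auto
  fix f assume f: "f \<in> finite_perms n" "f \<noteq> w"
  show "\<exists>g\<in>finite_perms n. adjacent_step n f g"
  proof (rule ccontr)
    assume no: "\<not> ?thesis"
    have "\<not> f (int i - 1) < f (int i)" if "1 \<le> i" "i \<le> n - 2" for i
      using no that f(1) finite_perms_compose[OF f(1) finite_perms_adjacent[OF n that]]
      unfolding adjacent_step_def by blast
    then have top: "f x = int n - 2 - x" if "0 \<le> x" "x \<le> int n - 2" for x
      using finite_perms_top[OF n f(1) _ that] by blast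
    have "f = w"
    proof (rule affine_eqI[OF _ aff[OF f(1)] w(1), of "- 1"])
      fix j assume j: "0 < j" "j < n"
      show "f (- 1 + int j) = w (- 1 + int j)"
        using j by (subst top) (auto simp: w(2))
    qed (use n in auto)
    then show False using f(2) by simp
  qed
next
  show "perm_step n f g" if "adjacent_step n f g" for f g
    using n that by (rule adjacent_step_perm_step)
qed (rule f)

section \<open>Monomial matrices and the affine Weyl group\<close>

text \<open>
  The matrix that maps the basis vector numbered \<open>j\<close> to a multiple of the one numbered \<open>f j\<close>, in
  the numbering of \<open>t\<^sup>-\<^sup>k e\<^sub>j\<close> by \<open>j + n k\<close>.
\<close>

definition monom_mat :: "nat \<Rightarrow> (int \<Rightarrow> int) \<Rightarrow> (nat \<Rightarrow> complex) \<Rightarrow> complex fls mat" where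
  "monom_mat n f c = mat n n (\<lambda>(i, j).
     if f (int j) mod int n = int i then fls_const (c j) * fls_X_intpow (- (f (int j) div int n)) else 0)"

lemma monom_mat_carrier [simp]: "monom_mat n f c \<in> carrier_mat n n"
  by (simp add: monom_mat_def)

lemma monom_mat_index:
  "i < n \<Longrightarrow> j < n \<Longrightarrow> monom_mat n f c $$ (i, j) =
     (if f (int j) mod int n = int i then fls_const (c j) * fls_X_intpow (- (f (int j) div int n)) else 0)"
  by (simp add: monom_mat_def)

lemma const_X_intpow_nth:
  fixes c :: complex
  shows "fls_nth (fls_const c * fls_X_intpow a) k = (if k = a then c else 0)"
  by (auto simp: fls_X_intpow_times_conv_shift)

lemma const_X_intpow_mult:
  fixes c d :: complex
  shows "(fls_const c * fls_X_intpow a) * (fls_const d * fls_X_intpow b) = fls_const (c * d) * fls_X_intpow (a + b)"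
  by (simp only: fls_X_intpow_times_fls_X_intpow[symmetric] fls_const_mult_const[symmetric] mult_ac)

lemma monom_mat_mult:
  assumes f: "f \<in> affine_perms n"
  shows "monom_mat n f c * monom_mat n g d =
    monom_mat n (f \<circ> g) (\<lambda>j. c (nat (g (int j) mod int n)) * d j)"
proof (rule eq_matI)
  fix i j assume "i < dim_row (monom_mat n (f \<circ> g) (\<lambda>j. c (nat (g (int j) mod int n)) * d j))"
    "j < dim_col (monom_mat n (f \<circ> g) (\<lambda>j. c (nat (g (int j) mod int n)) * d j))"
  then have ij: "i < n" "j < n" by (simp_all add: monom_mat_def)
  define q l0 where "q = g (int j) div int n" and "l0 = nat (g (int j) mod int n)"
  have n: "0 < int n" using ij by auto
  have l0: "int l0 = g (int j) mod int n" using n by (simp add: l0_def)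
  have l0n: "l0 < n" using n by (simp add: l0_def nat_less_iff)
  have "g (int j) = int l0 + int n * q" by (simp add: l0 q_def)
  then have fg: "f (g (int j)) = f (int l0) + int n * q" by (simp add: affine_shift(1)[OF f])
  have div: "f (g (int j)) div int n = f (int l0) div int n + q" using fg n by simp
  have "(monom_mat n f c * monom_mat n g d) $$ (i, j)
      = (\<Sum>l<n. monom_mat n f c $$ (i, l) * monom_mat n g d $$ (l, j))"
    by (rule mat_mult_index[OF monom_mat_carrier monom_mat_carrier ij])
  also have "\<dots> = monom_mat n f c $$ (i, l0) * monom_mat n g d $$ (l0, j)
      + (\<Sum>l\<in>{..<n} - {l0}. monom_mat n f c $$ (i, l) * monom_mat n g d $$ (l, j))"
    using l0n by (intro sum.remove) auto
  also have "(\<Sum>l\<in>{..<n} - {l0}. monom_mat n f c $$ (i, l) * monom_mat n g d $$ (l, j)) = 0"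
    using ij l0 by (intro sum.neutral) (auto simp: monom_mat_index)
  also have "monom_mat n f c $$ (i, l0) * monom_mat n g d $$ (l0, j) =
      (if f (g (int j)) mod int n = int i then
         (fls_const (c l0) * fls_X_intpow (- (f (int l0) div int n))) * (fls_const (d j) * fls_X_intpow (- q))
       else 0)"
    unfolding monom_mat_index[OF ij(1) l0n] monom_mat_index[OF l0n ij(2)] fg by (simp add: l0 q_def)
  also have "\<dots> + 0 = monom_mat n (f \<circ> g) (\<lambda>j. c (nat (g (int j) mod int n)) * d j) $$ (i, j)"
    unfolding monom_mat_index[OF ij] const_X_intpow_mult by (simp add: div l0_def)
  finally show "(monom_mat n f c * monom_mat n g d) $$ (i, j) =
    monom_mat n (f \<circ> g) (\<lambda>j. c (nat (g (int j) mod int n)) * d j) $$ (i, j)" .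
qed (simp_all add: monom_mat_def)

text \<open>
  All nonzero terms of the Leibniz formula carry the same power of \<open>t\<close>.
\<close>

lemma det_monom_mat:
  "\<exists>C. det (monom_mat n f c) = fls_const C * fls_X_intpow (- (\<Sum>j<n. f (int j) div int n))"
proof -
  let ?A = "monom_mat n f c" and ?S = "\<Sum>j<n. f (int j) div int n"
  define e where "e p = (if \<forall>j<n. f (int j) mod int n = int (p j) then \<Prod>j<n. c j else 0)" for p :: "nat \<Rightarrow> nat"
  have prod: "(\<Prod>j<n. ?A $$ (p j, j)) = fls_const (e p) * fls_X_intpow (- ?S)" if p: "p permutes {0..<n}" for p
  proof (cases "\<forall>j<n. f (int j) mod int n = int (p j)")
    case True
    have pj: "p j < n" if "j < n" for j using permutes_in_image[OF p, of j] that by simp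
    have "(\<Prod>j<m. ?A $$ (p j, j)) =
        fls_const (\<Prod>j<m. c j) * fls_X_intpow (- (\<Sum>j<m. f (int j) div int n))" if "m \<le> n" for m
      using that
    proof (induction m)
      case (Suc m)
      have "?A $$ (p m, m) = fls_const (c m) * fls_X_intpow (- (f (int m) div int n))"
        using Suc.prems pj[of m] True by (simp add: monom_mat_index)
      then show ?case
        using Suc const_X_intpow_mult[of "\<Prod>j<m. c j" "- (\<Sum>j<m. f (int j) div int n)" "c m" "- (f (int m) div int n)"]
        by simp
    qed simp
    then show ?thesis using True by (simp add: e_def)
  next
    case False
    then obtain j where j: "j < n" "f (int j) mod int n \<noteq> int (p j)" by blast
    moreover have "p j < n" using permutes_in_image[OF p, of j] j by simp
    ultimately have "?A $$ (p j, j) = 0" by (simp add: monom_mat_index)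
    then have "(\<Prod>j<n. ?A $$ (p j, j)) = 0" using j by (intro prod_zero) auto
    moreover have "e p = 0" unfolding e_def using False by (simp only: if_False)
    ultimately show ?thesis by simp
  qed
  have "det ?A = (\<Sum>p | p permutes {0..<n}. of_int (sign p) * (\<Prod>j<n. ?A $$ (p j, j)))"
    by (rule det_col[OF monom_mat_carrier])
  also have "\<dots> = (\<Sum>p | p permutes {0..<n}. fls_const (of_int (sign p) * e p)) * fls_X_intpow (- ?S)"
    unfolding sum_distrib_right by (intro sum.cong refl) (simp add: prod fls_of_int mult.assoc[symmetric])
  also have "(\<Sum>p | p permutes {0..<n}. fls_const (of_int (sign p) * e p)) =
      fls_const (\<Sum>p | p permutes {0..<n}. of_int (sign p) * e p)"
    by (rule fls_eqI) (auto simp: fls_nth_sum)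
  finally show ?thesis by blast
qed

lemma monom_mat_SL_nonzero:
  assumes "monom_mat n f c \<in> carrier (SLF n)" "j < n"
  shows "c j \<noteq> 0"
proof
  assume "c j = 0"
  have zero: "(\<Prod>k<n. monom_mat n f c $$ (p k, k)) = 0" if p: "p permutes {0..<n}" for p
  proof (rule prod_zero)
    have "p j < n" using permutes_in_image[OF p, of j] \<open>j < n\<close> by simp
    then have "monom_mat n f c $$ (p j, j) = 0" using \<open>c j = 0\<close> \<open>j < n\<close> by (simp add: monom_mat_index)
    then show "\<exists>k\<in>{..<n}. monom_mat n f c $$ (p k, k) = 0" using \<open>j < n\<close> by blast
  qed simp
  then have "det (monom_mat n f c) = 0"
    unfolding det_col[OF monom_mat_carrier]
    by (intro sum.neutral ballI) (simp only: mem_Collect_eq zero mult_zero_right)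
  then show False using assms by (simp add: carrier_SL)
qed

text \<open>
  For an affine permutation \<open>f\<close> this is an element of the affine Weyl group, that is, a coset of
  the torus.
\<close>

definition weyl_coset :: "nat \<Rightarrow> (int \<Rightarrow> int) \<Rightarrow> complex fls mat set" where
  "weyl_coset n f = {m \<in> carrier (SLF n). \<exists>c. m = monom_mat n f c}"

lemma weyl_coset_SL: "m \<in> weyl_coset n f \<Longrightarrow> m \<in> carrier (SLF n)"
  by (simp add: weyl_coset_def)

lemma weyl_coset_mult:
  assumes "f \<in> affine_perms n" "a \<in> weyl_coset n f" "b \<in> weyl_coset n g"
  shows "a * b \<in> weyl_coset n (f \<circ> g)"
  using assms monom_mat_mult[OF assms(1)] by (auto simp: weyl_coset_def intro: mult_in_SL)

text \<open>
  A quotient of monomial matrices can be written down entry by entry; this gives inverses and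
  factorizations at the same time.
\<close>

lemma weyl_coset_left_divide:
  assumes f: "f \<in> affine_perms n" and a: "a \<in> weyl_coset n f" and h: "h \<in> weyl_coset n (f \<circ> g)"
  shows "\<exists>b \<in> weyl_coset n g. h = a * b"
proof -
  obtain c e where c: "a = monom_mat n f c" "a \<in> carrier (SLF n)"
    and e: "h = monom_mat n (f \<circ> g) e" "h \<in> carrier (SLF n)"
    using a h by (auto simp: weyl_coset_def)
  let ?b = "monom_mat n g (\<lambda>j. e j / c (nat (g (int j) mod int n)))"
  have nz: "c (nat (g (int j) mod int n)) \<noteq> 0" if "j < n" for j
    using monom_mat_SL_nonzero[of n f c] c that by (auto simp: nat_less_iff)
  have h_eq: "h = a * ?b"
    unfolding c(1) e(1) monom_mat_mult[OF f]
    by (rule eq_matI) (auto simp: monom_mat_def nz)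
  have "det a * det ?b = 1"
    using det_mult[of a n ?b] h_eq c(2) e(2) by (simp add: carrier_SL)
  then have "?b \<in> carrier (SLF n)"
    using c(2) by (simp add: carrier_SL)
  then show ?thesis using h_eq by (auto simp: weyl_coset_def)
qed

lemma loop_torus_eq: "loop_torus n = weyl_coset n id"
proof (intro equalityI subsetI)
  fix m assume "m \<in> loop_torus n"
  then obtain g where g: "g \<in> carrier (SLK n)" "diagonal_mat g" and m: "m = const_loop g"
    by (auto simp: loop_torus_def torus_def)
  have "m = monom_mat n id (\<lambda>j. g $$ (j, j))"
    by (rule eq_matI) (use g in \<open>auto simp: m const_loop_def monom_mat_def diagonal_mat_def carrier_SL\<close>)
  moreover have "m \<in> carrier (SLF n)" using g m by simp
  ultimately show "m \<in> weyl_coset n id" unfolding weyl_coset_def by blast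
next
  fix m assume "m \<in> weyl_coset n id"
  then obtain c where c: "m = monom_mat n id c" "m \<in> carrier (SLF n)" by (auto simp: weyl_coset_def)
  let ?g = "mat n n (\<lambda>(i, j). if i = j then c i else 0)"
  have "m = const_loop ?g"
    by (rule eq_matI) (auto simp: c(1) const_loop_def monom_mat_def)
  moreover from this have "?g \<in> torus n"
    using c(2) by (auto simp: torus_def diagonal_mat_def)
  ultimately show "m \<in> loop_torus n" by (auto simp: loop_torus_def)
qed

lemma weyl_coset_l_coset:
  assumes f: "f \<in> affine_perms n" and a: "a \<in> weyl_coset n f"
  shows "a <#\<^bsub>SLF n\<^esub> weyl_coset n g = weyl_coset n (f \<circ> g)"
proof (intro equalityI subsetI)
  fix h assume "h \<in> weyl_coset n (f \<circ> g)"
  then show "h \<in> a <#\<^bsub>SLF n\<^esub> weyl_coset n g"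
    using weyl_coset_left_divide[OF f a] by (fastforce simp: l_coset_def)
qed (auto simp: l_coset_def intro: weyl_coset_mult[OF f a])

lemma weyl_coset_set_mult:
  assumes f: "f \<in> affine_perms n" and "weyl_coset n f \<noteq> {}"
  shows "weyl_coset n f <#>\<^bsub>SLF n\<^esub> weyl_coset n g = weyl_coset n (f \<circ> g)"
proof -
  obtain a where a: "a \<in> weyl_coset n f" using assms(2) by blast
  have "weyl_coset n (f \<circ> g) \<subseteq> weyl_coset n f <#>\<^bsub>SLF n\<^esub> weyl_coset n g"
    unfolding weyl_coset_l_coset[OF f a, symmetric] using a by (auto simp: l_coset_def set_mult_def)
  moreover have "weyl_coset n f <#>\<^bsub>SLF n\<^esub> weyl_coset n g \<subseteq> weyl_coset n (f \<circ> g)"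
    by (auto simp: set_mult_def intro: weyl_coset_mult[OF f])
  ultimately show ?thesis by blast
qed

lemma weyl_coset_id_nonempty: "1\<^sub>m n \<in> weyl_coset n id"
proof -
  have "1\<^sub>m n = monom_mat n id (\<lambda>_. 1)"
    by (rule eq_matI) (auto simp: monom_mat_def)
  moreover have "1\<^sub>m n \<in> carrier (SLF n)" by (simp add: carrier_SL)
  ultimately show ?thesis unfolding weyl_coset_def by blast
qed

lemma weyl_coset_inv:
  assumes f: "f \<in> affine_perms n" and a: "a \<in> weyl_coset n f" and "f \<circ> g = id"
  shows "inv\<^bsub>SLF n\<^esub> a \<in> weyl_coset n g"
proof -
  have "1\<^sub>m n \<in> weyl_coset n (f \<circ> g)" using assms(3) weyl_coset_id_nonempty by simp
  from weyl_coset_left_divide[OF f a this] obtain b where b: "b \<in> weyl_coset n g" "1\<^sub>m n = a * b" by blast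
  then have "inv\<^bsub>SLF n\<^esub> a = b"
    using a by (intro inv_SL_eq) (auto dest: weyl_coset_SL)
  then show ?thesis using b by simp
qed

lemma weyl_coset_r_coset:
  assumes f: "f \<in> affine_perms n" and a: "a \<in> weyl_coset n f" and g: "g \<in> affine_perms n"
  shows "weyl_coset n g #>\<^bsub>SLF n\<^esub> a = weyl_coset n (g \<circ> f)"
proof (intro equalityI subsetI)
  fix h assume h: "h \<in> weyl_coset n (g \<circ> f)"
  obtain f' where f': "f' \<in> affine_perms n" "f \<circ> f' = id" by (rule affine_inverse[OF f])
  have "h * inv\<^bsub>SLF n\<^esub> a \<in> weyl_coset n ((g \<circ> f) \<circ> f')"
    by (intro weyl_coset_mult affine_compose f g h weyl_coset_inv[OF f a f'(2)])
  then have "h * inv\<^bsub>SLF n\<^esub> a \<in> weyl_coset n g" by (simp add: comp_assoc f'(2))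
  moreover have "h = (h * inv\<^bsub>SLF n\<^esub> a) * a"
    using SL_cancel(4)[OF weyl_coset_SL[OF a] weyl_coset_SL[OF h]] by simp
  ultimately show "h \<in> weyl_coset n g #>\<^bsub>SLF n\<^esub> a" by (auto simp: r_coset_def)
qed (auto simp: r_coset_def intro: weyl_coset_mult[OF g _ a])

lemma weyl_coset_loop_normalizer:
  assumes f: "f \<in> affine_perms n" and a: "a \<in> weyl_coset n f"
  shows "a \<in> loop_normalizer n"
proof -
  obtain f' where f': "f' \<in> affine_perms n" "f \<circ> f' = id" by (rule affine_inverse[OF f])
  have sub: "weyl_coset n id \<subseteq> carrier (SLF n)" by (auto dest: weyl_coset_SL)
  have "a <#\<^bsub>SLF n\<^esub> weyl_coset n id #>\<^bsub>SLF n\<^esub> inv\<^bsub>SLF n\<^esub> a = weyl_coset n id"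
    unfolding weyl_coset_l_coset[OF f a]
    using weyl_coset_r_coset[OF f'(1) weyl_coset_inv[OF f a f'(2)] f] by (simp add: f'(2))
  then have "a \<in> normalizer (SLF n) (loop_torus n)"
    using weyl_coset_SL[OF a] sub by (simp add: normalizer_def stabilizer_def loop_torus_eq)
  moreover have "finite {k. fls_nth (a $$ (i, j)) k \<noteq> 0}" if "i < n" "j < n" for i j
  proof -
    obtain c where c: "a = monom_mat n f c" using a by (auto simp: weyl_coset_def)
    have "{k. fls_nth (a $$ (i, j)) k \<noteq> 0} \<subseteq> {- (f (int j) div int n)}"
      unfolding c monom_mat_index[OF that] using const_X_intpow_nth[of "c j" "- (f (int j) div int n)"]
      by auto
    then show ?thesis by (rule finite_subset) simp
  qed
  ultimately show ?thesis by (simp add: loop_normalizer_def)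
qed

lemma addrow_SL:
  "k < n \<Longrightarrow> l < n \<Longrightarrow> k \<noteq> l \<Longrightarrow> addrow_mat n u k l \<in> carrier (SL n :: 'a::field mat monoid)"
  by (simp add: carrier_SL det_addrow_mat)

text \<open>
  The product of the elementary matrices with entries \<open>u\<close>, \<open>-v\<close>, \<open>u\<close> at \<open>(k, l)\<close>, \<open>(l, k)\<close>,
  \<open>(k, l)\<close>, as in the usual factorization of a rotation in \<open>SL\<^sub>2\<close>.
\<close>

lemma rotation_SL:
  fixes u v :: "'a::field"
  assumes kl: "k < n" "l < n" "k \<noteq> l" and "u * v = 1"
  shows "mat n n (\<lambda>(a, b). if a = k \<and> b = l then u else if a = l \<and> b = k then - v
      else if a = b \<and> a \<noteq> k \<and> a \<noteq> l then 1 else 0) \<in> carrier (SL n)"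
    (is "?R \<in> _")
proof -
  let ?E = "addrow_mat n u k l" and ?F = "addrow_mat n (- v) l k"
  have "?R = addrow u k l (addrow (- v) l k ?E)"
    by (rule eq_matI) (use kl \<open>u * v = 1\<close> in \<open>auto simp: mat_addrow_def addrow_mat_def algebra_simps\<close>)
  also have "\<dots> = ?E * (?F * ?E)"
  proof -
    have F: "addrow (- v) l k ?E = ?F * ?E"
      using kl by (intro addrow_mat[where nc = n]) auto
    show ?thesis unfolding F using kl by (intro addrow_mat[where nc = n]) auto
  qed
  also have "\<dots> \<in> carrier (SL n)"
    using kl by (intro mult_in_SL addrow_SL) auto
  finally show ?thesis .
qed

lemma simple_rep_weyl_coset:
  assumes n: "2 \<le> n" and i: "i < n"
  shows "simple_rep n i \<in> weyl_coset n (adjacent_swap n i)"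
proof (cases "i = 0")
  case True
  have "(fls_X_intpow (- 1) :: complex fls) * fls_X = fls_shift (- (- 1)) fls_X"
    by (rule fls_X_intpow_times_conv_shift(1))
  also have "\<dots> = 1" by (simp add: fls_X_conv_shift_1)
  finally have SL: "simple_rep n i \<in> carrier (SLF n)"
    using rotation_SL[of 0 n "n - 1" "fls_X_intpow (- 1) :: complex fls" fls_X] n True
    by (simp add: simple_rep_def)
  have m1: "(- 1) mod int n = int n - 1" "(- 1) div int n = - 1" "int n div int n = 1"
    using n by (auto simp: zmod_minus1 div_eq_minus1)
  have "simple_rep n i = monom_mat n (adjacent_swap n i) (\<lambda>j. if j = 0 then - 1 else 1)"
  proof (rule eq_matI)
    fix a b assume "a < dim_row (monom_mat n (adjacent_swap n i) (\<lambda>j. if j = 0 then - 1 else 1))"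
      "b < dim_col (monom_mat n (adjacent_swap n i) (\<lambda>j. if j = 0 then - 1 else 1))"
    then have ab: "a < n" "b < n" by (simp_all add: monom_mat_def)
    \<comment> \<open>The column \<open>n - 1\<close> goes to \<open>n\<close>, that is to \<open>t\<^sup>-\<^sup>1 e\<^sub>0\<close>, and the column \<open>0\<close> to \<open>-1\<close>, that is to \<open>t e\<^sub>n\<^sub>-\<^sub>1\<close>.\<close>
    have sw: "adjacent_swap n i (int b) = (if b = n - 1 then int n else if b = 0 then - 1 else int b)"
      using ab n by (auto simp: class_swap_def True m1 of_nat_diff)
    show "simple_rep n i $$ (a, b) =
        monom_mat n (adjacent_swap n i) (\<lambda>j. if j = 0 then - 1 else 1) $$ (a, b)"
      unfolding monom_mat_index[OF ab] sw
      using ab n True m1 by (auto simp: simple_rep_def fls_X_conv_shift_1 of_nat_diff)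
  qed (simp_all add: monom_mat_def simple_rep_def)
  then show ?thesis using SL by (auto simp: weyl_coset_def)
next
  case False
  have SL: "simple_rep n i \<in> carrier (SLF n)"
    using rotation_SL[of "i - 1" n i "1 :: complex fls" 1] False i
    by (simp add: simple_rep_def)
  have "simple_rep n i = monom_mat n (adjacent_swap n i) (\<lambda>j. if j = i - 1 then - 1 else 1)"
  proof (rule eq_matI)
    fix a b assume "a < dim_row (monom_mat n (adjacent_swap n i) (\<lambda>j. if j = i - 1 then - 1 else 1))"
      "b < dim_col (monom_mat n (adjacent_swap n i) (\<lambda>j. if j = i - 1 then - 1 else 1))"
    then have ab: "a < n" "b < n" by (simp_all add: monom_mat_def)
    define b' where "b' = (if b = i - 1 then i else if b = i then i - 1 else b)"
    have sw: "adjacent_swap n i (int b) = int b'"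
      using ab i False by (auto simp: class_swap_def b'_def)
    have "b' < n" using ab i by (auto simp: b'_def)
    then have md: "int b' mod int n = int b'" "int b' div int n = 0" by simp_all
    obtain m where m: "i = Suc m" using False not0_implies_Suc by blast
    have "simple_rep n i $$ (a, b) = (if a = i - 1 \<and> b = i then 1
        else if a = i \<and> b = i - 1 then - 1 else if a = b \<and> a \<noteq> i - 1 \<and> a \<noteq> i then 1 else 0)"
      using ab False by (simp only: simple_rep_def if_False index_mat prod.case)
    also have "\<dots> = (if b' = a then fls_const (if b = i - 1 then - 1 else 1) else 0)"
      unfolding b'_def m by auto
    finally show "simple_rep n i $$ (a, b) =
        monom_mat n (adjacent_swap n i) (\<lambda>j. if j = i - 1 then - 1 else 1) $$ (a, b)"
      unfolding monom_mat_index[OF ab] sw md by simp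
  qed (simp_all add: monom_mat_def simple_rep_def)
  then show ?thesis using SL by (auto simp: weyl_coset_def)
qed

lemma simple_refl_eq:
  assumes n: "2 \<le> n" and i: "i < n"
  shows "simple_refl n i = weyl_coset n (adjacent_swap n i)"
  unfolding simple_refl_def loop_torus_eq
  using weyl_coset_r_coset[OF adjacent_swap_affine[OF n] simple_rep_weyl_coset[OF n i] affine_id]
  by simp

lemma affine_weyl_mult [simp]: "v \<otimes>\<^bsub>affine_weyl n\<^esub> w = v <#>\<^bsub>SLF n\<^esub> w"
  by (simp add: affine_weyl_def FactGroup_def set_mult_def)

lemma affine_weyl_one: "\<one>\<^bsub>affine_weyl n\<^esub> = weyl_coset n id"
  by (simp add: affine_weyl_def FactGroup_def loop_torus_eq)

lemma word_prod_weyl_coset: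
  assumes n: "2 \<le> n" and "set xs \<subseteq> {0..<n}"
  shows "word_prod (affine_weyl n) (map (simple_refl n) xs) = weyl_coset n (word_perm n xs)"
    and "weyl_coset n (word_perm n xs) \<noteq> {}"
  using assms(2)
proof (induction xs)
  case Nil
  {
    case 1 then show ?case by (simp add: word_prod_def affine_weyl_one id_def)
  next
    case 2 then show ?case using weyl_coset_id_nonempty[of n] by (auto simp: id_def)
  }
next
  case (Cons i xs)
  {
    case 1
    then have "weyl_coset n (adjacent_swap n i) \<noteq> {}" using simple_rep_weyl_coset[OF n, of i] by auto
    then show ?case using 1 Cons.IH weyl_coset_set_mult[OF adjacent_swap_affine[OF n], of i]
      by (simp add: word_prod_def simple_refl_eq[OF n] comp_def)
  next
    case 2
    then obtain b where "b \<in> weyl_coset n (word_perm n xs)" using Cons.IH by auto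
    then have "simple_rep n i * b \<in> weyl_coset n (adjacent_swap n i \<circ> word_perm n xs)"
      using 2 by (intro weyl_coset_mult adjacent_swap_affine n simple_rep_weyl_coset) auto
    then show ?case by (auto simp: comp_def)
  }
qed

lemma weyl_coset_nonempty:
  assumes "2 \<le> n" "f \<in> affine_perms n"
  shows "weyl_coset n f \<noteq> {}"
  using affine_perm_word[OF assms] word_prod_weyl_coset(2)[OF assms(1)] by blast

lemma weyl_coset_mult_weyl:
  assumes "2 \<le> n" "f \<in> affine_perms n"
  shows "weyl_coset n f \<otimes>\<^bsub>affine_weyl n\<^esub> weyl_coset n g = weyl_coset n (f \<circ> g)"
  using weyl_coset_set_mult weyl_coset_nonempty assms by simp

lemma carrier_affine_weyl:
  "carrier (affine_weyl n) = (\<lambda>a. loop_torus n #>\<^bsub>SLF n\<^esub> a) ` loop_normalizer n"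
  by (auto simp: affine_weyl_def FactGroup_def RCOSETS_def r_coset_def)

lemma weyl_coset_in_carrier:
  assumes n: "2 \<le> n" and f: "f \<in> affine_perms n"
  shows "weyl_coset n f \<in> carrier (affine_weyl n)"
proof -
  obtain a where a: "a \<in> weyl_coset n f" using weyl_coset_nonempty[OF assms] by blast
  have "weyl_coset n f = loop_torus n #>\<^bsub>SLF n\<^esub> a"
    using weyl_coset_r_coset[OF f a affine_id] by (simp add: loop_torus_eq)
  then show ?thesis
    using weyl_coset_loop_normalizer[OF f a] by (simp add: carrier_affine_weyl)
qed

lemma weyl_coset_inject:
  assumes n: "2 \<le> n" and f: "f \<in> affine_perms n" and g: "g \<in> affine_perms n"
    and eq: "weyl_coset n f = weyl_coset n g"
  shows "f = g"
proof (rule affine_eqI[OF _ f g, of "- 1"])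
  obtain a where a: "a \<in> weyl_coset n f" using weyl_coset_nonempty[OF n f] by blast
  then have "a \<in> weyl_coset n g" using eq by simp
  with a obtain c d where c: "a = monom_mat n f c" and d: "a = monom_mat n g d"
    and SL: "a \<in> carrier (SLF n)"
    by (auto simp: weyl_coset_def)
  fix j assume "0 < j" "j < n"
  define l where "l = j - 1"
  have l: "l < n" "int l = - 1 + int j" using \<open>0 < j\<close> \<open>j < n\<close> by (auto simp: l_def)
  define i where "i = nat (f (int l) mod int n)"
  have i: "i < n" "int i = f (int l) mod int n" using n by (auto simp: i_def nat_less_iff)
  have cl: "c l \<noteq> 0" using monom_mat_SL_nonzero[of n f c l] SL c l by simp
  have "fls_nth (a $$ (i, l)) (- (f (int l) div int n)) = c l"
    unfolding c monom_mat_index[OF i(1) l(1)] using i(2) by (simp add: const_X_intpow_nth)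
  then have nz: "fls_nth (monom_mat n g d $$ (i, l)) (- (f (int l) div int n)) \<noteq> 0" using cl d by simp
  have "g (int l) mod int n = int i \<and> f (int l) div int n = g (int l) div int n"
  proof (rule ccontr)
    assume "\<not> ?thesis"
    then have "fls_nth (monom_mat n g d $$ (i, l)) (- (f (int l) div int n)) = 0"
      unfolding monom_mat_index[OF i(1) l(1)]
      using const_X_intpow_nth[of "d l" "- (g (int l) div int n)" "- (f (int l) div int n)"] by auto
    then show False using nz by simp
  qed
  then have "f (int l) = g (int l)"
    using i(2) mult_div_mod_eq[of "int n" "f (int l)"] mult_div_mod_eq[of "int n" "g (int l)"] by simp
  then show "f (- 1 + int j) = g (- 1 + int j)" by (simp add: l(2))
qed (use n in auto)

text \<open>
  Words in the generators of the affine Weyl group correspond to words in adjacent swaps.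
\<close>

lemma weyl_length_eq:
  assumes n: "2 \<le> n" and f: "f \<in> affine_perms n"
  shows "weyl_length n (weyl_coset n f) = perm_length n f"
proof -
  have "(\<exists>xs. set xs \<subseteq> simple_refls n \<and> length xs = k \<and> word_prod (affine_weyl n) xs = weyl_coset n f)
    \<longleftrightarrow> (\<exists>xs. set xs \<subseteq> {0..<n} \<and> length xs = k \<and> word_perm n xs = f)" for k
  proof
    assume "\<exists>xs. set xs \<subseteq> simple_refls n \<and> length xs = k \<and> word_prod (affine_weyl n) xs = weyl_coset n f"
    then obtain xs where xs: "set xs \<subseteq> simple_refls n" "length xs = k"
      "word_prod (affine_weyl n) xs = weyl_coset n f" by blast
    have "xs \<in> lists (simple_refl n ` {0..<n})" using xs(1) by (auto simp: simple_refls_def)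
    then obtain ys where ys: "set ys \<subseteq> {0..<n}" "xs = map (simple_refl n) ys"
      unfolding lists_image by auto
    have "weyl_coset n (word_perm n ys) = weyl_coset n f"
      using xs(3) word_prod_weyl_coset(1)[OF n ys(1)] ys(2) by simp
    then have "word_perm n ys = f" by (rule weyl_coset_inject[OF n word_perm_affine[OF n] f])
    then show "\<exists>xs. set xs \<subseteq> {0..<n} \<and> length xs = k \<and> word_perm n xs = f"
      using ys xs(2) by auto
  next
    assume "\<exists>xs. set xs \<subseteq> {0..<n} \<and> length xs = k \<and> word_perm n xs = f"
    then obtain xs where xs: "set xs \<subseteq> {0..<n}" "length xs = k" "word_perm n xs = f" by blast
    then show "\<exists>xs. set xs \<subseteq> simple_refls n \<and> length xs = k \<and> word_prod (affine_weyl n) xs = weyl_coset n f"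
      using word_prod_weyl_coset(1)[OF n xs(1)]
      by (intro exI[of _ "map (simple_refl n) xs"]) (auto simp: simple_refls_def)
  qed
  then show ?thesis by (simp add: word_length_def perm_length_def)
qed

text \<open>
  Inverses are unique by associativity of products of sets, since every element of the affine Weyl
  group absorbs the torus from the left.
\<close>

lemma weyl_inv_eq:
  assumes n: "2 \<le> n" and f: "f \<in> affine_perms n" and g: "g \<in> affine_perms n"
    and fg: "f \<circ> g = id" "g \<circ> f = id"
  shows "inv\<^bsub>affine_weyl n\<^esub> (weyl_coset n f) = weyl_coset n g"
  unfolding m_inv_def
proof (rule the_equality)
  show "weyl_coset n g \<in> carrier (affine_weyl n) \<and>
    weyl_coset n f \<otimes>\<^bsub>affine_weyl n\<^esub> weyl_coset n g = \<one>\<^bsub>affine_weyl n\<^esub> \<and>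
    weyl_coset n g \<otimes>\<^bsub>affine_weyl n\<^esub> weyl_coset n f = \<one>\<^bsub>affine_weyl n\<^esub>"
    using weyl_coset_in_carrier[OF n g] weyl_coset_mult_weyl[OF n f, of g] weyl_coset_mult_weyl[OF n g, of f] fg
    by (simp add: affine_weyl_one)
next
  fix y assume y: "y \<in> carrier (affine_weyl n) \<and>
    weyl_coset n f \<otimes>\<^bsub>affine_weyl n\<^esub> y = \<one>\<^bsub>affine_weyl n\<^esub> \<and>
    y \<otimes>\<^bsub>affine_weyl n\<^esub> weyl_coset n f = \<one>\<^bsub>affine_weyl n\<^esub>"
  then obtain a where a: "a \<in> loop_normalizer n" "y = weyl_coset n id #>\<^bsub>SLF n\<^esub> a"
    by (auto simp: carrier_affine_weyl loop_torus_eq)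
  have aS: "a \<in> carrier (SLF n)" using a(1) by (auto simp: loop_normalizer_def normalizer_def stabilizer_def)
  have sub: "weyl_coset n h \<subseteq> carrier (SLF n)" for h by (auto dest: weyl_coset_SL)
  have ysub: "y \<subseteq> carrier (SLF n)"
    unfolding a(2) r_coset_def using aS sub[of id] by (auto intro!: mult_in_SL)
  note assoc = group.set_mult_assoc[OF group_SL]
  have "weyl_coset n id <#>\<^bsub>SLF n\<^esub> y = (weyl_coset n id <#>\<^bsub>SLF n\<^esub> weyl_coset n id) #>\<^bsub>SLF n\<^esub> a"
    unfolding a(2) using group.setmult_rcos_assoc[OF group_SL sub sub aS] by simp
  also have "\<dots> = y"
    using weyl_coset_set_mult[OF affine_id, of n id] weyl_coset_nonempty[OF n affine_id] a(2) by simp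
  finally have "y = weyl_coset n id <#>\<^bsub>SLF n\<^esub> y" by simp
  also have "\<dots> = (weyl_coset n g <#>\<^bsub>SLF n\<^esub> weyl_coset n f) <#>\<^bsub>SLF n\<^esub> y"
    using weyl_coset_mult_weyl[OF n g, of f] fg by simp
  also have "\<dots> = weyl_coset n g <#>\<^bsub>SLF n\<^esub> (weyl_coset n f <#>\<^bsub>SLF n\<^esub> y)"
    using sub ysub by (intro assoc) auto
  also have "\<dots> = weyl_coset n g <#>\<^bsub>SLF n\<^esub> weyl_coset n id"
    using y by (simp add: affine_weyl_one)
  also have "\<dots> = weyl_coset n g"
    using weyl_coset_mult_weyl[OF n g, of id] by simp
  finally show "y = weyl_coset n g" .
qed

text \<open>
  The reflection is \<open>u\<^sup>-\<^sup>1 s\<^sub>i u\<close>, with \<open>u\<close> and \<open>i\<close> from the exchange property.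
\<close>

lemma perm_step_bruhat_step:
  assumes n: "2 \<le> n" and f: "f \<in> affine_perms n" and g: "g \<in> affine_perms n" and step: "perm_step n f g"
  shows "bruhat_step (affine_weyl n) (simple_refls n) (weyl_coset n f) (weyl_coset n g)"
proof -
  obtain a b i u where g_eq: "g = f \<circ> class_swap n a b" and ab: "a mod int n \<noteq> b mod int n"
    and i: "i < n" and u: "u \<in> affine_perms n" and ui: "u \<circ> class_swap n a b = adjacent_swap n i \<circ> u"
    using perm_step_length(2)[OF n f step] by blast
  obtain v where v: "v \<in> affine_perms n" "u \<circ> v = id" "v \<circ> u = id" by (rule affine_inverse[OF u])
  have si: "adjacent_swap n i \<in> affine_perms n" by (rule adjacent_swap_affine[OF n])
  have "class_swap n a b = v \<circ> u \<circ> class_swap n a b" using v(3) by simp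
  also have "\<dots> = v \<circ> adjacent_swap n i \<circ> u" using ui by (simp add: comp_assoc)
  finally have r: "weyl_coset n (class_swap n a b) =
      weyl_coset n v \<otimes>\<^bsub>affine_weyl n\<^esub> simple_refl n i \<otimes>\<^bsub>affine_weyl n\<^esub> inv\<^bsub>affine_weyl n\<^esub> weyl_coset n v"
    unfolding simple_refl_eq[OF n i] weyl_inv_eq[OF n v(1) u v(3,2)]
      weyl_coset_mult_weyl[OF n v(1)] weyl_coset_mult_weyl[OF n affine_compose[OF v(1) si]]
    by simp
  have "weyl_coset n (class_swap n a b) \<in> reflections (affine_weyl n) (simple_refls n)"
    unfolding reflections_def mem_Collect_eq
  proof (intro exI conjI)
    show "simple_refl n i \<in> simple_refls n" using i by (simp add: simple_refls_def)
  qed (rule r weyl_coset_in_carrier[OF n v(1)])+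
  moreover have "weyl_coset n g = weyl_coset n f \<otimes>\<^bsub>affine_weyl n\<^esub> weyl_coset n (class_swap n a b)"
    unfolding weyl_coset_mult_weyl[OF n f] g_eq ..
  ultimately show ?thesis
    unfolding bruhat_step_def using weyl_coset_in_carrier[OF n f]
      weyl_length_eq[OF n f] weyl_length_eq[OF n g] perm_step_length(1)[OF n f step] by auto
qed

lemma perm_steps_weyl_le:
  assumes n: "2 \<le> n"
    and "(\<lambda>f g. f \<in> affine_perms n \<and> g \<in> affine_perms n \<and> perm_step n f g)\<^sup>*\<^sup>* f k"
  shows "weyl_le n (weyl_coset n f) (weyl_coset n k)"
  using assms(2) unfolding bruhat_le_def
proof (induction rule: rtranclp_induct)
  case (step g h)
  then have "bruhat_step (affine_weyl n) (simple_refls n) (weyl_coset n g) (weyl_coset n h)"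
    using perm_step_bruhat_step[OF n, of g h] by blast
  with step.IH show ?case by (rule rtranclp.rtrancl_into_rtrancl)
qed (rule rtranclp.rtrancl_refl)

section \<open>The affine permutation of \<open>\<kappa>\<^sub>0\<close>\<close>

text \<open>
  By induction on \<open>m\<close>: the product \<open>s\<^sub>m\<^sub>-\<^sub>1 \<dots> s\<^sub>1 s\<^sub>0\<close> carries \<open>-1\<close> upwards to \<open>m - 1\<close> and moves
  the points that it passes down by one.
\<close>

lemma word_perm_rotation:
  assumes n: "2 \<le> n" and m: "1 \<le> m" "m < n"
  shows "word_perm n (rev [0..<m]) (- 1) = int m - 1" "word_perm n (rev [0..<m]) 0 = - 1"
    "\<And>x. 1 \<le> x \<Longrightarrow> x < int m \<Longrightarrow> word_perm n (rev [0..<m]) x = x - 1"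
    "\<And>x. int m \<le> x \<Longrightarrow> x \<le> int n - 2 \<Longrightarrow> word_perm n (rev [0..<m]) x = x"
proof -
  have sw: "adjacent_swap n i x = (if x = int i - 1 then int i else if x = int i then int i - 1 else x)"
    if "0 \<le> x" "x < int n" "1 \<le> i" "i < n" for i x
    using that by (auto simp: class_swap_def)
  have m1: "(- 1) mod int n = int n - 1" using n by (simp add: zmod_minus1)
  have swm: "adjacent_swap n i (- 1) = - 1" if "1 \<le> i" "i < n - 1" for i
    using that by (auto simp: class_swap_def m1)
  have sw0: "adjacent_swap n 0 (- 1) = 0" "adjacent_swap n 0 0 = - 1"
    "\<And>x. 1 \<le> x \<Longrightarrow> x \<le> int n - 2 \<Longrightarrow> adjacent_swap n 0 x = x"
    using n by (auto simp: class_swap_def m1)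
  have "word_perm n (rev [0..<m]) (- 1) = int m - 1 \<and> word_perm n (rev [0..<m]) 0 = - 1 \<and>
    (\<forall>x. 1 \<le> x \<and> x < int m \<longrightarrow> word_perm n (rev [0..<m]) x = x - 1) \<and>
    (\<forall>x. int m \<le> x \<and> x \<le> int n - 2 \<longrightarrow> word_perm n (rev [0..<m]) x = x)"
    using m
  proof (induction m rule: nat_induct_at_least)
    case base
    have "rev [0..<1] = [0]" by simp
    then show ?case using sw0 by simp
  next
    case (Suc m)
    have rec: "word_perm n (rev [0..<Suc m]) x = adjacent_swap n m (word_perm n (rev [0..<m]) x)" for x
      by simp
    have IH: "word_perm n (rev [0..<m]) (- 1) = int m - 1" "word_perm n (rev [0..<m]) 0 = - 1"
      "\<And>x. 1 \<le> x \<Longrightarrow> x < int m \<Longrightarrow> word_perm n (rev [0..<m]) x = x - 1"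
      "\<And>x. int m \<le> x \<Longrightarrow> x \<le> int n - 2 \<Longrightarrow> word_perm n (rev [0..<m]) x = x"
      using Suc by auto
    have m: "1 \<le> m" "m < n" "m < n - 1" using Suc by auto
    show ?case
      unfolding rec
    proof (intro conjI allI impI)
      show "adjacent_swap n m (word_perm n (rev [0..<m]) (- 1)) = int (Suc m) - 1"
        unfolding IH(1) using m by (subst sw) auto
      show "adjacent_swap n m (word_perm n (rev [0..<m]) 0) = - 1"
        unfolding IH(2) using m by (intro swm) auto
      show "adjacent_swap n m (word_perm n (rev [0..<m]) x) = x - 1" if "1 \<le> x \<and> x < int (Suc m)" for x
      proof (cases "x = int m")
        case True
        then show ?thesis using m IH(4)[of x] by (simp add: sw)
      next
        case False
        then show ?thesis using m IH(3)[of x] that by (simp add: sw)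
      qed
      show "adjacent_swap n m (word_perm n (rev [0..<m]) x) = x" if "int (Suc m) \<le> x \<and> x \<le> int n - 2" for x
        using m IH(4)[of x] that by (simp add: sw)
    qed
  qed
  then show "word_perm n (rev [0..<m]) (- 1) = int m - 1" "word_perm n (rev [0..<m]) 0 = - 1"
    "\<And>x. 1 \<le> x \<Longrightarrow> x < int m \<Longrightarrow> word_perm n (rev [0..<m]) x = x - 1"
    "\<And>x. int m \<le> x \<Longrightarrow> x \<le> int n - 2 \<Longrightarrow> word_perm n (rev [0..<m]) x = x"
    by blast+
qed

text \<open>
  It fixes the class of \<open>n - 1\<close> up to a shift and rotates the other classes downwards by one
  place.
\<close>

definition tau_perm :: "nat \<Rightarrow> int \<Rightarrow> int" where
  "tau_perm n = word_perm n (rev [0..<n])"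

lemma tau_perm_affine: "2 \<le> n \<Longrightarrow> tau_perm n \<in> affine_perms n"
  unfolding tau_perm_def by (rule word_perm_affine)

lemma tau_perm_values:
  assumes n: "2 \<le> n"
  shows "tau_perm n 0 = - 2" "1 \<le> x \<Longrightarrow> x \<le> int n - 2 \<Longrightarrow> tau_perm n x = x - 1"
proof -
  let ?w = "word_perm n (rev [0..<n - 1])"
  have "[0..<n] = [0..<n - 1] @ [n - 1]" using n by (metis Suc_diff_1 gr0I not_numeral_le_zero upt_Suc_append zero_le)
  then have rec: "tau_perm n x = adjacent_swap n (n - 1) (?w x)" for x
    by (simp add: tau_perm_def)
  note w = word_perm_rotation[OF n, of "n - 1"]
  have "adjacent_swap n (n - 1) (- 1) = - 2"
  proof -
    have "(- 1) mod int n = int n - 1" using n by (simp add: zmod_minus1)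
    moreover have "(int n - 2) mod int n = int n - 2" "(int n - 1) mod int n = int n - 1"
      by (rule mod_pos_pos_trivial; use n in simp)+
    ultimately show ?thesis using n by (simp add: class_swap_def of_nat_diff)
  qed
  then show "tau_perm n 0 = - 2" unfolding rec using w(2) n by simp
  assume x: "1 \<le> x" "x \<le> int n - 2"
  have "?w x = x - 1" using x n by (intro w(3)) (auto simp: of_nat_diff)
  moreover have "adjacent_swap n (n - 1) (x - 1) = x - 1"
  proof -
    have "(x - 1) mod int n = x - 1" using x by (intro mod_pos_pos_trivial) auto
    moreover have "(int n - 2) mod int n = int n - 2" "(int n - 1) mod int n = int n - 1"
      by (rule mod_pos_pos_trivial; use n in simp)+
    ultimately show ?thesis using n x by (simp add: class_swap_def of_nat_diff)
  qed
  ultimately show "tau_perm n x = x - 1" unfolding rec by simp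
qed

lemma tau_perm_power_affine: "2 \<le> n \<Longrightarrow> (tau_perm n ^^ k) \<in> affine_perms n"
  by (induction k) (auto intro: affine_compose tau_perm_affine affine_id)

text \<open>
  The case distinction reflects that the rotation jumps over the class of \<open>n - 1\<close>.
\<close>

lemma tau_perm_power:
  assumes n: "2 \<le> n" and x: "0 \<le> x" "x \<le> int n - 2"
  shows "k \<le> n - 1 \<Longrightarrow> (tau_perm n ^^ k) x = (if int k \<le> x then x - int k else x - int k - 1)"
proof (induction k)
  case 0
  then show ?case using x by simp
next
  case (Suc k)
  have IH: "(tau_perm n ^^ k) x = (if int k \<le> x then x - int k else x - int k - 1)" using Suc by simp
  consider "int k + 1 \<le> x" | "x = int k" | "x < int k" by linarith
  then show ?case
  proof cases
    case 1
    then have "tau_perm n (x - int k) = x - int k - 1" using x by (intro tau_perm_values[OF n]) auto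
    then show ?thesis using 1 IH by simp
  next
    case 2
    then show ?thesis using IH tau_perm_values(1)[OF n] by simp
  next
    case 3
    have "tau_perm n (x - int k - 1 + int n) = x - int k - 1 + int n - 1"
      using 3 x Suc.prems by (intro tau_perm_values[OF n]) auto
    then have "tau_perm n (x - int k - 1) = x - int k - 1 - 1"
      using affine_shift(2)[OF tau_perm_affine[OF n], of "x - int k - 1"] by simp
    then show ?thesis using 3 IH by simp
  qed
qed

lemma tau_eq:
  assumes n: "2 \<le> n"
  shows "tau n = weyl_coset n (tau_perm n)"
  unfolding tau_def tau_perm_def using word_prod_weyl_coset(1)[OF n, of "rev [0..<n]"] by simp

lemma tau_power_eq:
  assumes n: "2 \<le> n"
  shows "tau n [^]\<^bsub>affine_weyl n\<^esub> k = weyl_coset n (tau_perm n ^^ k)"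
proof (induction k)
  case 0
  then show ?case by (simp add: affine_weyl_one id_def)
next
  case (Suc k)
  have "tau n [^]\<^bsub>affine_weyl n\<^esub> Suc k =
      (tau n [^]\<^bsub>affine_weyl n\<^esub> k) \<otimes>\<^bsub>affine_weyl n\<^esub> tau n"
    unfolding nat_pow_def by (simp del: affine_weyl_mult)
  also have "\<dots> = weyl_coset n ((tau_perm n ^^ k) \<circ> tau_perm n)"
    unfolding Suc unfolding tau_eq[OF n] by (rule weyl_coset_mult_weyl[OF n tau_perm_power_affine[OF n]])
  finally show ?case by (simp only: funpow_Suc_right)
qed

text \<open>
  An element of maximal energy has no ascent.
\<close>

lemma finite_perms_longest_exists:
  assumes n: "2 \<le> n"
  obtains w where "w \<in> finite_perms n" "\<And>x. 0 \<le> x \<Longrightarrow> x \<le> int n - 2 \<Longrightarrow> w x = int n - 2 - x"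
proof -
  define B where "B = nat (\<Sum>j<n. (int n)\<^sup>2)"
  have bound: "nat (energy n f) \<le> B" if "f \<in> finite_perms n" for f
    using finite_perms_energy[of n f] that n unfolding B_def by (intro nat_mono) auto
  have "\<exists>w. w \<in> finite_perms n \<and> (\<forall>f. f \<in> finite_perms n \<longrightarrow> nat (energy n f) \<le> nat (energy n w))"
    by (rule ex_has_greatest_nat[where k = id and b = "Suc B"]) (auto simp: finite_perms_id le_imp_less_Suc bound)
  then obtain w where w: "w \<in> finite_perms n"
    "\<And>f. f \<in> finite_perms n \<Longrightarrow> nat (energy n f) \<le> nat (energy n w)" by blast
  have wa: "w \<in> affine_perms n" using w(1) by (simp add: finite_perms_def)
  have "\<not> w (int i - 1) < w (int i)" if i: "1 \<le> i" "i \<le> n - 2" for i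
  proof
    assume lt: "w (int i - 1) < w (int i)"
    have "energy n (w \<circ> adjacent_swap n i) = energy n w + 2 * ((int i - (int i - 1)) * (w (int i) - w (int i - 1)))"
      by (rule energy_swap) (use wa n in \<open>auto simp: consecutive_mod\<close>)
    then have "energy n w < energy n (w \<circ> adjacent_swap n i)" using lt by simp
    moreover have "nat (energy n (w \<circ> adjacent_swap n i)) \<le> nat (energy n w)"
      by (intro w(2) finite_perms_compose w(1) finite_perms_adjacent n i)
    moreover have "0 \<le> energy n w" by (simp add: energy_def sum_nonneg)
    ultimately show False by simp
  qed
  then show ?thesis
    using that[OF w(1)] finite_perms_top[OF n w(1)] by blast
qed

lemma perm_steps_length:
  assumes n: "2 \<le> n" and R: "\<And>f g. R f g \<Longrightarrow> f \<in> affine_perms n \<and> perm_step n f g"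
    and "R\<^sup>*\<^sup>* f k"
  shows "f = k \<or> perm_length n f < perm_length n k"
  using assms(3)
proof (induction rule: rtranclp_induct)
  case (step g h)
  then have "perm_length n g < perm_length n h"
    using R[of g h] perm_step_length(1)[OF n] by blast
  then show ?case using step.IH by auto
qed simp

lemma parabolic_generate:
  assumes n: "2 \<le> n" and v: "v \<in> generate (affine_weyl n) (simple_refl n ` {1..n - 2})"
  shows "\<exists>f \<in> finite_perms n. v = weyl_coset n f"
  using v
proof (induction rule: generate.induct)
  case one
  show ?case using finite_perms_id by (auto simp: affine_weyl_one)
next
  case (incl h)
  then obtain i where "1 \<le> i" "i \<le> n - 2" "h = simple_refl n i" by auto
  then show ?case using finite_perms_adjacent[OF n] simple_refl_eq[OF n, of i] by auto
next
  case (inv h)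
  then obtain i where i: "1 \<le> i" "i \<le> n - 2" "h = simple_refl n i" by auto
  have "adjacent_swap n i \<circ> adjacent_swap n i = id"
    by (auto simp: class_swap_involution consecutive_mod n)
  then have "inv\<^bsub>affine_weyl n\<^esub> h = weyl_coset n (adjacent_swap n i)"
    using i simple_refl_eq[OF n, of i] weyl_inv_eq[OF n adjacent_swap_affine[OF n] adjacent_swap_affine[OF n]] by auto
  then show ?case using finite_perms_adjacent[OF n i(1,2)] by auto
next
  case (eng h1 h2)
  then obtain f g where "f \<in> finite_perms n" "h1 = weyl_coset n f" "g \<in> finite_perms n" "h2 = weyl_coset n g" by blast
  moreover from this have "f \<in> affine_perms n" by (simp add: finite_perms_def)
  ultimately have "f \<circ> g \<in> finite_perms n \<and> h1 \<otimes>\<^bsub>affine_weyl n\<^esub> h2 = weyl_coset n (f \<circ> g)"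
    using weyl_coset_mult_weyl[OF n] finite_perms_compose by blast
  then show ?case by blast
qed

text \<open>
  Ascending adjacent swaps lead from every element of the parabolic subgroup to the order
  reversal, with increasing length. Starting from the identity this shows that the order reversal
  belongs to the subgroup, and starting from any other element that it is strictly longest.
\<close>

lemma longest_parabolic_eq:
  assumes n: "2 \<le> n" and w: "w \<in> finite_perms n" "\<And>x. 0 \<le> x \<Longrightarrow> x \<le> int n - 2 \<Longrightarrow> w x = int n - 2 - x"
  shows "longest_parabolic n = weyl_coset n w"
proof -
  let ?H = "generate (affine_weyl n) (simple_refl n ` {1..n - 2})"
  let ?R = "\<lambda>f g. f \<in> finite_perms n \<and> g \<in> finite_perms n \<and> adjacent_step n f g"
  have aff: "f \<in> affine_perms n" if "f \<in> finite_perms n" for f using that by (simp add: finite_perms_def)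
  note climb = finite_perms_climb[OF n aff[OF w(1)] w(2)]
  have "?R\<^sup>*\<^sup>* id w" by (rule climb[OF _ _ finite_perms_id])
  then have wH: "weyl_coset n w \<in> ?H"
  proof (induction rule: rtranclp_induct)
    case base
    then show ?case using generate.one[of "affine_weyl n"] by (simp add: affine_weyl_one id_def)
  next
    case (step f g)
    obtain i where i: "1 \<le> i" "i \<le> n - 2" and g: "g = f \<circ> adjacent_swap n i"
      using step by (auto simp: adjacent_step_def)
    have "simple_refl n i \<in> ?H" using i by (intro generate.incl) auto
    then have "weyl_coset n f \<otimes>\<^bsub>affine_weyl n\<^esub> simple_refl n i \<in> ?H"
      using step.IH by (intro generate.eng)
    moreover have "weyl_coset n f \<otimes>\<^bsub>affine_weyl n\<^esub> simple_refl n i = weyl_coset n g"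
      unfolding g using i step.hyps aff simple_refl_eq[OF n, of i]
        weyl_coset_mult_weyl[OF n, of f "adjacent_swap n i"] by auto
    ultimately show ?case by simp
  qed
  have longest: "weyl_length n v < weyl_length n (weyl_coset n w)" if vH: "v \<in> ?H" and ne: "v \<noteq> weyl_coset n w" for v
  proof -
    obtain f where f: "f \<in> finite_perms n" "v = weyl_coset n f" using parabolic_generate[OF n vH] by blast
    have "?R\<^sup>*\<^sup>* f w" by (rule climb[OF _ _ f(1)])
    then have "f = w \<or> perm_length n f < perm_length n w"
      by (rule perm_steps_length[OF n, rotated]) (auto intro: aff adjacent_step_perm_step[OF n])
    then show ?thesis
      using ne f weyl_length_eq[OF n aff[OF f(1)]] weyl_length_eq[OF n aff[OF w(1)]] by auto
  qed
  show ?thesis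
    unfolding longest_parabolic_def Let_def
  proof (rule the_equality)
    show "weyl_coset n w \<in> ?H \<and> (\<forall>v\<in>?H. v \<noteq> weyl_coset n w \<longrightarrow> weyl_length n v < weyl_length n (weyl_coset n w))"
      using wH longest by blast
    fix u assume u: "u \<in> ?H \<and> (\<forall>v\<in>?H. v \<noteq> u \<longrightarrow> weyl_length n v < weyl_length n u)"
    show "u = weyl_coset n w"
    proof (rule ccontr)
      assume ne: "u \<noteq> weyl_coset n w"
      then have "weyl_length n u < weyl_length n (weyl_coset n w)" using u longest by blast
      moreover have "weyl_length n (weyl_coset n w) < weyl_length n u" using u wH ne by blast
      ultimately show False by simp
    qed
  qed
qed

text \<open>
  On \<open>0, \<dots>, n - 2\<close> the power of \<open>\<tau>\<close> is the shift by \<open>-n\<close>, and the longest element reverses this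
  interval.
\<close>

lemma kappa0_eq:
  assumes n: "2 \<le> n"
  obtains k where "k \<in> affine_perms n" "kappa0 n = weyl_coset n k"
    "\<And>x. 0 \<le> x \<Longrightarrow> x \<le> int n - 2 \<Longrightarrow> k x = - 2 - x"
proof -
  obtain w where w: "w \<in> finite_perms n" "\<And>x. 0 \<le> x \<Longrightarrow> x \<le> int n - 2 \<Longrightarrow> w x = int n - 2 - x"
    using finite_perms_longest_exists[OF n] by blast
  have wa: "w \<in> affine_perms n" using w(1) by (simp add: finite_perms_def)
  let ?k = "w \<circ> (tau_perm n ^^ (n - 1))"
  show ?thesis
  proof (rule that[of ?k])
    show "?k \<in> affine_perms n" by (intro affine_compose wa tau_perm_power_affine n)
    have "longest_parabolic n = weyl_coset n w"
      using longest_parabolic_eq[OF n w(1)] w(2) by blast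
    then show "kappa0 n = weyl_coset n ?k"
      unfolding kappa0_def tau_power_eq[OF n] by (simp only:) (rule weyl_coset_mult_weyl[OF n wa])
    fix x assume x: "0 \<le> x" "x \<le> int n - 2"
    have "(tau_perm n ^^ (n - 1)) x = x - int n"
      using tau_perm_power[OF n x, of "n - 1"] x n by (simp add: of_nat_diff)
    then show "?k x = - 2 - x"
      using affine_shift(3)[OF wa, of x] w(2)[OF x] by simp
  qed
qed

lemma admissible_weyl_le_kappa0:
  assumes n: "2 \<le> n" and f: "f \<in> admissible_perms n"
  shows "weyl_le n (weyl_coset n f) (kappa0 n)"
proof -
  obtain k where k: "k \<in> affine_perms n" "kappa0 n = weyl_coset n k"
    "\<And>x. 0 \<le> x \<Longrightarrow> x \<le> int n - 2 \<Longrightarrow> k x = - 2 - x"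
    using kappa0_eq[OF n] by blast
  show ?thesis
    unfolding k(2) by (rule perm_steps_weyl_le[OF n admissible_climb[OF n k(1,3) f]])
qed

section \<open>The Bruhat decomposition for the Iwahori subgroup\<close>

text \<open>
  The weight of the leading term of an entry.
\<close>

definition pivot_weight :: "nat \<Rightarrow> complex fls mat \<Rightarrow> nat \<Rightarrow> nat \<Rightarrow> int" where
  "pivot_weight n g i j = int n * fls_subdegree (g $$ (i, j)) + int j - int i"

lemma addrow_mat_iwahori:
  assumes kl: "k < n" "l < n" "k \<noteq> l"
    and c: "c \<noteq> 0 \<Longrightarrow> 0 \<le> int n * fls_subdegree c + int l - int k"
  shows "addrow_mat n c k l \<in> iwahori n"
  unfolding iwahori_iff
proof (intro conjI allI impI)
  show "addrow_mat n c k l \<in> carrier (SLF n)" using kl by (rule addrow_SL)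
  fix i j m assume ij: "i < n" "j < n" and m: "int n * m + int j - int i < 0"
  show "fls_nth (addrow_mat n c k l $$ (i, j)) m = 0"
  proof (cases "i = k \<and> j = l")
    case True
    have "m < fls_subdegree c" if "c \<noteq> 0"
    proof (rule ccontr)
      assume "\<not> ?thesis"
      then have "int n * fls_subdegree c \<le> int n * m" by (intro mult_left_mono) auto
      then show False using c[OF that] m True by linarith
    qed
    then have "fls_nth c m = 0" by (cases "c = 0") auto
    then show ?thesis using True ij kl by (simp add: addrow_mat_def)
  next
    case False
    have "i = j \<Longrightarrow> m \<noteq> 0" using m by auto
    then show ?thesis using False ij by (auto simp: addrow_mat_def)
  qed
qed

lemma addrow_index:
  "A \<in> carrier_mat n n \<Longrightarrow> k < n \<Longrightarrow> j < n \<Longrightarrow>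
    addrow c i l A $$ (k, j) = (if k = i then c * A $$ (l, j) + A $$ (k, j) else A $$ (k, j))"
  by auto

lemma addcol_index:
  "A \<in> carrier_mat n n \<Longrightarrow> i < n \<Longrightarrow> k < n \<Longrightarrow>
    addcol c j l A $$ (i, k) = (if k = j then c * A $$ (i, l) + A $$ (i, k) else A $$ (i, k))"
  by auto

text \<open>
  Only multiples of row \<open>i0\<close> are added, so a row can change only in the columns where row \<open>i0\<close> is
  nonzero. The multiplier that clears an entry has as its weight the difference of the two pivot
  weights, which is nonnegative.
\<close>

lemma clear_column:
  assumes g: "g \<in> carrier (SLF n)" and p: "i0 < n" "j0 < n" "g $$ (i0, j0) \<noteq> 0"
    and S: "finite S" "S \<subseteq> {..<n} - {i0}"
    and min: "\<And>i. i \<in> S \<Longrightarrow> g $$ (i, j0) \<noteq> 0 \<Longrightarrow> pivot_weight n g i0 j0 \<le> pivot_weight n g i j0"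
  shows "\<exists>b \<in> iwahori n. (\<forall>i<n. \<forall>j<n. i \<notin> S \<longrightarrow> (b * g) $$ (i, j) = g $$ (i, j)) \<and>
    (\<forall>i\<in>S. (b * g) $$ (i, j0) = 0) \<and>
    (\<forall>i\<in>S. \<forall>j<n. g $$ (i0, j) = 0 \<longrightarrow> (b * g) $$ (i, j) = g $$ (i, j))"
  using S min
proof (induction S rule: finite_induct)
  case empty
  then show ?case using one_iwahori[of n] SL_D[OF g] by (intro bexI[of _ "1\<^sub>m n"]) auto
next
  case (insert i S)
  then obtain b where b: "b \<in> iwahori n" "\<And>k j. k < n \<Longrightarrow> j < n \<Longrightarrow> k \<notin> S \<Longrightarrow> (b * g) $$ (k, j) = g $$ (k, j)"
    "\<And>k. k \<in> S \<Longrightarrow> (b * g) $$ (k, j0) = 0"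
    "\<And>k j. k \<in> S \<Longrightarrow> j < n \<Longrightarrow> g $$ (i0, j) = 0 \<Longrightarrow> (b * g) $$ (k, j) = g $$ (k, j)" by auto
  have i: "i < n" "i \<noteq> i0" and i0S: "i0 \<notin> S" using insert.prems by auto
  define c where "c = - (g $$ (i, j0) / g $$ (i0, j0))"
  have "0 \<le> int n * fls_subdegree c + int i0 - int i" if "c \<noteq> 0"
  proof -
    have nz: "g $$ (i, j0) \<noteq> 0" using that by (auto simp: c_def)
    have "fls_subdegree c = fls_subdegree (g $$ (i, j0)) - fls_subdegree (g $$ (i0, j0))"
      using nz p(3) by (simp add: c_def fls_divide_subdegree)
    then have "int n * fls_subdegree c =
        int n * fls_subdegree (g $$ (i, j0)) - int n * fls_subdegree (g $$ (i0, j0))"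
      by (simp only: right_diff_distrib)
    moreover have "pivot_weight n g i0 j0 \<le> pivot_weight n g i j0" using insert.prems(2)[of i] nz by simp
    ultimately show ?thesis unfolding pivot_weight_def by linarith
  qed
  then have E: "addrow_mat n c i i0 \<in> iwahori n"
    using i p by (intro addrow_mat_iwahori) auto
  have bg: "b * g \<in> carrier (SLF n)" by (intro mult_in_SL iwahori_SL b(1) g)
  have eq: "addrow_mat n c i i0 * b * g = addrow c i i0 (b * g)"
    using SL_assoc[OF iwahori_SL[OF E] iwahori_SL[OF b(1)] g] addrow_mat[OF SL_D[OF bg] p(1), of c i] by simp
  have ent: "addrow c i i0 (b * g) $$ (k, j) =
      (if k = i then c * g $$ (i0, j) + (b * g) $$ (k, j) else (b * g) $$ (k, j))" if "k < n" "j < n" for k j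
    unfolding addrow_index[OF SL_D[OF bg] that] b(2)[OF p(1) that(2) i0S] ..
  show ?case
  proof (intro bexI[of _ "addrow_mat n c i i0 * b"] conjI allI ballI impI)
    show "addrow_mat n c i i0 * b \<in> iwahori n" by (intro iwahori_mult E b(1))
    show "(addrow_mat n c i i0 * b * g) $$ (k, j) = g $$ (k, j)" if "k < n" "j < n" "k \<notin> insert i S" for k j
      unfolding eq ent[OF that(1,2)] using that b(2) by auto
    show "(addrow_mat n c i i0 * b * g) $$ (k, j0) = 0" if "k \<in> insert i S" for k
    proof -
      have k: "k < n" using that insert.prems by auto
      show ?thesis
        unfolding eq ent[OF k p(2)] using that b(2)[OF i(1) p(2)] b(3) insert.hyps(2) p(3)
        by (auto simp: c_def)
    qed
    show "(addrow_mat n c i i0 * b * g) $$ (k, j) = g $$ (k, j)"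
      if "k \<in> insert i S" "j < n" "g $$ (i0, j) = 0" for k j
    proof -
      have k: "k < n" using that insert.prems by auto
      show ?thesis
        unfolding eq ent[OF k that(2)] using that b(2)[OF i(1) that(2)] b(4) insert.hyps(2) by auto
    qed
  qed
qed

text \<open>
  The counterpart of \<open>clear_column\<close>, by column operations from the right.
\<close>

lemma clear_row:
  assumes g: "g \<in> carrier (SLF n)" and p: "i0 < n" "j0 < n" "g $$ (i0, j0) \<noteq> 0"
    and S: "finite S" "S \<subseteq> {..<n} - {j0}"
    and min: "\<And>j. j \<in> S \<Longrightarrow> g $$ (i0, j) \<noteq> 0 \<Longrightarrow> pivot_weight n g i0 j0 \<le> pivot_weight n g i0 j"
  shows "\<exists>b \<in> iwahori n. (\<forall>i<n. \<forall>j<n. j \<notin> S \<longrightarrow> (g * b) $$ (i, j) = g $$ (i, j)) \<and>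
    (\<forall>j\<in>S. (g * b) $$ (i0, j) = 0) \<and>
    (\<forall>j\<in>S. \<forall>i<n. g $$ (i, j0) = 0 \<longrightarrow> (g * b) $$ (i, j) = g $$ (i, j))"
  using S min
proof (induction S rule: finite_induct)
  case empty
  then show ?case using one_iwahori[of n] SL_D[OF g] by (intro bexI[of _ "1\<^sub>m n"]) auto
next
  case (insert j S)
  then obtain b where b: "b \<in> iwahori n" "\<And>i k. i < n \<Longrightarrow> k < n \<Longrightarrow> k \<notin> S \<Longrightarrow> (g * b) $$ (i, k) = g $$ (i, k)"
    "\<And>k. k \<in> S \<Longrightarrow> (g * b) $$ (i0, k) = 0"
    "\<And>i k. k \<in> S \<Longrightarrow> i < n \<Longrightarrow> g $$ (i, j0) = 0 \<Longrightarrow> (g * b) $$ (i, k) = g $$ (i, k)" by auto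
  have j: "j < n" "j \<noteq> j0" and j0S: "j0 \<notin> S" using insert.prems by auto
  define c where "c = - (g $$ (i0, j) / g $$ (i0, j0))"
  have "0 \<le> int n * fls_subdegree c + int j - int j0" if "c \<noteq> 0"
  proof -
    have nz: "g $$ (i0, j) \<noteq> 0" using that by (auto simp: c_def)
    have "fls_subdegree c = fls_subdegree (g $$ (i0, j)) - fls_subdegree (g $$ (i0, j0))"
      using nz p(3) by (simp add: c_def fls_divide_subdegree)
    then have "int n * fls_subdegree c =
        int n * fls_subdegree (g $$ (i0, j)) - int n * fls_subdegree (g $$ (i0, j0))"
      by (simp only: right_diff_distrib)
    moreover have "pivot_weight n g i0 j0 \<le> pivot_weight n g i0 j" using insert.prems(2)[of j] nz by simp
    ultimately show ?thesis unfolding pivot_weight_def by linarith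
  qed
  then have E: "addrow_mat n c j0 j \<in> iwahori n"
    using j p by (intro addrow_mat_iwahori) auto
  have gb: "g * b \<in> carrier (SLF n)" by (intro mult_in_SL iwahori_SL b(1) g)
  have eq: "g * (b * addrow_mat n c j0 j) = addcol c j j0 (g * b)"
    using SL_assoc[OF g iwahori_SL[OF b(1)] iwahori_SL[OF E]] addcol_mat[OF SL_D[OF gb] p(2), of c j] by simp
  have ent: "addcol c j j0 (g * b) $$ (i, k) =
      (if k = j then c * g $$ (i, j0) + (g * b) $$ (i, k) else (g * b) $$ (i, k))" if "i < n" "k < n" for i k
    unfolding addcol_index[OF SL_D[OF gb] that] b(2)[OF that(1) p(2) j0S] ..
  show ?case
  proof (intro bexI[of _ "b * addrow_mat n c j0 j"] conjI allI ballI impI)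
    show "b * addrow_mat n c j0 j \<in> iwahori n" by (intro iwahori_mult E b(1))
    show "(g * (b * addrow_mat n c j0 j)) $$ (i, k) = g $$ (i, k)" if "i < n" "k < n" "k \<notin> insert j S" for i k
      unfolding eq ent[OF that(1,2)] using that b(2) by auto
    show "(g * (b * addrow_mat n c j0 j)) $$ (i0, k) = 0" if "k \<in> insert j S" for k
    proof -
      have k: "k < n" using that insert.prems by auto
      show ?thesis
        unfolding eq ent[OF p(1) k] using that b(2)[OF p(1) j(1)] b(3) insert.hyps(2) p(3)
        by (auto simp: c_def)
    qed
    show "(g * (b * addrow_mat n c j0 j)) $$ (i, k) = g $$ (i, k)"
      if "k \<in> insert j S" "i < n" "g $$ (i, j0) = 0" for i k
    proof -
      have k: "k < n" using that insert.prems by auto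
      show ?thesis
        unfolding eq ent[OF that(2) k] using that b(2)[OF that(2) j(1)] b(4) insert.hyps(2) by auto
    qed
  qed
qed

definition isolated :: "nat \<Rightarrow> complex fls mat \<Rightarrow> nat \<Rightarrow> nat \<Rightarrow> bool" where
  "isolated n g i j \<longleftrightarrow> i < n \<and> j < n \<and> g $$ (i, j) \<noteq> 0 \<and>
     (\<forall>i'<n. i' \<noteq> i \<longrightarrow> g $$ (i', j) = 0) \<and> (\<forall>j'<n. j' \<noteq> j \<longrightarrow> g $$ (i, j') = 0)"

lemma SL_column_nonzero:
  fixes g :: "'a::field mat"
  assumes g: "g \<in> carrier (SL n)" and j: "j < n"
  shows "\<exists>i<n. g $$ (i, j) \<noteq> 0"
proof (rule ccontr)
  assume "\<not> ?thesis"
  then have zero: "\<And>i. i < n \<Longrightarrow> g $$ (i, j) = 0" by blast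
  have "(inv\<^bsub>SL n\<^esub> g * g) $$ (j, j) = 0"
    unfolding mat_mult_index[OF SL_D[OF inv_SL_closed[OF g]] SL_D[OF g] j j]
    using zero by (intro sum.neutral) auto
  then show False using inv_SL_mult(2)[OF g] j by simp
qed

text \<open>
  Take an entry of minimal weight among the rows and columns without isolated entry. It has
  minimal weight in its row and in its column, so both can be cleared by operations in the Iwahori
  subgroup. Isolated entries stay isolated: their rows and columns meet the pivot row and column
  in zeros only.
\<close>

lemma isolate_pivot:
  assumes g: "g \<in> carrier (SLF n)" and j: "j < n" "\<And>i. \<not> isolated n g i j"
  shows "\<exists>b1 \<in> iwahori n. \<exists>b2 \<in> iwahori n. \<exists>i0 j0. isolated n (b1 * g * b2) i0 j0 \<and>
    (\<forall>i. \<not> isolated n g i j0) \<and> (\<forall>i j. isolated n g i j \<longrightarrow> isolated n (b1 * g * b2) i j)"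
proof -
  define P where "P = {(i, j). i < n \<and> j < n \<and> g $$ (i, j) \<noteq> 0 \<and> (\<forall>i. \<not> isolated n g i j) \<and> (\<forall>j. \<not> isolated n g i j)}"
  have fin: "finite P"
    by (rule finite_subset[of _ "{..<n} \<times> {..<n}"]) (auto simp: P_def)
  obtain i where i: "i < n" "g $$ (i, j) \<noteq> 0" using SL_column_nonzero[OF g j(1)] by blast
  have "\<not> isolated n g i j'" for j'
    using i j unfolding isolated_def by metis
  then have "(i, j) \<in> P" using i j by (auto simp: P_def)
  then have ne: "P \<noteq> {}" by blast
  obtain p where p: "p \<in> P" "\<And>q. q \<in> P \<Longrightarrow> (\<lambda>(i, j). pivot_weight n g i j) p \<le> (\<lambda>(i, j). pivot_weight n g i j) q"
    using ex_min_if_finite[of "(\<lambda>(i, j). pivot_weight n g i j) ` P"] fin ne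
    by (metis (no_types, lifting) arg_min_if_finite(1) arg_min_least)
  obtain i0 j0 where p_eq: "p = (i0, j0)" by (cases p)
  have P0: "(i0, j0) \<in> P" using p p_eq by simp
  have min: "pivot_weight n g i0 j0 \<le> pivot_weight n g i j" if "(i, j) \<in> P" for i j
    using p(2)[OF that] p_eq by simp
  have i0: "i0 < n" "j0 < n" "g $$ (i0, j0) \<noteq> 0" "\<And>i. \<not> isolated n g i j0" "\<And>j. \<not> isolated n g i0 j"
    using P0 by (auto simp: P_def)
  define S where "S = {i. i < n \<and> i \<noteq> i0 \<and> (\<forall>j. \<not> isolated n g i j)}"
  define T where "T = {j. j < n \<and> j \<noteq> j0 \<and> (\<forall>i. \<not> isolated n g i j)}"
  have S: "finite S" "S \<subseteq> {..<n} - {i0}" and T: "finite T" "T \<subseteq> {..<n} - {j0}"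
    by (auto simp: S_def T_def)
  have minS: "pivot_weight n g i0 j0 \<le> pivot_weight n g i j0" if "i \<in> S" "g $$ (i, j0) \<noteq> 0" for i
    using that i0 by (intro min) (auto simp: P_def S_def)
  obtain b1 where b1: "b1 \<in> iwahori n" "\<And>i j. i < n \<Longrightarrow> j < n \<Longrightarrow> i \<notin> S \<Longrightarrow> (b1 * g) $$ (i, j) = g $$ (i, j)"
    "\<And>i. i \<in> S \<Longrightarrow> (b1 * g) $$ (i, j0) = 0"
    "\<And>i j. i \<in> S \<Longrightarrow> j < n \<Longrightarrow> g $$ (i0, j) = 0 \<Longrightarrow> (b1 * g) $$ (i, j) = g $$ (i, j)"
    using clear_column[OF g i0(1-3) S minS] by blast
  define h where "h = b1 * g"
  have h: "h \<in> carrier (SLF n)" unfolding h_def by (intro mult_in_SL iwahori_SL b1(1) g)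
  have i0S: "i0 \<notin> S" by (simp add: S_def)
  have row0: "h $$ (i0, j) = g $$ (i0, j)" if "j < n" for j
    unfolding h_def using b1(2)[OF i0(1) that i0S] .
  have minT: "pivot_weight n h i0 j0 \<le> pivot_weight n h i0 j" if "j \<in> T" "h $$ (i0, j) \<noteq> 0" for j
  proof -
    have jn: "j < n" using that(1) by (simp add: T_def)
    have "pivot_weight n g i0 j0 \<le> pivot_weight n g i0 j"
      using that i0 row0[OF jn] by (intro min) (auto simp: P_def T_def)
    then show ?thesis using row0 jn i0(2) by (simp add: pivot_weight_def)
  qed
  have hp: "h $$ (i0, j0) \<noteq> 0" using row0 i0 by simp
  obtain b2 where b2: "b2 \<in> iwahori n" "\<And>i j. i < n \<Longrightarrow> j < n \<Longrightarrow> j \<notin> T \<Longrightarrow> (h * b2) $$ (i, j) = h $$ (i, j)"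
    "\<And>j. j \<in> T \<Longrightarrow> (h * b2) $$ (i0, j) = 0"
    "\<And>i j. j \<in> T \<Longrightarrow> i < n \<Longrightarrow> h $$ (i, j0) = 0 \<Longrightarrow> (h * b2) $$ (i, j) = h $$ (i, j)"
    using clear_row[OF h i0(1,2) hp T minT] by blast
  have iso_h: "isolated n h i j" if iso: "isolated n g i j" for i j
  proof -
    have ij: "i < n" "j < n" "i \<notin> S" "i \<noteq> i0" "j \<noteq> j0" using iso i0 by (auto simp: isolated_def S_def)
    have col: "h $$ (i', j) = g $$ (i', j)" if "i' < n" for i'
    proof (cases "i' \<in> S")
      case True
      have "g $$ (i0, j) = 0" using iso i0(1) ij by (simp add: isolated_def)
      then show ?thesis unfolding h_def using b1(4)[OF True ij(2)] by simp
    qed (use that ij b1(2) in \<open>simp add: h_def\<close>)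
    have row: "h $$ (i, j') = g $$ (i, j')" if "j' < n" for j'
      using that ij b1(2) by (simp add: h_def)
    show ?thesis using iso col row by (simp add: isolated_def)
  qed
  have col0: "h $$ (i, j0) = 0" if lt: "i < n" and ne: "i \<noteq> i0" for i
  proof (cases "i \<in> S")
    case True
    then show ?thesis unfolding h_def by (rule b1(3))
  next
    case False
    then obtain j where "isolated n g i j" using lt ne by (auto simp: S_def)
    moreover from this have "j \<noteq> j0" using i0 by auto
    ultimately have "g $$ (i, j0) = 0" using i0(2) by (simp add: isolated_def)
    then show ?thesis unfolding h_def using b1(2)[OF lt i0(2) False] by simp
  qed
  have j0T: "j0 \<notin> T" by (simp add: T_def)
  have off: "(h * b2) $$ (i, j) = h $$ (i, j)" if "i < n" "j < n" "i \<noteq> i0" for i j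
    using b2(2)[OF that(1,2)] b2(4)[OF _ that(1) col0[OF that(1,3)]] by blast
  have iso: "isolated n (h * b2) i j" if "isolated n g i j" for i j
  proof -
    have iso: "isolated n h i j" by (rule iso_h[OF that])
    have ij: "i < n" "j < n" "i \<noteq> i0" "j \<noteq> j0" "j \<notin> T" using that i0 by (auto simp: isolated_def T_def)
    have "(h * b2) $$ (i', j) = h $$ (i', j)" if "i' < n" for i' using b2(2)[OF that ij(2,5)] .
    moreover have "(h * b2) $$ (i, j') = h $$ (i, j')" if "j' < n" for j' using off[OF ij(1) that ij(3)] .
    ultimately show ?thesis using iso by (simp add: isolated_def)
  qed
  have "isolated n (h * b2) i0 j0"
    unfolding isolated_def
  proof (intro conjI allI impI)
    show "(h * b2) $$ (i0, j0) \<noteq> 0" using b2(2)[OF i0(1,2) j0T] hp by simp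
    show "(h * b2) $$ (i, j0) = 0" if "i < n" "i \<noteq> i0" for i
      using off[OF that(1) i0(2) that(2)] col0[OF that] by simp
    show "(h * b2) $$ (i0, j) = 0" if lt: "j < n" and ne: "j \<noteq> j0" for j
    proof (cases "j \<in> T")
      case False
      then obtain i where iso: "isolated n g i j" using lt ne by (auto simp: T_def)
      then have "i \<noteq> i0" using i0 by auto
      then have "g $$ (i0, j) = 0" using iso i0(1) by (simp add: isolated_def)
      then show ?thesis using b2(2)[OF i0(1) lt False] row0[OF lt] by simp
    qed (rule b2(3))
  qed (rule i0)+
  then show ?thesis
    using b1(1) b2(1) i0(4) iso unfolding h_def by blast
qed

lemma monomial_representative:
  assumes "g \<in> carrier (SLF n)"
  shows "\<exists>b1 \<in> iwahori n. \<exists>b2 \<in> iwahori n. \<forall>j<n. \<exists>i. isolated n (b1 * g * b2) i j"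
  using assms
proof (induction "card {j. j < n \<and> (\<forall>i. \<not> isolated n g i j)}" arbitrary: g rule: less_induct)
  case less
  let ?C = "\<lambda>g. {j. j < n \<and> (\<forall>i. \<not> isolated n g i j)}"
  show ?case
  proof (cases "\<exists>j<n. \<forall>i. \<not> isolated n g i j")
    case False
    have "1\<^sub>m n * g * 1\<^sub>m n = g" using SL_D[OF less.prems] by simp
    then show ?thesis using False one_iwahori[of n] by metis
  next
    case True
    then obtain j where j: "j < n" "\<And>i. \<not> isolated n g i j" by blast
    obtain b1 b2 i0 j0 where b: "b1 \<in> iwahori n" "b2 \<in> iwahori n" "isolated n (b1 * g * b2) i0 j0"
      "\<And>i. \<not> isolated n g i j0" "\<And>i j. isolated n g i j \<Longrightarrow> isolated n (b1 * g * b2) i j"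
      using isolate_pivot[OF less.prems j] by blast
    let ?h = "b1 * g * b2"
    have hS: "?h \<in> carrier (SLF n)" by (intro mult_in_SL iwahori_SL b less.prems)
    have "?C ?h \<subset> ?C g"
    proof
      show "?C ?h \<subseteq> ?C g" using b(5) by blast
      have "j0 < n" using b(3) by (simp add: isolated_def)
      then have "j0 \<in> ?C g" "j0 \<notin> ?C ?h" using b by auto
      then show "?C ?h \<noteq> ?C g" by blast
    qed
    then have "card (?C ?h) < card (?C g)" by (intro psubset_card_mono) auto
    from less.hyps[OF this hS] obtain c1 c2 where c: "c1 \<in> iwahori n" "c2 \<in> iwahori n"
      "\<forall>j<n. \<exists>i. isolated n (c1 * ?h * c2) i j" by blast
    have "c1 * ?h * c2 = (c1 * b1) * g * (b2 * c2)"
    proof -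
      note S = iwahori_SL[OF b(1)] iwahori_SL[OF b(2)] iwahori_SL[OF c(1)] iwahori_SL[OF c(2)] less.prems
      show ?thesis
        by (simp add: SL_assoc[of _ n] S mult_in_SL)
    qed
    then show ?thesis using c b iwahori_mult by metis
  qed
qed

text \<open>
  Each nonzero entry is its leading term times a power series with constant term one. The leading
  terms form the monomial matrix and the unit factors the diagonal matrix \<open>d\<close>. The determinant of
  \<open>d\<close> is again a series with constant term one while that of the monomial matrix is a single term;
  as the product is one, both are one.
\<close>

lemma isolated_SL_factorization:
  assumes n: "0 < n" and g: "g \<in> carrier (SLF n)" and iso: "\<forall>j<n. \<exists>i. isolated n g i j"
  shows "\<exists>f \<in> affine_perms n. \<exists>m \<in> weyl_coset n f. \<exists>d \<in> iwahori n. g = m * d"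
proof -
  obtain \<sigma> where \<sigma>: "\<And>j. j < n \<Longrightarrow> isolated n g (\<sigma> j) j" using iso by metis
  have \<sigma>n: "\<sigma> j < n" if "j < n" for j using \<sigma>[OF that] by (simp add: isolated_def)
  define k where "k j = fls_subdegree (g $$ (\<sigma> j, j))" for j
  define c where "c j = fls_nth (g $$ (\<sigma> j, j)) (k j)" for j
  have nz: "g $$ (\<sigma> j, j) \<noteq> 0" if "j < n" for j using \<sigma>[OF that] by (simp add: isolated_def)
  have cnz: "c j \<noteq> 0" if "j < n" for j using nz[OF that] by (simp add: c_def k_def)
  have inj: "inj_on \<sigma> {..<n}"
  proof (rule inj_onI)
    fix i j assume "i \<in> {..<n}" "j \<in> {..<n}" "\<sigma> i = \<sigma> j"
    then show "i = j" using \<sigma>[of i] \<sigma>[of j] unfolding isolated_def by (metis lessThan_iff)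
  qed
  then have bij: "bij_betw \<sigma> {..<n} {..<n}"
    using \<sigma>n by (simp add: bij_betw_def endo_inj_surj image_subset_iff)
  define r where "r x = nat (x mod int n)" for x
  have r: "int (r x) = x mod int n" "r x < n" for x using n by (auto simp: r_def nat_less_iff)
  have rj: "r (int j) = j" if "j < n" for j using that by (simp add: r_def)
  \<comment> \<open>An entry of order \<open>k\<close> in row \<open>\<sigma> j\<close> stands for the integer \<open>\<sigma> j - n k\<close>.\<close>
  define f where "f x = int (\<sigma> (r x)) - int n * k (r x) + int n * (x div int n)" for x
  have fj: "f (int j) = int (\<sigma> j) - int n * k j" if "j < n" for j
    using that by (simp add: f_def rj)
  have fmod: "f x mod int n = int (\<sigma> (r x))" for x
  proof -
    have "f x = int (\<sigma> (r x)) + int n * (x div int n - k (r x))" by (simp add: f_def algebra_simps)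
    then have "f x mod int n = int (\<sigma> (r x)) mod int n" by simp
    then show ?thesis using \<sigma>n[OF r(2)[of x]] by simp
  qed
  have fdiv: "f (int j) div int n = - k j" if "j < n" for j
  proof -
    have "f (int j) = int (\<sigma> j) + int n * (- k j)" using fj[OF that] by simp
    then have "f (int j) div int n = int (\<sigma> j) div int n + (- k j)" using n by (simp only: div_mult_self2)
    then show ?thesis using \<sigma>n[OF that] by simp
  qed
  have shift: "f (x + int n) = f x + int n" for x
    using n by (simp add: f_def r_def algebra_simps)
  have "inj f"
  proof (rule injI)
    fix x y assume eq: "f x = f y"
    then have "\<sigma> (r x) = \<sigma> (r y)" using fmod[of x] fmod[of y] by simp
    then have rr: "r x = r y" using inj r(2) by (auto dest: inj_onD)
    then have "x div int n = y div int n" using eq n by (simp add: f_def)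
    moreover have "x mod int n = y mod int n" using rr r(1) by metis
    ultimately show "x = y" by (metis mult_div_mod_eq)
  qed
  moreover have "surj f"
  proof -
    have "\<exists>x. f x = y" for y
    proof -
      have "r y \<in> \<sigma> ` {..<n}" using bij r(2) by (simp add: bij_betw_def)
      then obtain j where j: "j < n" "\<sigma> j = r y" by auto
      let ?x = "int j + int n * (y div int n + k j)"
      have "r ?x = j" "?x div int n = y div int n + k j" using j n by (simp_all add: r_def)
      then have "f ?x = int (r y) + int n * (y div int n)" using j by (simp add: f_def algebra_simps)
      then have "f ?x = y" using r(1)[of y] by simp
      then show ?thesis by blast
    qed
    then show ?thesis unfolding surj_def by metis
  qed
  ultimately have bijf: "bij f" by (simp add: bij_def)
  define m where "m = monom_mat n f c"
  define d where "d = mat n n (\<lambda>(i, j). if i = j then g $$ (\<sigma> j, j) * (fls_const (inverse (c j)) * fls_X_intpow (- k j)) else 0)"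
  have dC: "d \<in> carrier_mat n n" by (simp add: d_def)
  have gC: "g \<in> carrier_mat n n" using g by (rule SL_D)
  have md: "m * d = g"
  proof (rule eq_matI)
    fix i j assume "i < dim_row g" "j < dim_col g"
    then have ij: "i < n" "j < n" using gC by auto
    have "(m * d) $$ (i, j) = (\<Sum>l<n. m $$ (i, l) * d $$ (l, j))"
      unfolding m_def by (rule mat_mult_index[OF monom_mat_carrier dC ij])
    also have "\<dots> = m $$ (i, j) * d $$ (j, j) + (\<Sum>l\<in>{..<n} - {j}. m $$ (i, l) * d $$ (l, j))"
      using ij by (intro sum.remove) auto
    also have "(\<Sum>l\<in>{..<n} - {j}. m $$ (i, l) * d $$ (l, j)) = 0"
      using ij by (intro sum.neutral) (auto simp: d_def)
    also have "m $$ (i, j) * d $$ (j, j) + 0 = g $$ (i, j)"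
    proof (cases "\<sigma> j = i")
      case True
      then have mA: "m $$ (i, j) = fls_const (c j) * fls_X_intpow (k j)"
        unfolding m_def monom_mat_index[OF ij] using fmod[of "int j"] rj[OF ij(2)] fdiv[OF ij(2)] by simp
      have dB: "d $$ (j, j) = g $$ (i, j) * (fls_const (inverse (c j)) * fls_X_intpow (- k j))"
        using ij True by (simp add: d_def)
      have AB: "(fls_const (c j) * fls_X_intpow (k j)) * (fls_const (inverse (c j)) * fls_X_intpow (- k j)) = 1"
        unfolding const_X_intpow_mult using cnz[OF ij(2)] by simp
      have "m $$ (i, j) * d $$ (j, j) = g $$ (i, j) *
          ((fls_const (c j) * fls_X_intpow (k j)) * (fls_const (inverse (c j)) * fls_X_intpow (- k j)))"
        unfolding mA dB by (rule mult.left_commute)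
      then show ?thesis by (simp only: AB mult_1_right add_0_right)
    next
      case False
      then have "m $$ (i, j) = 0"
        unfolding m_def monom_mat_index[OF ij] using fmod[of "int j"] rj[OF ij(2)] by simp
      moreover have "g $$ (i, j) = 0" using \<sigma>[OF ij(2)] False ij by (simp add: isolated_def)
      ultimately show ?thesis by simp
    qed
    finally show "(m * d) $$ (i, j) = g $$ (i, j)" .
  qed (use gC in \<open>simp_all add: m_def d_def monom_mat_def\<close>)
  have dnth: "fls_nth (d $$ (i, j)) l = (if i = j then fls_nth (g $$ (\<sigma> j, j)) (l + k j) / c j else 0)"
    if "i < n" "j < n" for i j l
  proof -
    have "fls_nth (u * (fls_const a * fls_X_intpow b)) l = fls_nth u (l - b) * a" for u :: "complex fls" and a b
    proof -
      have "u * (fls_const a * fls_X_intpow b) = fls_X_intpow b * (u * fls_const a)" by (simp add: mult_ac)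
      also have "\<dots> = fls_shift (- b) (u * fls_const a)" by (rule fls_X_intpow_times_conv_shift(1))
      finally show ?thesis by simp
    qed
    from this[of "g $$ (\<sigma> j, j)" "inverse (c j)" "- k j"] show ?thesis
      using that by (cases "i = j") (simp_all add: d_def divide_inverse)
  qed
  have dpow: "fls_nth (d $$ (i, j)) l = 0" if "i < n" "j < n" "l < 0" for i j l
    using that by (simp add: dnth k_def)
  have "map_mat (\<lambda>f. fls_nth f 0) d = 1\<^sub>m n"
    by (rule eq_matI) (use dC cnz in \<open>auto simp: dnth c_def[symmetric]\<close>)
  then have det0: "fls_nth (det d) 0 = 1" using det_constant_term(1)[OF dC dpow] by simp
  have detneg: "fls_nth (det d) l = 0" if "l < 0" for l using det_constant_term(2)[OF dC dpow that] by simp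
  obtain C where C: "det m = fls_const C * fls_X_intpow (- (\<Sum>j<n. f (int j) div int n))"
    using det_monom_mat[of n f c] unfolding m_def by blast
  have one: "det m * det d = 1"
    using det_mult[of m n d] md g dC by (simp add: m_def carrier_SL)
  define K where "K = - (\<Sum>j<n. f (int j) div int n)"
  have prod: "fls_nth (det m * det d) l = C * fls_nth (det d) (l - K)" for l
    unfolding C K_def[symmetric]
    by (simp only: mult.assoc fls_X_intpow_times_conv_shift(1)) simp
  have "C \<noteq> 0" using prod[of 0] one by auto
  moreover have "C = fls_nth (1 :: complex fls) K" using prod[of K] one det0 by simp
  ultimately have K0: "K = 0" and "C = 1" by (auto split: if_splits)
  then have "det m = 1" using C unfolding K_def[symmetric] by simp
  then have mS: "m \<in> carrier (SLF n)" by (simp add: carrier_SL m_def)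
  have dS: "d \<in> carrier (SLF n)" using one \<open>det m = 1\<close> dC by (simp add: carrier_SL)
  have "(\<Sum>j<n. f (int j) - int j) = 0"
  proof -
    have "(\<Sum>j<n. f (int j)) = (\<Sum>j<n. int (\<sigma> j) + int n * (f (int j) div int n))"
    proof (intro sum.cong refl)
      show "f (int j) = int (\<sigma> j) + int n * (f (int j) div int n)" if "j \<in> {..<n}" for j
        using that fdiv[of j] fj[of j] by (simp only: lessThan_iff)
    qed
    also have "\<dots> = (\<Sum>j<n. int (\<sigma> j)) + int n * (\<Sum>j<n. f (int j) div int n)"
      by (simp add: sum.distrib sum_distrib_left)
    also have "(\<Sum>j<n. f (int j) div int n) = 0" using K0 by (simp add: K_def)
    also have "(\<Sum>j<n. int (\<sigma> j)) = (\<Sum>j<n. int j)" by (rule sum.reindex_bij_betw[OF bij])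
    finally show ?thesis by (simp add: sum_subtractf)
  qed
  then have fa: "f \<in> affine_perms n" using bijf shift by (simp add: affine_perms_def)
  have "d \<in> iwahori n"
    unfolding iwahori_iff
  proof (intro conjI allI impI dS)
    fix i j l assume ij: "i < n" "j < n" and l: "int n * l + int j - int i < 0"
    show "fls_nth (d $$ (i, j)) l = 0"
    proof (cases "i = j")
      case True
      then have "l < 0" using l by (simp add: mult_less_0_iff)
      then show ?thesis using dpow ij by blast
    qed (simp add: dnth ij)
  qed
  moreover have "m \<in> weyl_coset n f" using mS by (auto simp: weyl_coset_def m_def)
  ultimately show ?thesis using fa md by blast
qed

lemma iwahori_bruhat_decomposition:
  assumes n: "0 < n" and g: "g \<in> carrier (SLF n)"
  shows "\<exists>f \<in> affine_perms n. \<exists>m \<in> weyl_coset n f. \<exists>b1 \<in> iwahori n. \<exists>b2 \<in> iwahori n. g = b1 * m * b2"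
proof -
  obtain c1 c2 where c: "c1 \<in> iwahori n" "c2 \<in> iwahori n" "\<forall>j<n. \<exists>i. isolated n (c1 * g * c2) i j"
    using monomial_representative[OF g] by blast
  note S = iwahori_SL[OF c(1)] iwahori_SL[OF c(2)] g
  have h: "c1 * g * c2 \<in> carrier (SLF n)" by (intro mult_in_SL S)
  obtain f m d where f: "f \<in> affine_perms n" "m \<in> weyl_coset n f" "d \<in> iwahori n" "c1 * g * c2 = m * d"
    using isolated_SL_factorization[OF n h c(3)] by blast
  let ?b1 = "inv\<^bsub>SLF n\<^esub> c1" and ?b2 = "d * inv\<^bsub>SLF n\<^esub> c2"
  have "g = ?b1 * (c1 * g * c2) * inv\<^bsub>SLF n\<^esub> c2"
    using S SL_D[OF g] by (simp add: SL_assoc[of _ n] mult_in_SL inv_SL_closed SL_cancel inv_SL_mult)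
  also have "\<dots> = ?b1 * m * ?b2"
    unfolding f(4) using S weyl_coset_SL[OF f(2)] iwahori_SL[OF f(3)]
    by (simp add: SL_assoc[of _ n] mult_in_SL inv_SL_closed)
  finally have "g = ?b1 * m * ?b2" .
  moreover have "?b1 \<in> iwahori n" "?b2 \<in> iwahori n"
    by (intro iwahori_mult iwahori_inverse c f(3))+
  ultimately show ?thesis using f(1,2) by blast
qed

section \<open>Flags above a fixed lattice\<close>

text \<open>
  The condition says that poles have order at most one and do not occur in the last row. Written
  as a bound on \<open>n k - i\<close>, it is visibly preserved by factors of nonnegative weight.
\<close>

definition pole_bounded :: "nat \<Rightarrow> complex fls mat set" where
  "pole_bounded n = {h \<in> carrier_mat n n. \<forall>i<n. \<forall>j<n. \<forall>k.
     int n * k - int i < 2 - 2 * int n \<longrightarrow> fls_nth (h $$ (i, j)) k = 0}"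

text \<open>
  The loops \<open>g\<close> with \<open>t L \<subseteq> g (\<Lambda> (n - 1))\<close>.
\<close>

definition bounded_loops :: "nat \<Rightarrow> complex fls mat set" where
  "bounded_loops n = {g \<in> carrier (SLF n). inv\<^bsub>SLF n\<^esub> g \<in> pole_bounded n}"

lemma pole_bounded_mult:
  assumes h: "h \<in> pole_bounded n" and b: "b \<in> iwahori n"
  shows "b * h \<in> pole_bounded n" "h * b \<in> pole_bounded n"
proof -
  have C: "h \<in> carrier_mat n n" "b \<in> carrier_mat n n"
    using h iwahori_SL[OF b] by (auto simp: pole_bounded_def carrier_SL)
  have hz: "fls_nth (h $$ (i, j)) k = 0" if "i < n" "j < n" "int n * k - int i < 2 - 2 * int n" for i j k
    using h that by (simp add: pole_bounded_def)
  have bz: "fls_nth (b $$ (i, j)) k = 0" if "i < n" "j < n" "k < 0" for i j k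
  proof (rule iwahori_nth[OF b that(1,2)])
    have "int n * k \<le> int n * (- 1)" using that by (intro mult_left_mono) auto
    then show "int n * k + int j - int i < 0" using that by auto
  qed
  have nk: "int n * k = int n * a + int n * c" if "a + c = k" for a c k
    using that by (simp add: distrib_left[symmetric])
  show "b * h \<in> pole_bounded n"
    unfolding pole_bounded_def mem_Collect_eq
  proof (intro conjI allI impI)
    fix i j k assume ij: "i < n" "j < n" and k: "int n * k - int i < 2 - 2 * int n"
    show "fls_nth ((b * h) $$ (i, j)) k = 0"
    proof (rule mat_mult_nth_eq_0[OF C(2,1) ij])
      fix l a c assume l: "l < n" "a + c = k"
      have "int n * a + int l - int i < 0 \<or> int n * c - int l < 2 - 2 * int n"
        using k nk[OF l(2)] by linarith
      then show "fls_nth (b $$ (i, l)) a = 0 \<or> fls_nth (h $$ (l, j)) c = 0"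
        using iwahori_nth[OF b ij(1) l(1)] hz[OF l(1) ij(2)] by blast
    qed
  qed (use C in auto)
  show "h * b \<in> pole_bounded n"
    unfolding pole_bounded_def mem_Collect_eq
  proof (intro conjI allI impI)
    fix i j k assume ij: "i < n" "j < n" and k: "int n * k - int i < 2 - 2 * int n"
    show "fls_nth ((h * b) $$ (i, j)) k = 0"
    proof (rule mat_mult_nth_eq_0[OF C ij])
      fix l a c assume l: "l < n" "a + c = k"
      have "c < 0 \<or> int n * a - int i < 2 - 2 * int n"
      proof (rule ccontr)
        assume "\<not> ?thesis"
        moreover from this have "0 \<le> int n * c" by simp
        ultimately show False using k nk[OF l(2)] by linarith
      qed
      then show "fls_nth (h $$ (i, l)) a = 0 \<or> fls_nth (b $$ (l, j)) c = 0"
        using bz[OF l(1) ij(2)] hz[OF ij(1) l(1)] by blast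
    qed
  qed (use C in auto)
qed

lemma inv_SL_mult_distrib:
  fixes a b :: "'a::field mat"
  assumes "a \<in> carrier (SL n)" "b \<in> carrier (SL n)"
  shows "inv\<^bsub>SL n\<^esub> (a * b) = inv\<^bsub>SL n\<^esub> b * inv\<^bsub>SL n\<^esub> a"
  using group.inv_mult_group[OF group_SL assms] by simp

lemma bounded_loops_mult:
  assumes g: "g \<in> bounded_loops n" and b: "b \<in> iwahori n"
  shows "b * g \<in> bounded_loops n" "g * b \<in> bounded_loops n"
  using g pole_bounded_mult[OF _ iwahori_inverse[OF b], of "inv\<^bsub>SLF n\<^esub> g"]
  by (auto simp: bounded_loops_def mult_in_SL iwahori_SL[OF b] inv_SL_mult_distrib)

text \<open>
  For a monomial matrix the lattice condition bounds the inverse permutation from above on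
  \<open>0, \<dots>, n - 1\<close> by \<open>2 n - 2\<close>. By periodicity the inverse then maps negative numbers below \<open>n - 1\<close>,
  so \<open>f\<close> is nonnegative from \<open>n - 1\<close> on.
\<close>

lemma bounded_weyl_admissible:
  assumes n: "2 \<le> n" and f: "f \<in> affine_perms n" and m: "m \<in> weyl_coset n f" and mb: "m \<in> bounded_loops n"
  shows "f \<in> admissible_perms n"
proof -
  obtain g where g: "g \<in> affine_perms n" "f \<circ> g = id" "g \<circ> f = id" by (rule affine_inverse[OF f])
  let ?h = "inv\<^bsub>SLF n\<^esub> m"
  have h: "?h \<in> weyl_coset n g" by (rule weyl_coset_inv[OF f m g(2)])
  then obtain c where c: "?h = monom_mat n g c" by (auto simp: weyl_coset_def)
  have cnz: "c j \<noteq> 0" if "j < n" for j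
    using monom_mat_SL_nonzero[of n g c j] weyl_coset_SL[OF h] c that by simp
  have up: "g (int j) \<le> 2 * int n - 2" if j: "j < n" for j
  proof (rule ccontr)
    assume gt: "\<not> ?thesis"
    define i where "i = nat (g (int j) mod int n)"
    have i: "i < n" "int i = g (int j) mod int n" using n by (auto simp: i_def nat_less_iff)
    have "int n * (g (int j) div int n) + int i = g (int j)" unfolding i(2) by (rule mult_div_mod_eq)
    then have "int n * (- (g (int j) div int n)) - int i < 2 - 2 * int n" using gt by simp
    then have "fls_nth (?h $$ (i, j)) (- (g (int j) div int n)) = 0"
      using mb i(1) j by (simp only: bounded_loops_def pole_bounded_def mem_Collect_eq)
    moreover have "fls_nth (?h $$ (i, j)) (- (g (int j) div int n)) = c j"
      unfolding c monom_mat_index[OF i(1) j] using i(2) const_X_intpow_nth[of "c j" "- (g (int j) div int n)"] by simp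
    ultimately show False using cnz[OF j] by simp
  qed
  have "0 \<le> f x" if x: "int n - 1 \<le> x" for x
  proof (rule ccontr)
    assume neg: "\<not> ?thesis"
    define q j where "q = f x div int n" and "j = nat (f x mod int n)"
    have j: "j < n" "int j = f x mod int n" using n by (auto simp: j_def nat_less_iff)
    have fx: "f x = int j + int n * q" unfolding j(2) q_def by (rule mod_mult_div_eq[symmetric])
    have "x = g (f x)" using fun_cong[OF g(3), of x] by simp
    also have "\<dots> = g (int j) + int n * q" unfolding fx by (rule affine_shift(1)[OF g(1)])
    finally have xg: "x = g (int j) + int n * q" .
    have "0 < int n" using n by simp
    then have "q < 0" unfolding q_def using neg by (intro div_neg_pos_less0) auto
    then have "int n * q \<le> int n * (- 1)" by (intro mult_left_mono) auto
    then show False using xg up[OF j(1)] x by linarith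
  qed
  then show ?thesis using f by (simp add: admissible_perms_def)
qed

text \<open>
  Bruhat decomposition: the monomial factor satisfies the lattice condition too.
\<close>

lemma bounded_loops_schubert:
  assumes n: "2 \<le> n" and g: "g \<in> bounded_loops n"
  shows "flag_point n g \<in> affine_schubert n (kappa0 n)"
proof -
  have gS: "g \<in> carrier (SLF n)" using g by (simp add: bounded_loops_def)
  obtain f m b1 b2 where f: "f \<in> affine_perms n" "m \<in> weyl_coset n f" and b: "b1 \<in> iwahori n" "b2 \<in> iwahori n"
    and g_eq: "g = b1 * m * b2"
    using iwahori_bruhat_decomposition[of n g] n gS by auto
  note S = iwahori_SL[OF b(1)] iwahori_SL[OF b(2)] weyl_coset_SL[OF f(2)]
  have "inv\<^bsub>SLF n\<^esub> b1 * (g * inv\<^bsub>SLF n\<^esub> b2) = m"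
    unfolding g_eq using S by (simp add: mult_in_SL SL_cancel)
  moreover have "inv\<^bsub>SLF n\<^esub> b1 * (g * inv\<^bsub>SLF n\<^esub> b2) \<in> bounded_loops n"
    by (intro bounded_loops_mult iwahori_inverse b g)
  ultimately have "f \<in> admissible_perms n"
    using bounded_weyl_admissible[OF n f] by simp
  then have "weyl_le n (weyl_coset n f) (kappa0 n)" by (rule admissible_weyl_le_kappa0[OF n])
  moreover have "g \<in> iwahori n <#>\<^bsub>SLF n\<^esub> weyl_coset n f <#>\<^bsub>SLF n\<^esub> iwahori n"
    unfolding g_eq set_mult_def using b f(2) by auto
  ultimately show ?thesis
    unfolding affine_schubert_def using weyl_coset_in_carrier[OF n f(1)] by blast
qed

lemma loop_regular_sum:
  "finite S \<Longrightarrow> (\<And>x. x \<in> S \<Longrightarrow> p x \<in> loop_regular n) \<Longrightarrow> (\<lambda>g. \<Sum>x\<in>S. p x g) \<in> loop_regular n"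
proof (induction S rule: finite_induct)
  case (insert x S)
  then have "(\<lambda>g. p x g + (\<Sum>x\<in>S. p x g)) \<in> loop_regular n" by (intro loop_regular.add) auto
  then show ?case using insert by simp
qed (simp add: loop_regular.const)

section \<open>Regular functions and closedness\<close>

text \<open>
  Laurent series valued functions whose coefficients are regular on a stage. The uniform bound on
  the pole order is what makes the coefficients of a product finite sums.
\<close>

definition stage_regular :: "nat \<Rightarrow> nat \<Rightarrow> (complex fls mat \<Rightarrow> complex fls) \<Rightarrow> bool" where
  "stage_regular n N F \<longleftrightarrow> (\<exists>M::nat. \<forall>g\<in>loop_stage n N. \<forall>k < - int M. fls_nth (F g) k = 0) \<and>
     (\<forall>k. \<exists>p\<in>loop_regular n. \<forall>g\<in>loop_stage n N. fls_nth (F g) k = p g)"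

lemma stage_regular_const: "stage_regular n N (\<lambda>_. c)"
  unfolding stage_regular_def
proof (intro conjI allI)
  show "\<exists>M::nat. \<forall>g\<in>loop_stage n N. \<forall>k < - int M. fls_nth c k = 0"
    by (intro exI[of _ "nat (- fls_subdegree c)"]) auto
  show "\<exists>p\<in>loop_regular n. \<forall>g\<in>loop_stage n N. fls_nth c k = p g" for k
    by (intro bexI[of _ "\<lambda>_. fls_nth c k"] loop_regular.const) auto
qed

lemma stage_regular_entry:
  assumes "i < n" "j < n"
  shows "stage_regular n N (\<lambda>g. g $$ (i, j))"
  unfolding stage_regular_def
proof (intro conjI allI)
  show "\<exists>M::nat. \<forall>g\<in>loop_stage n N. \<forall>k < - int M. fls_nth (g $$ (i, j)) k = 0"
    using assms by (intro exI[of _ N]) (auto simp: loop_stage_def)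
  show "\<exists>p\<in>loop_regular n. \<forall>g\<in>loop_stage n N. fls_nth (g $$ (i, j)) k = p g" for k
    using loop_regular.coeff[OF assms, of k] by (intro bexI[of _ "\<lambda>g. fls_nth (g $$ (i, j)) k"]) auto
qed

lemma stage_regular_add:
  assumes "stage_regular n N F" "stage_regular n N G"
  shows "stage_regular n N (\<lambda>g. F g + G g)"
  unfolding stage_regular_def
proof (intro conjI allI)
  obtain M M' :: nat where "\<forall>g\<in>loop_stage n N. \<forall>k < - int M. fls_nth (F g) k = 0"
    "\<forall>g\<in>loop_stage n N. \<forall>k < - int M'. fls_nth (G g) k = 0"
    using assms by (auto simp: stage_regular_def)
  then show "\<exists>M::nat. \<forall>g\<in>loop_stage n N. \<forall>k < - int M. fls_nth (F g + G g) k = 0"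
    by (intro exI[of _ "max M M'"]) auto
  fix k
  obtain p q where "p \<in> loop_regular n" "\<forall>g\<in>loop_stage n N. fls_nth (F g) k = p g"
    "q \<in> loop_regular n" "\<forall>g\<in>loop_stage n N. fls_nth (G g) k = q g"
    using assms unfolding stage_regular_def by meson
  then show "\<exists>p\<in>loop_regular n. \<forall>g\<in>loop_stage n N. fls_nth (F g + G g) k = p g"
    by (intro bexI[of _ "\<lambda>g. p g + q g"] loop_regular.add) auto
qed

lemma stage_regular_mult:
  assumes "stage_regular n N F" "stage_regular n N G"
  shows "stage_regular n N (\<lambda>g. F g * G g)"
  unfolding stage_regular_def
proof (intro conjI allI)
  obtain M M' :: nat where M: "\<And>g k. g \<in> loop_stage n N \<Longrightarrow> k < - int M \<Longrightarrow> fls_nth (F g) k = 0"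
    "\<And>g k. g \<in> loop_stage n N \<Longrightarrow> k < - int M' \<Longrightarrow> fls_nth (G g) k = 0"
    using assms unfolding stage_regular_def by blast
  show "\<exists>M::nat. \<forall>g\<in>loop_stage n N. \<forall>k < - int M. fls_nth (F g * G g) k = 0"
  proof (intro exI[of _ "M + M'"] ballI allI impI)
    fix g k assume g: "g \<in> loop_stage n N" and k: "k < - int (M + M')"
    show "fls_nth (F g * G g) k = 0"
    proof (rule fls_mult_nth_eq_0)
      fix a b assume "a + b = k"
      then have "a < - int M \<or> b < - int M'" using k by auto
      then show "fls_nth (F g) a = 0 \<or> fls_nth (G g) b = 0" using M g by blast
    qed
  qed
  fix k
  have "\<forall>k. \<exists>p. p \<in> loop_regular n \<and> (\<forall>g\<in>loop_stage n N. fls_nth (F g) k = p g)"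
    "\<forall>k. \<exists>p. p \<in> loop_regular n \<and> (\<forall>g\<in>loop_stage n N. fls_nth (G g) k = p g)"
    using assms unfolding stage_regular_def by blast+
  then obtain p q where p: "\<And>k. p k \<in> loop_regular n" "\<And>k g. g\<in>loop_stage n N \<Longrightarrow> fls_nth (F g) k = p k g"
    and q: "\<And>k. q k \<in> loop_regular n" "\<And>k g. g\<in>loop_stage n N \<Longrightarrow> fls_nth (G g) k = q k g"
    unfolding choice_iff by blast
  have reg: "(\<lambda>g. \<Sum>i=- int M..k - (- int M'). p i g * q (k - i) g) \<in> loop_regular n"
    by (intro loop_regular_sum loop_regular.mult p q) auto
  have "fls_nth (F g * G g) k = (\<Sum>i=- int M..k - (- int M'). p i g * q (k - i) g)"
    if g: "g \<in> loop_stage n N" for g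
    using fls_mult_nth_window[of "- int M" "F g" "- int M'" "G g" k] M[OF g] p(2)[OF g] q(2)[OF g] by simp
  then show "\<exists>p\<in>loop_regular n. \<forall>g\<in>loop_stage n N. fls_nth (F g * G g) k = p g"
    by (intro bexI[OF _ reg] ballI)
qed

lemma stage_regular_sum:
  "finite S \<Longrightarrow> (\<And>x. x \<in> S \<Longrightarrow> stage_regular n N (F x)) \<Longrightarrow> stage_regular n N (\<lambda>g. \<Sum>x\<in>S. F x g)"
  by (induction S rule: finite_induct) (simp_all add: stage_regular_const stage_regular_add)

lemma stage_regular_prod:
  "finite S \<Longrightarrow> (\<And>x. x \<in> S \<Longrightarrow> stage_regular n N (F x)) \<Longrightarrow> stage_regular n N (\<lambda>g. \<Prod>x\<in>S. F x g)"
  by (induction S rule: finite_induct) (simp_all add: stage_regular_const stage_regular_mult)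

lemma stage_regular_cong:
  "(\<And>g. g \<in> loop_stage n N \<Longrightarrow> F g = G g) \<Longrightarrow> stage_regular n N G \<Longrightarrow> stage_regular n N F"
  by (simp add: stage_regular_def)

lemma stage_regular_det:
  assumes "\<And>g. g \<in> loop_stage n N \<Longrightarrow> A g \<in> carrier_mat m m"
    and reg: "\<And>i j. i < m \<Longrightarrow> j < m \<Longrightarrow> stage_regular n N (\<lambda>g. A g $$ (i, j))"
  shows "stage_regular n N (\<lambda>g. det (A g))"
proof (rule stage_regular_cong[OF det_def'[OF assms(1)]])
  show "stage_regular n N (\<lambda>g. \<Sum>p | p permutes {0..<m}. of_int (sign p) * (\<Prod>i = 0..<m. A g $$ (i, p i)))"
  proof (intro stage_regular_sum stage_regular_mult stage_regular_const stage_regular_prod)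
    fix p i assume "p \<in> {p. p permutes {0..<m}}" "i \<in> {0..<m}"
    then have "i < m" "p i < m" using permutes_in_image[of p "{0..<m}" i] by auto
    then show "stage_regular n N (\<lambda>g. A g $$ (i, p i))" by (rule reg)
  qed (auto intro: finite_permutations)
qed

lemma loop_stage_SL: "g \<in> loop_stage n N \<Longrightarrow> g \<in> carrier (SLF n)"
  by (simp add: loop_stage_def)

lemma stage_regular_inverse:
  assumes ij: "i < n" "j < n"
  shows "stage_regular n N (\<lambda>g. (inv\<^bsub>SLF n\<^esub> g) $$ (i, j))"
proof (rule stage_regular_cong)
  show "(inv\<^bsub>SLF n\<^esub> g) $$ (i, j) = (- 1) ^ (j + i) * det (mat_delete g j i)" if "g \<in> loop_stage n N" for g
    using loop_stage_SL[OF that] ij SL_D[OF loop_stage_SL[OF that]] by (simp add: inv_SL adj_mat_def cofactor_def)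
  show "stage_regular n N (\<lambda>g. (- 1) ^ (j + i) * det (mat_delete g j i))"
  proof (intro stage_regular_mult stage_regular_const stage_regular_det)
    show "mat_delete g j i \<in> carrier_mat (n - 1) (n - 1)" if "g \<in> loop_stage n N" for g
      using SL_D[OF loop_stage_SL[OF that]] by (rule mat_delete_carrier)
    fix a b assume ab: "a < n - 1" "b < n - 1"
    show "stage_regular n N (\<lambda>g. mat_delete g j i $$ (a, b))"
    proof (rule stage_regular_cong)
      show "mat_delete g j i $$ (a, b) = g $$ (if a < j then a else Suc a, if b < i then b else Suc b)"
        if "g \<in> loop_stage n N" for g
        using SL_D[OF loop_stage_SL[OF that]] ab by (auto simp: mat_delete_def)
      show "stage_regular n N (\<lambda>g. g $$ (if a < j then a else Suc a, if b < i then b else Suc b))"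
        using ab by (intro stage_regular_entry) auto
    qed
  qed
qed

text \<open>
  The inverse of a bounded loop has poles of order at most one, and the pole order of the inverse
  of such a matrix is bounded.
\<close>

lemma bounded_loops_stage:
  shows "\<exists>M. bounded_loops n \<subseteq> loop_stage n M"
proof -
  have "\<forall>i j. \<exists>M::nat. i < n \<longrightarrow> j < n \<longrightarrow>
      (\<forall>g\<in>loop_stage n 1. \<forall>k < - int M. fls_nth ((inv\<^bsub>SLF n\<^esub> g) $$ (i, j)) k = 0)"
    using stage_regular_inverse[where N = 1] unfolding stage_regular_def by blast
  then obtain M :: "nat \<Rightarrow> nat \<Rightarrow> nat" where M: "\<And>i j g k. i < n \<Longrightarrow> j < n \<Longrightarrow> g \<in> loop_stage n 1 \<Longrightarrow>
      k < - int (M i j) \<Longrightarrow> fls_nth ((inv\<^bsub>SLF n\<^esub> g) $$ (i, j)) k = 0"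
    unfolding choice_iff by blast
  let ?M = "Max ((\<lambda>(i, j). M i j) ` ({..<n} \<times> {..<n}))"
  have le: "M i j \<le> ?M" if "i < n" "j < n" for i j
    using that by (intro Max_ge) auto
  have "g \<in> loop_stage n ?M" if g: "g \<in> bounded_loops n" for g
  proof -
    have gS: "g \<in> carrier (SLF n)" using g by (simp add: bounded_loops_def)
    let ?h = "inv\<^bsub>SLF n\<^esub> g"
    have "?h \<in> loop_stage n 1"
      unfolding loop_stage_def mem_Collect_eq
    proof (intro conjI allI impI)
      show "?h \<in> carrier (SLF n)" using gS by (rule inv_SL_closed)
      fix i j k assume ij: "i < n" "j < n" and k: "k < - int 1"
      have "int n * k \<le> int n * (- 2)" using k by (intro mult_left_mono) auto
      then have "int n * k - int i < 2 - 2 * int n" by linarith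
      then show "fls_nth (?h $$ (i, j)) k = 0"
        using g ij by (simp only: bounded_loops_def pole_bounded_def mem_Collect_eq)
    qed
    then have "fls_nth ((inv\<^bsub>SLF n\<^esub> ?h) $$ (i, j)) k = 0" if "i < n" "j < n" "k < - int ?M" for i j k
      using M[of i j ?h k] le[OF that(1,2)] that by auto
    then show ?thesis
      using gS group.inv_inv[OF group_SL gS] by (simp add: loop_stage_def)
  qed
  then show ?thesis by blast
qed

text \<open>
  Closed sets of the quotient are detected on the stages of the loop group.
\<close>

lemma closedin_flag_iff:
  "closedin (affine_flag_topology n) C \<longleftrightarrow> C \<subseteq> affine_flags n \<and>
     (\<forall>N. \<exists>P \<subseteq> loop_regular n. {g \<in> loop_stage n N. flag_point n g \<in> C} = loop_zeros n N P)"
proof -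
  have "loop_stage n N - {g \<in> carrier (SLF n). flag_point n g \<in> affine_flags n - C} =
      {g \<in> loop_stage n N. flag_point n g \<in> C}" for N
    by (auto simp: loop_stage_def affine_flags_eq)
  then show ?thesis
    unfolding closedin_def topspace_affine_flag_topology openin_affine_flag_topology
      openin_loop_topology loop_open_def by auto
qed

text \<open>
  The defining conditions are the vanishing of coefficients of the inverse, hence of regular
  functions on each stage.
\<close>

lemma bounded_flags_closed:
  "closedin (affine_flag_topology n) (flag_point n ` bounded_loops n)"
  unfolding closedin_flag_iff
proof (intro conjI allI)
  show "flag_point n ` bounded_loops n \<subseteq> affine_flags n"
    by (auto simp: bounded_loops_def affine_flags_eq)
  fix N
  have mem: "flag_point n g \<in> flag_point n ` bounded_loops n \<longleftrightarrow> g \<in> bounded_loops n"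
    if g: "g \<in> carrier (SLF n)" for g
  proof
    assume "flag_point n g \<in> flag_point n ` bounded_loops n"
    then obtain h where h: "h \<in> bounded_loops n" "flag_point n h = flag_point n g" by auto
    have hS: "h \<in> carrier (SLF n)" using h by (simp add: bounded_loops_def)
    have "inv\<^bsub>SLF n\<^esub> h * g \<in> iwahori n" using h(2) flag_point_eq_iff[OF hS g] by simp
    then have "h * (inv\<^bsub>SLF n\<^esub> h * g) \<in> bounded_loops n" by (intro bounded_loops_mult h(1))
    then show "g \<in> bounded_loops n" using hS g by (simp add: SL_cancel)
  qed simp
  \<comment> \<open>The full ideal of the set, so that only its zeros have to be determined.\<close>
  define P where "P = {p \<in> loop_regular n. \<forall>g \<in> loop_stage n N \<inter> bounded_loops n. p g = 0}"
  have "loop_zeros n N P \<subseteq> bounded_loops n"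
  proof
    fix g assume g: "g \<in> loop_zeros n N P"
    then have gN: "g \<in> loop_stage n N" and zero: "\<And>p. p \<in> P \<Longrightarrow> p g = 0" by (auto simp: mem_loop_zeros)
    have gS: "g \<in> carrier (SLF n)" by (rule loop_stage_SL[OF gN])
    have "fls_nth ((inv\<^bsub>SLF n\<^esub> g) $$ (i, j)) k = 0"
      if ij: "i < n" "j < n" and k: "int n * k - int i < 2 - 2 * int n" for i j k
    proof -
      obtain p where p: "p \<in> loop_regular n"
        "\<And>g. g \<in> loop_stage n N \<Longrightarrow> fls_nth ((inv\<^bsub>SLF n\<^esub> g) $$ (i, j)) k = p g"
        using stage_regular_inverse[OF ij, of N] unfolding stage_regular_def by blast
      have "p h = 0" if h: "h \<in> loop_stage n N \<inter> bounded_loops n" for h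
      proof -
        have "fls_nth ((inv\<^bsub>SLF n\<^esub> h) $$ (i, j)) k = 0"
          using h ij k by (simp only: Int_iff bounded_loops_def pole_bounded_def mem_Collect_eq)
        then show ?thesis using p(2) h by simp
      qed
      then have "p \<in> P" using p(1) by (simp add: P_def)
      then show ?thesis using zero p(2)[OF gN] by simp
    qed
    then show "g \<in> bounded_loops n"
      using gS inv_SL_closed[OF gS] by (simp add: bounded_loops_def pole_bounded_def carrier_SL)
  qed
  then have "{g \<in> loop_stage n N. g \<in> bounded_loops n} = loop_zeros n N P"
    by (auto simp: mem_loop_zeros P_def)
  moreover have "{g \<in> loop_stage n N. flag_point n g \<in> flag_point n ` bounded_loops n} =
      {g \<in> loop_stage n N. g \<in> bounded_loops n}"
    using mem[OF loop_stage_SL] by (intro Collect_cong conj_cong refl)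
  ultimately have "{g \<in> loop_stage n N. flag_point n g \<in> flag_point n ` bounded_loops n} = loop_zeros n N P"
    by simp
  moreover have "P \<subseteq> loop_regular n" by (auto simp: P_def)
  ultimately show "\<exists>P\<subseteq>loop_regular n.
      {g \<in> loop_stage n N. flag_point n g \<in> flag_point n ` bounded_loops n} = loop_zeros n N P" by blast
qed

section \<open>Translations and closures\<close>

lemma const_loop_mult_nth:
  assumes a: "a \<in> carrier_mat n n" and g: "g \<in> carrier_mat n n" and ij: "i < n" "j < n"
  shows "fls_nth ((const_loop a * g) $$ (i, j)) k = (\<Sum>l<n. a $$ (i, l) * fls_nth (g $$ (l, j)) k)"
proof -
  have "(const_loop a * g) $$ (i, j) = (\<Sum>l<n. const_loop a $$ (i, l) * g $$ (l, j))"
    using a g ij by (intro mat_mult_index) auto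
  also have "\<dots> = (\<Sum>l<n. fls_const (a $$ (i, l)) * g $$ (l, j))"
    using a ij by (intro sum.cong refl) (auto simp: const_loop_def)
  finally show ?thesis by (simp add: fls_nth_sum)
qed

lemma const_loop_stage:
  assumes a: "a \<in> carrier (SLK n)" and g: "g \<in> loop_stage n N"
  shows "const_loop a * g \<in> loop_stage n N"
  using g const_loop_mult_nth[OF SL_D[OF a] SL_D[OF loop_stage_SL[OF g]]] a
  by (auto simp: loop_stage_def intro!: mult_in_SL sum.neutral)

lemma loop_regular_translate:
  assumes a: "a \<in> carrier (SLK n)" and "p \<in> loop_regular n"
  shows "\<exists>q\<in>loop_regular n. \<forall>g\<in>carrier (SLF n). q g = p (const_loop a * g)"
  using assms(2)
proof (induction p rule: loop_regular.induct)
  case (const c)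
  then show ?case by (intro bexI[of _ "\<lambda>_. c"] loop_regular.const) auto
next
  case (coeff i j k)
  have "(\<lambda>g. \<Sum>l<n. a $$ (i, l) * fls_nth (g $$ (l, j)) k) \<in> loop_regular n"
    using coeff by (intro loop_regular_sum loop_regular.mult loop_regular.const loop_regular.coeff) auto
  then show ?case
    by (rule bexI[rotated]) (use const_loop_mult_nth[OF SL_D[OF a] SL_D coeff] in auto)
next
  case (add p q)
  then obtain p' q' where "p' \<in> loop_regular n" "\<forall>g\<in>carrier (SLF n). p' g = p (const_loop a * g)"
    "q' \<in> loop_regular n" "\<forall>g\<in>carrier (SLF n). q' g = q (const_loop a * g)" by blast
  then show ?case by (intro bexI[of _ "\<lambda>g. p' g + q' g"] loop_regular.add) auto
next
  case (mult p q)
  then obtain p' q' where "p' \<in> loop_regular n" "\<forall>g\<in>carrier (SLF n). p' g = p (const_loop a * g)"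
    "q' \<in> loop_regular n" "\<forall>g\<in>carrier (SLF n). q' g = q (const_loop a * g)" by blast
  then show ?case by (intro bexI[of _ "\<lambda>g. p' g * q' g"] loop_regular.mult) auto
qed

text \<open>
  Left translation by a constant matrix preserves the stages and pulls regular functions back to
  regular ones.
\<close>

lemma closedin_translate:
  assumes a: "a \<in> carrier (SLK n)" and C: "closedin (affine_flag_topology n) C"
  shows "closedin (affine_flag_topology n) {x \<in> affine_flags n. const_loop a <#\<^bsub>SLF n\<^esub> x \<in> C}"
  unfolding closedin_flag_iff
proof (intro conjI allI)
  fix N
  obtain P where P: "P \<subseteq> loop_regular n" "{g \<in> loop_stage n N. flag_point n g \<in> C} = loop_zeros n N P"
    using C unfolding closedin_flag_iff by blast
  define Q where "Q = {q \<in> loop_regular n. \<exists>p\<in>P. \<forall>g\<in>carrier (SLF n). q g = p (const_loop a * g)}"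
  have aS: "const_loop a \<in> carrier (SLF n)" using a by simp
  have "g \<in> {g \<in> loop_stage n N. flag_point n g \<in> {x \<in> affine_flags n. const_loop a <#\<^bsub>SLF n\<^esub> x \<in> C}} \<longleftrightarrow>
      g \<in> loop_zeros n N Q" for g
  proof (cases "g \<in> loop_stage n N")
    case True
    have gS: "g \<in> carrier (SLF n)" by (rule loop_stage_SL[OF True])
    have "const_loop a <#\<^bsub>SLF n\<^esub> flag_point n g \<in> C \<longleftrightarrow> const_loop a * g \<in> loop_zeros n N P"
      using const_loop_stage[OF a True] unfolding P(2)[symmetric] l_coset_flag_point[OF aS gS] by simp
    also have "\<dots> \<longleftrightarrow> (\<forall>p\<in>P. p (const_loop a * g) = 0)"
      using const_loop_stage[OF a True] by (simp add: mem_loop_zeros)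
    also have "\<dots> \<longleftrightarrow> (\<forall>q\<in>Q. q g = 0)"
    proof
      assume zero: "\<forall>q\<in>Q. q g = 0"
      show "\<forall>p\<in>P. p (const_loop a * g) = 0"
      proof
        fix p assume p: "p \<in> P"
        then have "p \<in> loop_regular n" using P(1) by blast
        from loop_regular_translate[OF a this] obtain q where
          q: "q \<in> loop_regular n" "\<forall>g\<in>carrier (SLF n). q g = p (const_loop a * g)" by blast
        then have "q \<in> Q" using p by (auto simp: Q_def)
        then show "p (const_loop a * g) = 0" using zero q(2) gS by auto
      qed
    qed (use gS in \<open>auto simp: Q_def\<close>)
    finally show ?thesis using True gS by (auto simp: mem_loop_zeros affine_flags_eq)
  qed (simp add: mem_loop_zeros)
  then have "{g \<in> loop_stage n N. flag_point n g \<in> {x \<in> affine_flags n. const_loop a <#\<^bsub>SLF n\<^esub> x \<in> C}} =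
      loop_zeros n N Q" by (rule Set.set_eqI)
  moreover have "Q \<subseteq> loop_regular n" by (auto simp: Q_def)
  ultimately show "\<exists>P\<subseteq>loop_regular n.
      {g \<in> loop_stage n N. flag_point n g \<in> {x \<in> affine_flags n. const_loop a <#\<^bsub>SLF n\<^esub> x \<in> C}} = loop_zeros n N P"
    by blast
qed auto

lemma G_stable_closure:
  assumes S: "S \<subseteq> affine_flags n" "G_stable n S"
  shows "G_stable n (affine_flag_topology n closure_of S)"
  unfolding G_stable_def
proof (intro ballI)
  fix a x assume a: "a \<in> carrier (SLK n)" and x: "x \<in> affine_flag_topology n closure_of S"
  let ?C = "{x \<in> affine_flags n. const_loop a <#\<^bsub>SLF n\<^esub> x \<in> affine_flag_topology n closure_of S}"
  have "S \<subseteq> affine_flag_topology n closure_of S"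
    using S(1) by (simp add: closure_of_subset topspace_affine_flag_topology)
  then have "S \<subseteq> ?C" using S a by (auto simp: G_stable_def)
  then have "affine_flag_topology n closure_of S \<subseteq> ?C"
    by (rule closure_of_minimal) (intro closedin_translate[OF a] closedin_closure_of)
  then show "const_loop a <#\<^bsub>SLF n\<^esub> x \<in> affine_flag_topology n closure_of S" using x by blast
qed

lemma irreducible_closure:
  assumes "irreducible_in X S"
  shows "irreducible_in X (X closure_of S)"
  unfolding irreducible_in_def
proof (intro conjI allI impI)
  have S: "S \<subseteq> topspace X" "S \<noteq> {}" using assms by (auto simp: irreducible_in_def)
  have sub: "S \<subseteq> X closure_of S" using S(1) by (rule closure_of_subset)
  then show "X closure_of S \<noteq> {}" using S(2) by blast
  show "X closure_of S \<subseteq> topspace X" by (rule closure_of_subset_topspace)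
  fix C D assume CD: "closedin X C" "closedin X D" "X closure_of S \<subseteq> C \<union> D"
  then have "S \<subseteq> C \<or> S \<subseteq> D" using assms sub unfolding irreducible_in_def by blast
  then show "X closure_of S \<subseteq> C \<or> X closure_of S \<subseteq> D"
    using CD closure_of_minimal by blast
qed

section \<open>The map \<open>\<phi>\<close>\<close>

lemma square_mat_eqI:
  "A \<in> carrier_mat n n \<Longrightarrow> B \<in> carrier_mat n n \<Longrightarrow>
    (\<And>i j. i < n \<Longrightarrow> j < n \<Longrightarrow> A $$ (i, j) = B $$ (i, j)) \<Longrightarrow> A = B"
  by (rule eq_matI) auto

lemma borel_SL: "b \<in> borel n \<Longrightarrow> b \<in> carrier (SLK n)"
  by (simp add: borel_def)

lemma const_loop_nth:
  "a \<in> carrier_mat n n \<Longrightarrow> i < n \<Longrightarrow> j < n \<Longrightarrow> fls_nth (const_loop a $$ (i, j)) k = (if k = 0 then a $$ (i, j) else 0)"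
  by (simp add: const_loop_def)

lemma const_loop_iwahori: "const_loop b \<in> iwahori n \<longleftrightarrow> b \<in> borel n"
proof
  assume b: "const_loop b \<in> iwahori n"
  then have bS: "b \<in> carrier (SLK n)" using iwahori_SL by fastforce
  have "b $$ (i, j) = 0" if "j < i" "i < n" for i j
    using iwahori_nth[OF b, of i j 0] const_loop_nth[OF SL_D[OF bS], of i j 0] that by simp
  then show "b \<in> borel n" using bS SL_D[OF bS] by (auto simp: borel_def)
next
  assume b: "b \<in> borel n"
  have bS: "b \<in> carrier (SLK n)" by (rule borel_SL[OF b])
  show "const_loop b \<in> iwahori n"
    unfolding iwahori_iff
  proof (intro conjI allI impI)
    show "const_loop b \<in> carrier (SLF n)" using bS by simp
    fix i j k assume ij: "i < n" "j < n" and k: "int n * k + int j - int i < 0"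
    have "b $$ (i, j) = 0" if "k = 0"
      using b ij k that SL_D[OF bS] by (auto simp: borel_def intro: upper_triangularD)
    then show "fls_nth (const_loop b $$ (i, j)) k = 0"
      unfolding const_loop_nth[OF SL_D[OF bS] ij] by simp
  qed
qed

lemma const_loop_inv:
  assumes "g \<in> carrier (SLK n)"
  shows "inv\<^bsub>SLF n\<^esub> (const_loop g) = const_loop (inv\<^bsub>SLK n\<^esub> g)"
proof (rule inv_SL_eq)
  have "const_loop g * const_loop (inv\<^bsub>SLK n\<^esub> g) = const_loop (g * inv\<^bsub>SLK n\<^esub> g)"
    using SL_D[OF assms] SL_D[OF inv_SL_closed[OF assms]] by (rule const_loop_mult[symmetric])
  also have "\<dots> = 1\<^sub>m n"
    unfolding inv_SL_mult(1)[OF assms] by (rule eq_matI) (auto simp: const_loop_def)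
  finally show "const_loop g * const_loop (inv\<^bsub>SLK n\<^esub> g) = 1\<^sub>m n" .
qed (use assms inv_SL_closed[OF assms] in auto)

lemma borel_inv: "b \<in> borel n \<Longrightarrow> inv\<^bsub>SLK n\<^esub> b \<in> borel n"
  using iwahori_inverse[of "const_loop b" n] const_loop_inv[OF borel_SL, of b n]
  by (simp add: const_loop_iwahori)

lemma nilradical_carrier: "Y \<in> borel_nilradical n \<Longrightarrow> Y \<in> carrier_mat n n"
  by (simp add: borel_nilradical_def)

lemma borel_nilradical_mult:
  assumes b: "b \<in> borel n" and Y: "Y \<in> borel_nilradical n"
  shows "b * Y \<in> borel_nilradical n" "Y * b \<in> borel_nilradical n"
proof -
  have C: "b \<in> carrier_mat n n" "Y \<in> carrier_mat n n"
    using SL_D[OF borel_SL[OF b]] nilradical_carrier[OF Y] by auto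
  have b0: "b $$ (i, j) = 0" if "i < n" "j < i" for i j
    using b that C by (auto simp: borel_def intro: upper_triangularD)
  have Y0: "Y $$ (i, j) = 0" if "i < n" "j \<le> i" for i j
    using Y that by (simp add: borel_nilradical_def)
  have "(b * Y) $$ (i, j) = 0" "(Y * b) $$ (i, j) = 0" if i: "i < n" and j: "j \<le> i" for i j
  proof -
    have jn: "j < n" using i j by simp
    have "b $$ (i, l) * Y $$ (l, j) = 0" if "l < n" for l
      using b0[OF i, of l] Y0[OF that, of j] j by (cases "l < i") auto
    then show "(b * Y) $$ (i, j) = 0" unfolding mat_mult_index[OF C i jn] by (intro sum.neutral) auto
    have "Y $$ (i, l) * b $$ (l, j) = 0" if "l < n" for l
      using Y0[OF i, of l] b0[OF that, of j] j by (cases "l \<le> i") auto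
    then show "(Y * b) $$ (i, j) = 0" unfolding mat_mult_index[OF C(2,1) i jn] by (intro sum.neutral) auto
  qed
  then show "b * Y \<in> borel_nilradical n" "Y * b \<in> borel_nilradical n"
    using C by (simp_all add: borel_nilradical_def)
qed

text \<open>
  Each factor \<open>Y\<close> raises the distance from the diagonal by one; in particular \<open>Y\<^sup>n = 0\<close>.
\<close>

lemma nilradical_power:
  assumes Y: "Y \<in> borel_nilradical n"
  shows "i < n \<Longrightarrow> j < n \<Longrightarrow> j < i + k \<Longrightarrow> (Y ^\<^sub>m k) $$ (i, j) = 0"
proof (induction k arbitrary: j)
  case 0
  then show ?case using nilradical_carrier[OF Y] by simp
next
  case (Suc k)
  note C = nilradical_carrier[OF Y]
  have "(Y ^\<^sub>m k) $$ (i, l) * Y $$ (l, j) = 0" if l: "l < n" for l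
  proof (cases "l < i + k")
    case True
    then show ?thesis using Suc.IH[OF Suc.prems(1) l] by simp
  next
    case False
    then have "j \<le> l" using Suc.prems by simp
    then show ?thesis using Y l by (simp add: borel_nilradical_def)
  qed
  then show ?case
    unfolding pow_mat.simps(2) mat_mult_index[OF pow_carrier_mat[OF C] C Suc.prems(1,2)]
    by (intro sum.neutral) auto
qed

text \<open>
  The matrix \<open>1 - t\<^sup>-\<^sup>1 Y\<close>, the inverse of \<open>geometric_sum n Y\<close>.
\<close>

definition one_minus_tinv :: "nat \<Rightarrow> complex mat \<Rightarrow> complex fls mat" where
  "one_minus_tinv n Y =
     mat n n (\<lambda>(i, j). (if i = j then 1 else 0) - fls_const (Y $$ (i, j)) * fls_X_intpow (- 1))"

lemma one_minus_tinv_carrier [simp]: "one_minus_tinv n Y \<in> carrier_mat n n"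
  by (simp add: one_minus_tinv_def)

lemma mult_const_X_nth:
  "fls_nth (u * (fls_const y * fls_X_intpow (- 1))) k = fls_nth u (k + 1) * (y :: complex)"
proof -
  have "u * (fls_const y * fls_X_intpow (- 1)) = fls_X_intpow (- 1) * (u * fls_const y)" by (simp add: mult_ac)
  also have "\<dots> = fls_shift (- (- 1)) (u * fls_const y)" by (rule fls_X_intpow_times_conv_shift(1))
  finally show ?thesis by simp
qed

lemma mult_one_minus_tinv_nth:
  assumes A: "A \<in> carrier_mat n n" and ij: "i < n" "j < n"
  shows "fls_nth ((A * one_minus_tinv n Y) $$ (i, j)) k =
    fls_nth (A $$ (i, j)) k - (\<Sum>l<n. fls_nth (A $$ (i, l)) (k + 1) * Y $$ (l, j))"
proof -
  have "fls_nth (A $$ (i, l) * one_minus_tinv n Y $$ (l, j)) k =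
      (if l = j then fls_nth (A $$ (i, j)) k else 0) - fls_nth (A $$ (i, l)) (k + 1) * Y $$ (l, j)" if "l < n" for l
  proof -
    have "one_minus_tinv n Y $$ (l, j) = (if l = j then 1 else 0) - fls_const (Y $$ (l, j)) * fls_X_intpow (- 1)"
      using that ij by (simp add: one_minus_tinv_def)
    then show ?thesis
      using mult_const_X_nth[of "A $$ (i, l)" "Y $$ (l, j)" k] by (auto simp: right_diff_distrib)
  qed
  then have "fls_nth ((A * one_minus_tinv n Y) $$ (i, j)) k =
      (\<Sum>l<n. (if l = j then fls_nth (A $$ (i, j)) k else 0) - fls_nth (A $$ (i, l)) (k + 1) * Y $$ (l, j))"
    unfolding mat_mult_index[OF A one_minus_tinv_carrier ij] fls_nth_sum by (intro sum.cong) auto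
  then show ?thesis using ij by (simp add: sum_subtractf)
qed

lemma one_minus_tinv_mult_nth:
  assumes A: "A \<in> carrier_mat n n" and ij: "i < n" "j < n"
  shows "fls_nth ((one_minus_tinv n Y * A) $$ (i, j)) k =
    fls_nth (A $$ (i, j)) k - (\<Sum>l<n. Y $$ (i, l) * fls_nth (A $$ (l, j)) (k + 1))"
proof -
  have "fls_nth (one_minus_tinv n Y $$ (i, l) * A $$ (l, j)) k =
      (if l = i then fls_nth (A $$ (i, j)) k else 0) - Y $$ (i, l) * fls_nth (A $$ (l, j)) (k + 1)" if "l < n" for l
  proof -
    define a y where "a = A $$ (l, j)" and "y = Y $$ (i, l)"
    have "one_minus_tinv n Y $$ (i, l) = (if i = l then 1 else 0) - fls_const y * fls_X_intpow (- 1)"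
      using that ij by (simp add: one_minus_tinv_def y_def)
    then have "one_minus_tinv n Y $$ (i, l) * a = (if i = l then a else 0) - a * (fls_const y * fls_X_intpow (- 1))"
      by (simp only: mult.commute[of _ a] right_diff_distrib) simp
    then have "fls_nth (one_minus_tinv n Y $$ (i, l) * a) k = fls_nth (if i = l then a else 0) k - fls_nth a (k + 1) * y"
      by (simp only: fls_minus_nth mult_const_X_nth)
    then show ?thesis by (auto simp: a_def y_def)
  qed
  then have "fls_nth ((one_minus_tinv n Y * A) $$ (i, j)) k =
      (\<Sum>l<n. (if l = i then fls_nth (A $$ (i, j)) k else 0) - Y $$ (i, l) * fls_nth (A $$ (l, j)) (k + 1))"
    unfolding mat_mult_index[OF one_minus_tinv_carrier A ij] fls_nth_sum by (intro sum.cong) auto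
  then show ?thesis using ij by (simp add: sum_subtractf)
qed

lemma geometric_sum_carrier [simp]: "geometric_sum n Y \<in> carrier_mat n n"
  by (simp add: geometric_sum_def)

lemma geometric_sum_nth:
  assumes "i < n" "j < n"
  shows "fls_nth (geometric_sum n Y $$ (i, j)) k =
    (if - int n < k \<and> k \<le> 0 then (Y ^\<^sub>m nat (- k)) $$ (i, j) else 0)"
proof -
  have "fls_nth (geometric_sum n Y $$ (i, j)) k =
      (\<Sum>m<n. fls_nth (fls_const ((Y ^\<^sub>m m) $$ (i, j)) * fls_X_intpow (- int m)) k)"
    using assms by (simp add: geometric_sum_def fls_nth_sum mult.commute)
  also have "\<dots> = (\<Sum>m<n. if k = - int m then (Y ^\<^sub>m m) $$ (i, j) else 0)"
    unfolding const_X_intpow_nth ..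
  also have "\<dots> = (\<Sum>m<n. if m = nat (- k) \<and> k \<le> 0 then (Y ^\<^sub>m m) $$ (i, j) else 0)"
    by (intro sum.cong refl) auto
  also have "\<dots> = (if - int n < k \<and> k \<le> 0 then (Y ^\<^sub>m nat (- k)) $$ (i, j) else 0)"
  proof (cases "k \<le> 0")
    case True
    then have "nat (- k) < n \<longleftrightarrow> - int n < k" by auto
    then show ?thesis using True by (simp add: sum.delta)
  qed simp
  finally show ?thesis .
qed

lemma one_minus_tinv_SL:
  assumes Y: "Y \<in> borel_nilradical n"
  shows "one_minus_tinv n Y \<in> carrier (SLF n)"
proof -
  have ut: "upper_triangular (one_minus_tinv n Y)"
    using Y by (auto simp: one_minus_tinv_def borel_nilradical_def)
  have "diag_mat (one_minus_tinv n Y) = map (\<lambda>_. 1) [0..<n]"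
    using Y by (auto simp: diag_mat_def one_minus_tinv_def borel_nilradical_def)
  then have "det (one_minus_tinv n Y) = 1"
    using det_upper_triangular[OF ut one_minus_tinv_carrier] by (simp add: map_replicate_const)
  then show ?thesis by (simp add: carrier_SL)
qed

lemma geometric_sum_inverse:
  assumes Y: "Y \<in> borel_nilradical n"
  shows "geometric_sum n Y * one_minus_tinv n Y = 1\<^sub>m n"
proof (rule eq_matI)
  fix i j assume "i < dim_row (1\<^sub>m n :: complex fls mat)" "j < dim_col (1\<^sub>m n :: complex fls mat)"
  then have ij: "i < n" "j < n" by simp_all
  note C = nilradical_carrier[OF Y]
  show "(geometric_sum n Y * one_minus_tinv n Y) $$ (i, j) = 1\<^sub>m n $$ (i, j)"
  proof (rule fls_eqI)
    fix k
    have suc: "(\<Sum>l<n. (Y ^\<^sub>m m) $$ (i, l) * Y $$ (l, j)) = (Y ^\<^sub>m Suc m) $$ (i, j)" for m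
      unfolding pow_mat.simps(2) mat_mult_index[OF pow_carrier_mat[OF C] C ij] ..
    have eq: "fls_nth ((geometric_sum n Y * one_minus_tinv n Y) $$ (i, j)) k =
        (if - int n < k \<and> k \<le> 0 then (Y ^\<^sub>m nat (- k)) $$ (i, j) else 0) -
        (if - int n < k + 1 \<and> k + 1 \<le> 0 then (Y ^\<^sub>m Suc (nat (- (k + 1)))) $$ (i, j) else 0)"
    proof (cases "- int n < k + 1 \<and> k + 1 \<le> 0")
      case True
      then show ?thesis
        unfolding mult_one_minus_tinv_nth[OF geometric_sum_carrier ij] suc[symmetric]
        using ij by (simp add: geometric_sum_nth)
    next
      case False
      then have "(\<Sum>l<n. fls_nth (geometric_sum n Y $$ (i, l)) (k + 1) * Y $$ (l, j)) = 0"
        using ij by (intro sum.neutral) (auto simp: geometric_sum_nth)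
      then show ?thesis
        unfolding mult_one_minus_tinv_nth[OF geometric_sum_carrier ij] geometric_sum_nth[OF ij] if_not_P[OF False] by simp
    qed
    consider "k > 0 \<or> k < - int n" | "k = 0" | "k = - int n" | "- int n < k" "k < 0" by linarith
    then show "fls_nth ((geometric_sum n Y * one_minus_tinv n Y) $$ (i, j)) k = fls_nth (1\<^sub>m n $$ (i, j)) k"
    proof cases
      case 1
      then show ?thesis unfolding eq using ij by auto
    next
      case 2
      then show ?thesis unfolding eq using ij C by simp
    next
      case 3
      then have "Suc (nat (- (k + 1))) = n" using ij by simp
      then show ?thesis unfolding eq using nilradical_power[OF Y ij, of n] 3 ij by simp
    next
      case 4
      then have "Suc (nat (- (k + 1))) = nat (- k)" by simp
      then show ?thesis unfolding eq using 4 ij by simp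
    qed
  qed
qed (simp_all add: geometric_sum_def one_minus_tinv_def)

lemma geometric_sum_SL:
  assumes Y: "Y \<in> borel_nilradical n"
  shows "geometric_sum n Y \<in> carrier (SLF n)"
    and "inv\<^bsub>SLF n\<^esub> (geometric_sum n Y) = one_minus_tinv n Y"
    and "inv\<^bsub>SLF n\<^esub> (one_minus_tinv n Y) = geometric_sum n Y"
proof -
  note inv = geometric_sum_inverse[OF Y]
  have "det (geometric_sum n Y) * det (one_minus_tinv n Y) = 1"
    using det_mult[OF geometric_sum_carrier one_minus_tinv_carrier, of n Y Y] inv by simp
  then show SL: "geometric_sum n Y \<in> carrier (SLF n)"
    using one_minus_tinv_SL[OF Y] by (simp add: carrier_SL)
  show "inv\<^bsub>SLF n\<^esub> (geometric_sum n Y) = one_minus_tinv n Y"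
    "inv\<^bsub>SLF n\<^esub> (one_minus_tinv n Y) = geometric_sum n Y"
    by (rule inv_SL_eq[OF inv SL one_minus_tinv_SL[OF Y]])+
qed

definition phi_loop :: "nat \<Rightarrow> complex mat \<Rightarrow> complex mat \<Rightarrow> complex fls mat" where
  "phi_loop n g Y = const_loop g * geometric_sum n Y"

lemma phi_loop_SL:
  "g \<in> carrier (SLK n) \<Longrightarrow> Y \<in> borel_nilradical n \<Longrightarrow> phi_loop n g Y \<in> carrier (SLF n)"
  unfolding phi_loop_def by (intro mult_in_SL geometric_sum_SL) auto

lemma phi_loop_inv:
  assumes "g \<in> carrier (SLK n)" "Y \<in> borel_nilradical n"
  shows "inv\<^bsub>SLF n\<^esub> (phi_loop n g Y) = one_minus_tinv n Y * const_loop (inv\<^bsub>SLK n\<^esub> g)"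
  unfolding phi_loop_def using assms
  by (simp add: inv_SL_mult_distrib geometric_sum_SL const_loop_inv)

lemma one_minus_tinv_const_nth:
  assumes c: "c \<in> carrier_mat n n" and Y: "Y \<in> carrier_mat n n" and ij: "i < n" "j < n"
  shows "fls_nth ((one_minus_tinv n Y * const_loop c) $$ (i, j)) k =
    (if k = 0 then c $$ (i, j) else 0) - (if k = - 1 then (Y * c) $$ (i, j) else 0)"
proof -
  have "(\<Sum>l<n. Y $$ (i, l) * fls_nth (const_loop c $$ (l, j)) (k + 1)) =
      (\<Sum>l<n. if k = - 1 then Y $$ (i, l) * c $$ (l, j) else 0)"
    using ij by (intro sum.cong refl) (auto simp: const_loop_nth[OF c])
  also have "\<dots> = (if k = - 1 then (Y * c) $$ (i, j) else 0)"
    unfolding mat_mult_index[OF Y c ij] by simp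
  finally have eq: "(\<Sum>l<n. Y $$ (i, l) * fls_nth (const_loop c $$ (l, j)) (k + 1)) =
    (if k = - 1 then (Y * c) $$ (i, j) else 0)" .
  have "const_loop c \<in> carrier_mat n n" using c by simp
  from one_minus_tinv_mult_nth[OF this ij, of Y k] show ?thesis unfolding eq const_loop_nth[OF c ij] .
qed

lemma const_one_minus_tinv_nth:
  assumes c: "c \<in> carrier_mat n n" and Y: "Y \<in> carrier_mat n n" and ij: "i < n" "j < n"
  shows "fls_nth ((const_loop c * one_minus_tinv n Y) $$ (i, j)) k =
    (if k = 0 then c $$ (i, j) else 0) - (if k = - 1 then (c * Y) $$ (i, j) else 0)"
proof -
  have "(\<Sum>l<n. fls_nth (const_loop c $$ (i, l)) (k + 1) * Y $$ (l, j)) =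
      (\<Sum>l<n. if k = - 1 then c $$ (i, l) * Y $$ (l, j) else 0)"
    using ij by (intro sum.cong refl) (auto simp: const_loop_nth[OF c])
  also have "\<dots> = (if k = - 1 then (c * Y) $$ (i, j) else 0)"
    unfolding mat_mult_index[OF c Y ij] by simp
  finally have eq: "(\<Sum>l<n. fls_nth (const_loop c $$ (i, l)) (k + 1) * Y $$ (l, j)) =
    (if k = - 1 then (c * Y) $$ (i, j) else 0)" .
  have "const_loop c \<in> carrier_mat n n" using c by simp
  from mult_one_minus_tinv_nth[OF this ij, of Y k] show ?thesis unfolding eq const_loop_nth[OF c ij] .
qed

text \<open>
  The inverse is \<open>(1 - t\<^sup>-\<^sup>1 Y) g\<^sup>-\<^sup>1\<close>, and the last row of \<open>Y\<close> is zero.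
\<close>

lemma phi_loop_bounded:
  assumes n: "2 \<le> n" and g: "g \<in> carrier (SLK n)" and Y: "Y \<in> borel_nilradical n"
  shows "phi_loop n g Y \<in> bounded_loops n"
proof -
  let ?c = "inv\<^bsub>SLK n\<^esub> g"
  have c: "?c \<in> carrier_mat n n" using SL_D[OF inv_SL_closed[OF g]] .
  note YC = nilradical_carrier[OF Y]
  have "one_minus_tinv n Y * const_loop ?c \<in> pole_bounded n"
    unfolding pole_bounded_def mem_Collect_eq
  proof (intro conjI allI impI)
    fix i j k assume ij: "i < n" "j < n" and k: "int n * k - int i < 2 - 2 * int n"
    have "k \<noteq> 0" using k ij n by auto
    moreover have "(Y * ?c) $$ (i, j) = 0" if "k = - 1"
    proof -
      have "i = n - 1" using k ij that by auto
      then have "Y $$ (i, l) = 0" if "l < n" for l using Y ij that by (simp add: borel_nilradical_def)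
      then show ?thesis unfolding mat_mult_index[OF YC c ij] by (intro sum.neutral) auto
    qed
    ultimately show "fls_nth ((one_minus_tinv n Y * const_loop ?c) $$ (i, j)) k = 0"
      unfolding one_minus_tinv_const_nth[OF c YC ij] by auto
  next
    show "one_minus_tinv n Y * const_loop ?c \<in> carrier_mat n n"
      using c by (intro mult_carrier_mat[where n = n]) auto
  qed
  then show ?thesis
    unfolding bounded_loops_def mem_Collect_eq phi_loop_inv[OF g Y]
    using phi_loop_SL[OF g Y] by simp
qed

text \<open>
  Both sides are compared through their inverses, which are polynomials in \<open>t\<^sup>-\<^sup>1\<close> of degree one.
\<close>

lemma phi_loop_conj:
  assumes g: "g \<in> carrier (SLK n)" and Y: "Y \<in> borel_nilradical n" and b: "b \<in> borel n"
  shows "inv\<^bsub>SLK n\<^esub> b * Y * b \<in> borel_nilradical n"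
    and "phi_loop n (g * b) (inv\<^bsub>SLK n\<^esub> b * Y * b) = phi_loop n g Y * const_loop b"
proof -
  let ?c = "inv\<^bsub>SLK n\<^esub> b" and ?Z = "inv\<^bsub>SLK n\<^esub> b * Y * b"
  have bS: "b \<in> carrier (SLK n)" by (rule borel_SL[OF b])
  have cS: "?c \<in> carrier (SLK n)" by (rule inv_SL_closed[OF bS])
  note C = SL_D[OF bS] SL_D[OF cS] nilradical_carrier[OF Y] SL_D[OF g]
  show Z: "?Z \<in> borel_nilradical n"
    by (intro borel_nilradical_mult b borel_inv Y)
  note ZC = nilradical_carrier[OF Z]
  have "?Z * ?c = ?c * Y * (b * ?c)"
    using C by (simp add: assoc_mult_mat[of _ n n _ n _ n])
  also have "\<dots> = ?c * Y" unfolding inv_SL_mult(1)[OF bS] using C by simp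
  finally have Zc: "?Z * ?c = ?c * Y" .
  have swap: "one_minus_tinv n ?Z * const_loop ?c = const_loop ?c * one_minus_tinv n Y"
  proof (rule eq_matI)
    fix i j assume "i < dim_row (const_loop ?c * one_minus_tinv n Y)" "j < dim_col (const_loop ?c * one_minus_tinv n Y)"
    then have ij: "i < n" "j < n" using C by (auto simp: const_loop_def one_minus_tinv_def)
    show "(one_minus_tinv n ?Z * const_loop ?c) $$ (i, j) = (const_loop ?c * one_minus_tinv n Y) $$ (i, j)"
      by (rule fls_eqI)
        (simp only: one_minus_tinv_const_nth[OF C(2) ZC ij] const_one_minus_tinv_nth[OF C(2,3) ij] Zc)
  qed (use C in \<open>auto simp: const_loop_def one_minus_tinv_def\<close>)
  have SLs: "phi_loop n (g * b) ?Z \<in> carrier (SLF n)" "phi_loop n g Y \<in> carrier (SLF n)"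
    "const_loop b \<in> carrier (SLF n)"
    using phi_loop_SL[OF mult_in_SL[OF g bS] Z] phi_loop_SL[OF g Y] bS by auto
  have gS: "inv\<^bsub>SLK n\<^esub> g \<in> carrier (SLK n)" by (rule inv_SL_closed[OF g])
  have "inv\<^bsub>SLF n\<^esub> (phi_loop n (g * b) ?Z) =
      one_minus_tinv n ?Z * const_loop (?c * inv\<^bsub>SLK n\<^esub> g)"
    unfolding phi_loop_inv[OF mult_in_SL[OF g bS] Z] inv_SL_mult_distrib[OF g bS] ..
  also have "\<dots> = (one_minus_tinv n ?Z * const_loop ?c) * const_loop (inv\<^bsub>SLK n\<^esub> g)"
    unfolding const_loop_mult[OF C(2) SL_D[OF gS]]
    using one_minus_tinv_SL[OF Z] cS gS by (intro SL_assoc[symmetric]) auto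
  also have "\<dots> = const_loop ?c * (one_minus_tinv n Y * const_loop (inv\<^bsub>SLK n\<^esub> g))"
    unfolding swap using one_minus_tinv_SL[OF Y] cS gS by (intro SL_assoc) auto
  also have "\<dots> = inv\<^bsub>SLF n\<^esub> (phi_loop n g Y * const_loop b)"
    unfolding inv_SL_mult_distrib[OF SLs(2,3)] phi_loop_inv[OF g Y] const_loop_inv[OF bS] ..
  finally have inv_eq: "inv\<^bsub>SLF n\<^esub> (phi_loop n (g * b) ?Z) = inv\<^bsub>SLF n\<^esub> (phi_loop n g Y * const_loop b)" .
  have "phi_loop n (g * b) ?Z = inv\<^bsub>SLF n\<^esub> (inv\<^bsub>SLF n\<^esub> (phi_loop n (g * b) ?Z))"
    by (rule group.inv_inv[OF group_SL SLs(1), symmetric])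
  also have "\<dots> = inv\<^bsub>SLF n\<^esub> (inv\<^bsub>SLF n\<^esub> (phi_loop n g Y * const_loop b))"
    by (simp only: inv_eq)
  also have "\<dots> = phi_loop n g Y * const_loop b"
    by (rule group.inv_inv[OF group_SL mult_in_SL[OF SLs(2,3)]])
  finally show "phi_loop n (g * b) ?Z = phi_loop n g Y * const_loop b" .
qed

text \<open>
  The quotient \<open>\<beta>\<close> of the two loops is a product of three factors without positive powers of \<open>t\<close>,
  and it has no negative powers because it lies in the Iwahori subgroup. So it is constant, and
  the two coefficients of \<open>\<beta> (1 - t\<^sup>-\<^sup>1 Y') = (1 - t\<^sup>-\<^sup>1 Y) c\<close> give the claim.
\<close>

lemma phi_loop_eq_imp:
  assumes g: "g \<in> carrier (SLK n)" "g' \<in> carrier (SLK n)"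
    and Y: "Y \<in> borel_nilradical n" "Y' \<in> borel_nilradical n"
    and eq: "flag_point n (phi_loop n g Y) = flag_point n (phi_loop n g' Y')"
  shows "\<exists>b \<in> borel n. g' = g * b \<and> Y' = inv\<^bsub>SLK n\<^esub> b * Y * b"
proof -
  let ?c = "inv\<^bsub>SLK n\<^esub> g * g'"
  have giS: "inv\<^bsub>SLK n\<^esub> g \<in> carrier (SLK n)" by (rule inv_SL_closed[OF g(1)])
  have cS: "?c \<in> carrier (SLK n)" by (intro mult_in_SL giS g)
  note cC = SL_D[OF cS]
  note YC = nilradical_carrier[OF Y(1)] nilradical_carrier[OF Y(2)]
  note U = one_minus_tinv_SL[OF Y(1)] one_minus_tinv_SL[OF Y(2)] geometric_sum_SL(1)[OF Y(2)]
  define \<beta> where "\<beta> = inv\<^bsub>SLF n\<^esub> (phi_loop n g Y) * phi_loop n g' Y'"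
  have \<beta>: "\<beta> \<in> iwahori n"
    unfolding \<beta>_def using eq flag_point_eq_iff[OF phi_loop_SL[OF g(1) Y(1)] phi_loop_SL[OF g(2) Y(2)]] by simp
  have \<beta>_eq: "\<beta> = one_minus_tinv n Y * const_loop ?c * geometric_sum n Y'"
    unfolding \<beta>_def phi_loop_inv[OF g(1) Y(1)] unfolding phi_loop_def const_loop_mult[OF SL_D[OF giS] SL_D[OF g(2)]]
    using U giS g by (simp add: SL_assoc[of _ n] mult_in_SL)
  have AS: "one_minus_tinv n Y * const_loop ?c \<in> carrier (SLF n)"
    using U(1) cS by (intro mult_in_SL) auto
  have pos: "fls_nth (\<beta> $$ (i, j)) k = 0" if ij: "i < n" "j < n" and k: "k \<noteq> 0" for i j k
  proof (cases "k < 0")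
    case True
    have "int n * k \<le> int n * (- 1)" using True by (intro mult_left_mono) auto
    then show ?thesis using iwahori_nth[OF \<beta> ij, of k] ij by auto
  next
    case False
    show ?thesis
      unfolding \<beta>_eq
    proof (rule mat_mult_nth_eq_0[OF SL_D[OF AS] geometric_sum_carrier ij])
      fix l a b assume l: "l < n" "a + b = k"
      have "fls_nth ((one_minus_tinv n Y * const_loop ?c) $$ (i, l)) a = 0" if "0 < a"
        unfolding one_minus_tinv_const_nth[OF cC YC(1) ij(1) l(1)] using that by simp
      moreover have "fls_nth (geometric_sum n Y' $$ (l, j)) b = 0" if "0 < b"
        unfolding geometric_sum_nth[OF l(1) ij(2)] using that by simp
      ultimately show "fls_nth ((one_minus_tinv n Y * const_loop ?c) $$ (i, l)) a = 0 \<or>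
          fls_nth (geometric_sum n Y' $$ (l, j)) b = 0"
        using False k l(2) by (cases "0 < a") auto
    qed
  qed
  define b where "b = mat n n (\<lambda>(i, j). fls_nth (\<beta> $$ (i, j)) 0)"
  have bC: "b \<in> carrier_mat n n" by (simp add: b_def)
  have \<beta>b: "\<beta> = const_loop b"
  proof (rule eq_matI)
    fix i j assume "i < dim_row (const_loop b)" "j < dim_col (const_loop b)"
    then have ij: "i < n" "j < n" by (simp_all add: const_loop_def b_def)
    show "\<beta> $$ (i, j) = const_loop b $$ (i, j)"
    proof (rule fls_eqI)
      fix k show "fls_nth (\<beta> $$ (i, j)) k = fls_nth (const_loop b $$ (i, j)) k"
        unfolding const_loop_nth[OF bC ij] using pos[OF ij, of k] ij by (simp add: b_def)
    qed
  qed (use SL_D[OF iwahori_SL[OF \<beta>]] in \<open>auto simp: const_loop_def b_def\<close>)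
  have bB: "b \<in> borel n" using \<beta> unfolding \<beta>b const_loop_iwahori .
  have "\<beta> * one_minus_tinv n Y' = one_minus_tinv n Y * const_loop ?c * (geometric_sum n Y' * one_minus_tinv n Y')"
    unfolding \<beta>_eq by (rule SL_assoc[OF AS U(3,2)])
  also have "\<dots> = one_minus_tinv n Y * const_loop ?c"
    unfolding geometric_sum_inverse[OF Y(2)] by (rule right_mult_one_mat[OF SL_D[OF AS]])
  finally have key: "const_loop b * one_minus_tinv n Y' = one_minus_tinv n Y * const_loop ?c" unfolding \<beta>b .
  have coeff: "(if k = 0 then b $$ (i, j) else 0) - (if k = - 1 then (b * Y') $$ (i, j) else 0) =
      (if k = 0 then ?c $$ (i, j) else 0) - (if k = - 1 then (Y * ?c) $$ (i, j) else 0)"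
    if "i < n" "j < n" for i j and k :: int
    using arg_cong[OF key, of "\<lambda>M. fls_nth (M $$ (i, j)) k"]
    unfolding const_one_minus_tinv_nth[OF bC YC(2) that] one_minus_tinv_const_nth[OF cC YC(1) that] .
  have "b $$ (i, j) = ?c $$ (i, j)" if "i < n" "j < n" for i j
    using coeff[OF that, of 0] by simp
  then have bc: "b = ?c" by (rule square_mat_eqI[OF bC cC])
  have "(b * Y') $$ (i, j) = (Y * ?c) $$ (i, j)" if "i < n" "j < n" for i j
    using coeff[OF that, of "- 1"] by simp
  then have "b * Y' = Y * ?c" by (rule square_mat_eqI[OF mult_carrier_mat[OF bC YC(2)] mult_carrier_mat[OF YC(1) cC]])
  then have bY: "b * Y' = Y * b" unfolding bc .
  have bS: "b \<in> carrier (SLK n)" by (rule borel_SL[OF bB])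
  note biC = SL_D[OF inv_SL_closed[OF bS]]
  have "Y' = (inv\<^bsub>SLK n\<^esub> b * b) * Y'" unfolding inv_SL_mult(2)[OF bS] using YC by simp
  also have "\<dots> = inv\<^bsub>SLK n\<^esub> b * (b * Y')" by (rule assoc_mult_mat[OF biC bC YC(2)])
  also have "\<dots> = inv\<^bsub>SLK n\<^esub> b * Y * b" unfolding bY by (rule assoc_mult_mat[OF biC YC(1) bC, symmetric])
  finally have "Y' = inv\<^bsub>SLK n\<^esub> b * Y * b" .
  moreover have "g' = g * b" unfolding bc by (rule SL_cancel(2)[OF g, symmetric])
  ultimately show ?thesis using bB by blast
qed

lemma phi_loop_flag_conj:
  assumes "g \<in> carrier (SLK n)" "Y \<in> borel_nilradical n" "b \<in> borel n"
  shows "flag_point n (phi_loop n (g * b) (inv\<^bsub>SLK n\<^esub> b * Y * b)) = flag_point n (phi_loop n g Y)"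
  unfolding phi_loop_conj(2)[OF assms]
  by (intro flag_point_mult phi_loop_SL assms) (simp add: const_loop_iwahori assms)

text \<open>
  The classes of the cotangent bundle are the fibres of the map on pairs; this contains both that
  \<open>\<phi>\<close> is well defined and that it is injective.
\<close>

lemma cotangent_class:
  assumes g: "g \<in> carrier (SLK n)" and Y: "Y \<in> borel_nilradical n"
  shows "cotangent_rel n `` {(g, Y)} = {(h, Z). h \<in> carrier (SLK n) \<and> Z \<in> borel_nilradical n \<and>
    flag_point n (phi_loop n h Z) = flag_point n (phi_loop n g Y)}"
proof (intro equalityI subsetI)
  fix x assume "x \<in> cotangent_rel n `` {(g, Y)}"
  then obtain b where b: "b \<in> borel n" "x = (g * b, inv\<^bsub>SLK n\<^esub> b * Y * b)"
    by (auto simp: cotangent_rel_def)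
  then show "x \<in> {(h, Z). h \<in> carrier (SLK n) \<and> Z \<in> borel_nilradical n \<and>
    flag_point n (phi_loop n h Z) = flag_point n (phi_loop n g Y)}"
    using phi_loop_flag_conj[OF g Y b(1)] phi_loop_conj(1)[OF g Y b(1)] mult_in_SL[OF g borel_SL[OF b(1)]] by simp
next
  fix x assume "x \<in> {(h, Z). h \<in> carrier (SLK n) \<and> Z \<in> borel_nilradical n \<and>
    flag_point n (phi_loop n h Z) = flag_point n (phi_loop n g Y)}"
  then obtain h Z where x: "x = (h, Z)" and h: "h \<in> carrier (SLK n)" "Z \<in> borel_nilradical n"
    "flag_point n (phi_loop n g Y) = flag_point n (phi_loop n h Z)" by auto
  obtain b where b: "b \<in> borel n" "h = g * b" "Z = inv\<^bsub>SLK n\<^esub> b * Y * b"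
    using phi_loop_eq_imp[OF g h(1) Y h(2,3)] by blast
  have "((g, Y), x) \<in> cotangent_rel n"
    unfolding x b(2,3) cotangent_rel_def mem_Collect_eq
    by (intro exI[of _ g] exI[of _ Y] exI[of _ b] conjI refl g Y b(1))
  then show "x \<in> cotangent_rel n `` {(g, Y)}" by blast
qed

lemma phi_class:
  assumes g: "g \<in> carrier (SLK n)" and Y: "Y \<in> borel_nilradical n"
  shows "phi n (cotangent_rel n `` {(g, Y)}) = flag_point n (phi_loop n g Y)"
proof -
  have "(\<lambda>(g, Y). flag_point n (const_loop g * geometric_sum n Y)) ` (cotangent_rel n `` {(g, Y)}) =
      {flag_point n (phi_loop n g Y)}"
    unfolding phi_loop_def[symmetric]
  proof (intro equalityI subsetI)
    fix x assume "x \<in> (\<lambda>(g, Y). flag_point n (phi_loop n g Y)) ` (cotangent_rel n `` {(g, Y)})"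
    then obtain h Z where "(h, Z) \<in> cotangent_rel n `` {(g, Y)}" "x = flag_point n (phi_loop n h Z)" by auto
    then show "x \<in> {flag_point n (phi_loop n g Y)}"
      unfolding cotangent_class[OF assms] by simp
  next
    fix x assume "x \<in> {flag_point n (phi_loop n g Y)}"
    moreover have "(g, Y) \<in> cotangent_rel n `` {(g, Y)}"
      unfolding cotangent_class[OF assms] using assms by simp
    ultimately show "x \<in> (\<lambda>(g, Y). flag_point n (phi_loop n g Y)) ` (cotangent_rel n `` {(g, Y)})"
      by (intro image_eqI[of _ _ "(g, Y)"]) auto
  qed
  then show ?thesis unfolding phi_def by (simp only: the_elem_eq)
qed

lemma phi_image:
  "phi n ` cotangent_bundle n =
    {flag_point n (phi_loop n g Y) | g Y. g \<in> carrier (SLK n) \<and> Y \<in> borel_nilradical n}"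
proof -
  have "cotangent_bundle n =
      {cotangent_rel n `` {(g, Y)} | g Y. g \<in> carrier (SLK n) \<and> Y \<in> borel_nilradical n}"
    by (auto simp: cotangent_bundle_def quotient_def)
  also have "phi n ` \<dots> =
      {flag_point n (phi_loop n g Y) | g Y. g \<in> carrier (SLK n) \<and> Y \<in> borel_nilradical n}"
  proof (intro equalityI subsetI)
    fix x assume "x \<in> phi n ` {cotangent_rel n `` {(g, Y)} | g Y. g \<in> carrier (SLK n) \<and> Y \<in> borel_nilradical n}"
    then obtain g Y where g: "g \<in> carrier (SLK n)" "Y \<in> borel_nilradical n"
      and x: "x = phi n (cotangent_rel n `` {(g, Y)})" by blast
    show "x \<in> {flag_point n (phi_loop n g Y) | g Y. g \<in> carrier (SLK n) \<and> Y \<in> borel_nilradical n}"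
      unfolding x phi_class[OF g] using g by blast
  next
    fix x assume "x \<in> {flag_point n (phi_loop n g Y) | g Y. g \<in> carrier (SLK n) \<and> Y \<in> borel_nilradical n}"
    then obtain g Y where g: "g \<in> carrier (SLK n)" "Y \<in> borel_nilradical n"
      and x: "x = flag_point n (phi_loop n g Y)" by blast
    show "x \<in> phi n ` {cotangent_rel n `` {(g, Y)} | g Y. g \<in> carrier (SLK n) \<and> Y \<in> borel_nilradical n}"
      unfolding x phi_class[OF g, symmetric] using g by blast
  qed
  finally show ?thesis .
qed

lemma phi_inj: "inj_on (phi n) (cotangent_bundle n)"
proof (rule inj_onI)
  fix E E' assume E: "E \<in> cotangent_bundle n" "E' \<in> cotangent_bundle n" "phi n E = phi n E'"
  obtain g Y where g: "g \<in> carrier (SLK n)" "Y \<in> borel_nilradical n" "E = cotangent_rel n `` {(g, Y)}"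
    using E(1) by (auto simp: cotangent_bundle_def quotient_def)
  obtain h Z where h: "h \<in> carrier (SLK n)" "Z \<in> borel_nilradical n" "E' = cotangent_rel n `` {(h, Z)}"
    using E(2) by (auto simp: cotangent_bundle_def quotient_def)
  have "flag_point n (phi_loop n g Y) = flag_point n (phi_loop n h Z)"
    using E(3) g h phi_class by simp
  then show "E = E'"
    unfolding g(3) h(3) cotangent_class[OF g(1,2)] cotangent_class[OF h(1,2)] by simp
qed

lemma phi_image_G_stable: "G_stable n (phi n ` cotangent_bundle n)"
  unfolding G_stable_def phi_image
proof (intro ballI)
  fix a x assume a: "a \<in> carrier (SLK n)"
    and "x \<in> {flag_point n (phi_loop n g Y) | g Y. g \<in> carrier (SLK n) \<and> Y \<in> borel_nilradical n}"
  then obtain g Y where x: "x = flag_point n (phi_loop n g Y)" and g: "g \<in> carrier (SLK n)" "Y \<in> borel_nilradical n"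
    by blast
  have "const_loop a <#\<^bsub>SLF n\<^esub> x = flag_point n (const_loop a * phi_loop n g Y)"
    unfolding x using a phi_loop_SL[OF g] by (intro l_coset_flag_point) auto
  also have "const_loop a * phi_loop n g Y = phi_loop n (a * g) Y"
    unfolding phi_loop_def const_loop_mult[OF SL_D[OF a] SL_D[OF g(1)]]
    using a g geometric_sum_SL(1)[OF g(2)] by (intro SL_assoc[symmetric]) auto
  finally show "const_loop a <#\<^bsub>SLF n\<^esub> x \<in>
      {flag_point n (phi_loop n g Y) | g Y. g \<in> carrier (SLK n) \<and> Y \<in> borel_nilradical n}"
    using mult_in_SL[OF a g(1)] g(2) by blast
qed

section \<open>Irreducibility of the image\<close>

text \<open>
  The functions of one variable that are rational with a power of \<open>d\<close> as denominator.
\<close>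

definition rational_off :: "(complex \<Rightarrow> complex) \<Rightarrow> (complex \<Rightarrow> complex) \<Rightarrow> bool" where
  "rational_off d u \<longleftrightarrow> (\<exists>P k. \<forall>s. d s \<noteq> 0 \<longrightarrow> u s * d s ^ k = poly P s)"

lemma rational_off_poly: "(\<And>s. u s = poly P s) \<Longrightarrow> rational_off d u"
  unfolding rational_off_def by (intro exI[of _ P] exI[of _ 0]) simp

lemma rational_off_const: "rational_off d (\<lambda>_. c)"
  by (rule rational_off_poly[of _ "[:c:]"]) simp

lemma rational_off_add:
  assumes d: "\<And>s. d s = poly Q s" and "rational_off d u" "rational_off d v"
  shows "rational_off d (\<lambda>s. u s + v s)"
proof -
  obtain P k where P: "\<And>s. d s \<noteq> 0 \<Longrightarrow> u s * d s ^ k = poly P s" using assms(2) by (auto simp: rational_off_def)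
  obtain R l where R: "\<And>s. d s \<noteq> 0 \<Longrightarrow> v s * d s ^ l = poly R s" using assms(3) by (auto simp: rational_off_def)
  have "(u s + v s) * d s ^ (k + l) = poly (P * Q ^ l + R * Q ^ k) s" if "d s \<noteq> 0" for s
  proof -
    have "(u s + v s) * d s ^ (k + l) = (u s * d s ^ k) * d s ^ l + (v s * d s ^ l) * d s ^ k"
      by (simp add: power_add algebra_simps)
    then show ?thesis unfolding P[OF that] R[OF that] by (simp add: d)
  qed
  then show ?thesis unfolding rational_off_def by blast
qed

lemma rational_off_mult:
  assumes "rational_off d u" "rational_off d v"
  shows "rational_off d (\<lambda>s. u s * v s)"
proof -
  obtain P k where P: "\<And>s. d s \<noteq> 0 \<Longrightarrow> u s * d s ^ k = poly P s" using assms(1) by (auto simp: rational_off_def)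
  obtain R l where R: "\<And>s. d s \<noteq> 0 \<Longrightarrow> v s * d s ^ l = poly R s" using assms(2) by (auto simp: rational_off_def)
  have "(u s * v s) * d s ^ (k + l) = poly (P * R) s" if "d s \<noteq> 0" for s
  proof -
    have "(u s * v s) * d s ^ (k + l) = (u s * d s ^ k) * (v s * d s ^ l)" by (simp add: power_add mult_ac)
    then show ?thesis using P[OF that] R[OF that] by simp
  qed
  then show ?thesis unfolding rational_off_def by blast
qed

lemma rational_off_sum:
  assumes d: "\<And>s. d s = poly Q s" and "finite S" "\<And>x. x \<in> S \<Longrightarrow> rational_off d (u x)"
  shows "rational_off d (\<lambda>s. \<Sum>x\<in>S. u x s)"
  using assms(2,3)
  by (induction S rule: finite_induct) (simp_all add: rational_off_const rational_off_add[OF d])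

lemma rational_off_inverse: "rational_off d (\<lambda>s. inverse (d s))"
  unfolding rational_off_def by (intro exI[of _ 1] exI[of _ 1]) simp

text \<open>
  Two nonzero polynomials cannot have a vanishing product.
\<close>

lemma rational_off_product_zero:
  assumes d: "\<And>s. d s = poly Q s" and u: "rational_off d u" and v: "rational_off d v"
    and zero: "\<And>s. d s \<noteq> 0 \<Longrightarrow> u s * v s = 0"
    and pts: "d a \<noteq> 0" "u a \<noteq> 0" "d b \<noteq> 0" "v b \<noteq> 0"
  shows False
proof -
  obtain P k where P: "\<And>s. d s \<noteq> 0 \<Longrightarrow> u s * d s ^ k = poly P s" using u by (auto simp: rational_off_def)
  obtain R l where R: "\<And>s. d s \<noteq> 0 \<Longrightarrow> v s * d s ^ l = poly R s" using v by (auto simp: rational_off_def)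
  have "poly P a \<noteq> 0" "poly R b \<noteq> 0" "poly Q a \<noteq> 0"
    using P[OF pts(1)] R[OF pts(3)] pts by (auto simp: d[symmetric] power_not_zero dest: sym)
  then have "P * R * Q \<noteq> 0" by auto
  then have "finite {s. poly (P * R * Q) s = 0}" by (rule poly_roots_finite)
  then have "{s. poly (P * R * Q) s = 0} \<noteq> UNIV" using infinite_UNIV_char_0[where 'a = complex] by metis
  then obtain s where s: "poly (P * R * Q) s \<noteq> 0" by blast
  then have ds: "d s \<noteq> 0" by (simp add: d)
  have "u s * d s ^ k \<noteq> 0" "v s * d s ^ l \<noteq> 0" using P[OF ds] R[OF ds] s by auto
  then show False using zero[OF ds] by simp
qed

definition segment_mat :: "nat \<Rightarrow> complex mat \<Rightarrow> complex mat \<Rightarrow> complex \<Rightarrow> complex mat" where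
  "segment_mat n A B s = mat n n (\<lambda>(i, j). A $$ (i, j) + s * (B $$ (i, j) - A $$ (i, j)))"

lemma segment_mat_ends:
  "A \<in> carrier_mat n n \<Longrightarrow> segment_mat n A B 0 = A" "B \<in> carrier_mat n n \<Longrightarrow> segment_mat n A B 1 = B"
  by (auto simp: segment_mat_def)

lemma segment_mat_carrier [simp]: "segment_mat n A B s \<in> carrier_mat n n"
  and segment_mat_dim [simp]: "dim_row (segment_mat n A B s) = n" "dim_col (segment_mat n A B s) = n"
  by (simp_all add: segment_mat_def)

lemma det_segment_mat: "\<exists>Q. \<forall>s. det (segment_mat n A B s) = poly Q s"
proof -
  let ?M = "mat n n (\<lambda>(i, j). [:A $$ (i, j), B $$ (i, j) - A $$ (i, j):])"
  have "det (segment_mat n A B s) = poly (det ?M) s" for s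
  proof -
    have hom: "comm_ring_hom (\<lambda>p. poly p s)" by unfold_locales auto
    have "segment_mat n A B s = map_mat (\<lambda>p. poly p s) ?M"
      by (rule eq_matI) (auto simp: segment_mat_def)
    then show ?thesis by (simp only: comm_ring_hom.hom_det[OF hom])
  qed
  then show ?thesis by blast
qed

text \<open>
  A rational curve in \<open>SL\<^sub>n\<close> from \<open>A\<close> to \<open>B\<close>: the first row of the straight segment is divided by
  the determinant.
\<close>

definition SL_path :: "nat \<Rightarrow> complex mat \<Rightarrow> complex mat \<Rightarrow> complex \<Rightarrow> complex mat" where
  "SL_path n A B s = multrow 0 (inverse (det (segment_mat n A B s))) (segment_mat n A B s)"

lemma SL_path_index:
  assumes "i < n" "j < n"
  shows "SL_path n A B s $$ (i, j) =
    (if i = 0 then inverse (det (segment_mat n A B s)) else 1) * segment_mat n A B s $$ (i, j)"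
  using assms by (simp add: SL_path_def)

lemma SL_path_SL:
  assumes "0 < n" "det (segment_mat n A B s) \<noteq> 0"
  shows "SL_path n A B s \<in> carrier (SLK n)"
  using assms det_multrow[OF assms(1) segment_mat_carrier, of _ A B s]
  by (simp add: carrier_SL SL_path_def)

lemma SL_path_ends:
  assumes "A \<in> carrier (SLK n)" "B \<in> carrier (SLK n)"
  shows "SL_path n A B 0 = A" "SL_path n A B 1 = B"
proof -
  have C: "A \<in> carrier_mat n n" "B \<in> carrier_mat n n" "det A = 1" "det B = 1"
    using assms by (auto simp: carrier_SL)
  have "multrow 0 1 M = M" for M :: "complex mat" by (rule eq_matI) auto
  then show "SL_path n A B 0 = A" "SL_path n A B 1 = B"
    by (simp_all add: SL_path_def segment_mat_ends C)
qed

lemma segment_nilradical: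
  "Y \<in> borel_nilradical n \<Longrightarrow> Z \<in> borel_nilradical n \<Longrightarrow> segment_mat n Y Z s \<in> borel_nilradical n"
  by (simp add: borel_nilradical_def segment_mat_def)

lemma phi_loop_nth:
  assumes g: "g \<in> carrier_mat n n" and ij: "i < n" "j < n"
  shows "fls_nth (phi_loop n g Y $$ (i, j)) k =
    (if - int n < k \<and> k \<le> 0 then \<Sum>l<n. g $$ (i, l) * (Y ^\<^sub>m nat (- k)) $$ (l, j) else 0)"
proof (cases "- int n < k \<and> k \<le> 0")
  case True
  then show ?thesis
    unfolding phi_loop_def const_loop_mult_nth[OF g geometric_sum_carrier ij]
    using ij by (simp add: geometric_sum_nth)
next
  case False
  have "(\<Sum>l<n. g $$ (i, l) * fls_nth (geometric_sum n Y $$ (l, j)) k) = 0"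
    using ij False by (intro sum.neutral) (auto simp: geometric_sum_nth)
  then show ?thesis
    unfolding phi_loop_def const_loop_mult_nth[OF g geometric_sum_carrier ij] if_not_P[OF False] .
qed

lemma phi_loop_stage:
  assumes "g \<in> carrier (SLK n)" "Y \<in> borel_nilradical n"
  shows "phi_loop n g Y \<in> loop_stage n n"
  using phi_loop_SL[OF assms] phi_loop_nth[OF SL_D[OF assms(1)]] by (simp add: loop_stage_def)

text \<open>
  Regular functions are polynomials in the coefficients, and along the path these are polynomial
  expressions in the entries of the two matrices.
\<close>

lemma loop_regular_rational_path:
  fixes n :: nat and A B Y Z :: "complex mat"
  defines "d \<equiv> \<lambda>s. det (segment_mat n A B s)"
  assumes "p \<in> loop_regular n"
  shows "rational_off d (\<lambda>s. p (phi_loop n (SL_path n A B s) (segment_mat n Y Z s)))"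
proof -
  obtain Q where Q: "\<And>s. d s = poly Q s" using det_segment_mat[of n A B] unfolding d_def by blast
  have seg: "rational_off d (\<lambda>s. segment_mat n C D s $$ (i, j))" if "i < n" "j < n" for C D i j
    by (rule rational_off_poly[of _ "[:C $$ (i, j), D $$ (i, j) - C $$ (i, j):]"])
      (use that in \<open>simp add: segment_mat_def\<close>)
  have path: "rational_off d (\<lambda>s. SL_path n A B s $$ (i, j))" if ij: "i < n" "j < n" for i j
  proof (cases "i = 0")
    case True
    have "rational_off d (\<lambda>s. inverse (d s) * segment_mat n A B s $$ (i, j))"
      by (intro rational_off_mult rational_off_inverse seg ij)
    then show ?thesis unfolding SL_path_index[OF ij] d_def using True by simp
  next
    case False
    then show ?thesis unfolding SL_path_index[OF ij] using seg[OF ij] by simp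
  qed
  have power: "rational_off d (\<lambda>s. (segment_mat n Y Z s ^\<^sub>m m) $$ (i, j))" if "i < n" "j < n" for i j m
    using that
  proof (induction m arbitrary: j)
    case 0
    have "(segment_mat n Y Z s ^\<^sub>m 0) $$ (i, j) = (if i = j then 1 else 0)" for s
      using 0 segment_mat_carrier[of n Y Z s] by simp
    then show ?case by (simp only: rational_off_const)
  next
    case (Suc m)
    have "(segment_mat n Y Z s ^\<^sub>m Suc m) $$ (i, j) =
        (\<Sum>l<n. (segment_mat n Y Z s ^\<^sub>m m) $$ (i, l) * segment_mat n Y Z s $$ (l, j))" for s
      unfolding pow_mat.simps(2)
      by (rule mat_mult_index[OF pow_carrier_mat[OF segment_mat_carrier] segment_mat_carrier Suc.prems])
    moreover have "rational_off d (\<lambda>s. \<Sum>l<n. (segment_mat n Y Z s ^\<^sub>m m) $$ (i, l) * segment_mat n Y Z s $$ (l, j))"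
      using Suc by (intro rational_off_sum[OF Q] rational_off_mult seg) auto
    ultimately show ?case by simp
  qed
  show ?thesis
    using assms(2)
  proof (induction p rule: loop_regular.induct)
    case (const c)
    show ?case by (rule rational_off_const)
  next
    case (coeff i j k)
    have C: "SL_path n A B s \<in> carrier_mat n n" for s by (simp add: SL_path_def)
    show ?case
    proof (cases "- int n < k \<and> k \<le> 0")
      case True
      have "rational_off d (\<lambda>s. \<Sum>l<n. SL_path n A B s $$ (i, l) * (segment_mat n Y Z s ^\<^sub>m nat (- k)) $$ (l, j))"
        using coeff by (intro rational_off_sum[OF Q] rational_off_mult path power) auto
      then show ?thesis unfolding phi_loop_nth[OF C coeff] using True by simp
    next
      case False
      then show ?thesis unfolding phi_loop_nth[OF C coeff] if_not_P[OF False] by (intro rational_off_const)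
    qed
  next
    case (add p q)
    show ?case by (rule rational_off_add[OF Q add.IH])
  next
    case (mult p q)
    show ?case by (rule rational_off_mult[OF mult.IH])
  qed
qed

text \<open>
  Suppose that one point of the image is outside \<open>C\<close> and another is outside \<open>D\<close>, and choose
  regular functions that vanish on \<open>C\<close> and on \<open>D\<close> but not at these points. Join the points by a
  rational curve in the image. Along the curve the product of the two functions is zero although
  neither of them is.
\<close>

lemma phi_image_irreducible:
  assumes n: "0 < n"
  shows "irreducible_in (affine_flag_topology n) (phi n ` cotangent_bundle n)"
  unfolding irreducible_in_def phi_image topspace_affine_flag_topology
proof (intro conjI allI impI)
  let ?S = "{flag_point n (phi_loop n g Y) | g Y. g \<in> carrier (SLK n) \<and> Y \<in> borel_nilradical n}"
  show "?S \<subseteq> affine_flags n" using phi_loop_SL by (auto simp: affine_flags_eq)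
  have "1\<^sub>m n \<in> carrier (SLK n)" "0\<^sub>m n n \<in> borel_nilradical n"
    by (auto simp: carrier_SL borel_nilradical_def)
  then show "?S \<noteq> {}" by blast
  fix C D assume CD: "closedin (affine_flag_topology n) C" "closedin (affine_flag_topology n) D" "?S \<subseteq> C \<union> D"
  show "?S \<subseteq> C \<or> ?S \<subseteq> D"
  proof (rule ccontr)
    assume "\<not> ?thesis"
    then obtain A Y B Z where A: "A \<in> carrier (SLK n)" "Y \<in> borel_nilradical n" "flag_point n (phi_loop n A Y) \<notin> C"
      and B: "B \<in> carrier (SLK n)" "Z \<in> borel_nilradical n" "flag_point n (phi_loop n B Z) \<notin> D" by blast
    obtain P where P: "P \<subseteq> loop_regular n" "{g \<in> loop_stage n n. flag_point n g \<in> C} = loop_zeros n n P"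
      using CD(1) unfolding closedin_flag_iff by blast
    obtain R where R: "R \<subseteq> loop_regular n" "{g \<in> loop_stage n n. flag_point n g \<in> D} = loop_zeros n n R"
      using CD(2) unfolding closedin_flag_iff by blast
    have memC: "flag_point n g \<in> C \<longleftrightarrow> (\<forall>p\<in>P. p g = 0)" and memD: "flag_point n g \<in> D \<longleftrightarrow> (\<forall>p\<in>R. p g = 0)"
      if g: "g \<in> loop_stage n n" for g
      using g eqset_imp_iff[OF P(2), of g] eqset_imp_iff[OF R(2), of g] by (simp_all add: mem_loop_zeros)
    obtain p where p: "p \<in> P" "p (phi_loop n A Y) \<noteq> 0" using A(3) memC[OF phi_loop_stage[OF A(1,2)]] by blast
    obtain q where q: "q \<in> R" "q (phi_loop n B Z) \<noteq> 0" using B(3) memD[OF phi_loop_stage[OF B(1,2)]] by blast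
    let ?c = "\<lambda>s. phi_loop n (SL_path n A B s) (segment_mat n Y Z s)"
    let ?d = "\<lambda>s. det (segment_mat n A B s)"
    obtain Q where Q: "\<And>s. ?d s = poly Q s" using det_segment_mat[of n A B] by blast
    have ends: "?c 0 = phi_loop n A Y" "?c 1 = phi_loop n B Z" "?d 0 \<noteq> 0" "?d 1 \<noteq> 0"
      using A B nilradical_carrier[OF A(2)] nilradical_carrier[OF B(2)]
      by (simp_all add: SL_path_ends segment_mat_ends SL_D) (simp_all add: carrier_SL)
    have "p (?c s) * q (?c s) = 0" if "?d s \<noteq> 0" for s
    proof -
      have g: "SL_path n A B s \<in> carrier (SLK n)" "segment_mat n Y Z s \<in> borel_nilradical n"
        using SL_path_SL[OF n that] segment_nilradical[OF A(2) B(2)] by auto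
      then have "flag_point n (?c s) \<in> C \<union> D" using CD(3) by blast
      then show ?thesis using memC[OF phi_loop_stage[OF g]] memD[OF phi_loop_stage[OF g]] p(1) q(1) by auto
    qed
    moreover have "rational_off ?d (\<lambda>s. p (?c s))" "rational_off ?d (\<lambda>s. q (?c s))"
      using p(1) q(1) P(1) R(1) by (auto intro!: loop_regular_rational_path)
    ultimately show False
      using rational_off_product_zero[OF Q, of "\<lambda>s. p (?c s)" "\<lambda>s. q (?c s)" 0 1] ends p(2) q(2) by simp
  qed
qed

section \<open>The closure of the cotangent bundle\<close>

theorem theorem6p4:
  fixes n :: nat
  assumes "n \<ge> 2"
  shows "inj_on (phi n) (cotangent_bundle n) \<and>
    closed_subvariety n (affine_flag_topology n closure_of (phi n ` cotangent_bundle n)) \<and>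
    G_stable n (affine_flag_topology n closure_of (phi n ` cotangent_bundle n)) \<and>
    affine_flag_topology n closure_of (phi n ` cotangent_bundle n) \<subseteq> affine_schubert n (kappa0 n)"
proof -
  let ?S = "phi n ` cotangent_bundle n"
  let ?cl = "affine_flag_topology n closure_of ?S"
  have irr: "irreducible_in (affine_flag_topology n) ?S"
    using assms by (intro phi_image_irreducible) auto
  then have sub: "?S \<subseteq> affine_flags n" by (simp add: irreducible_in_def topspace_affine_flag_topology)
  have "?S \<subseteq> flag_point n ` bounded_loops n"
    unfolding phi_image using phi_loop_bounded[OF assms] by blast
  then have cl: "?cl \<subseteq> flag_point n ` bounded_loops n"
    by (rule closure_of_minimal) (rule bounded_flags_closed)
  obtain M where "bounded_loops n \<subseteq> loop_stage n M" using bounded_loops_stage by blast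
  then have "?cl \<subseteq> flag_point n ` loop_stage n M" using cl by blast
  then have "closed_subvariety n ?cl"
    unfolding closed_subvariety_def using irreducible_closure[OF irr] by auto
  moreover have "?cl \<subseteq> affine_schubert n (kappa0 n)"
    using cl bounded_loops_schubert[OF assms] by blast
  ultimately show ?thesis
    using phi_inj G_stable_closure[OF sub phi_image_G_stable] by blast
qed

end
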